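(* Consider the system $$\dot\alpha=\omega(A)+\varepsilon F(\alpha,A,C,t),\qquad \dot A=\varepsilon G(\alpha,A,C,t),$$ and let $A_0\in W$ be such that $\omega(A_0)=p/q$. Assume that: (i) $\omega'(A_0)\neq 0$; (ii) there exists an analytic curve $t\mapsto C_0(t)$ from $[0,2\pi)$ to $\mathbb{R}$, $2\pi$-periodic, such that $M(t_0,C_0(t_0))=0$ and $\frac{\partial M}{\partial C}(t_0,C_0(t_0))\neq 0$ for all $t_0\in[0,2\pi)$, where $M$ is the subharmonic Melnikov function; (iii) if $t_m$ and $t_M$ are the values in $[0,2\pi)$ for which the function $C_0(t_0)$ attains its minimum and its maximum, respectively, then $C_0''(t_m)\,C_0''(t_M)\neq 0$. Then there exist $\varepsilon_0>0$ and two functions $\gamma_1(\varepsilon)$ and $\gamma_2(\varepsilon)$, analytic for $|\varepsilon|<\varepsilon_0$, with $\gamma_1(0)=\gamma_2(0)$, $\gamma_1(\varepsilon)>\gamma_2(\varepsilon)$ for $\varepsilon>0$ and $\gamma_1(\varepsilon)<\gamma_2(\varepsilon)$ for $\varepsilon<0$, and with different tangent lines at the origin, such that the system has at least one subharmonic solution of order $q/p$ for $\gamma_2(\varepsilon)\le\varepsilon C\le\gamma_1(\varepsilon)$ when $\varepsilon\in(0,\varepsilon_0)$ and for $\gamma_1(\varepsilon)\le\varepsilon C\le\gamma_2(\varepsilon)$ when $\varepsilon\in(-\varepsilon_0,0)$.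
   Context: Here $(\alpha,A)\in\mathbb{T}\times W$ with $\mathbb{T}=\mathbb{R}/2\pi\mathbb{Z}$ and $W\subset\mathbb{R}$ open; $\omega:W\to\mathbb{R}$ is analytic; $F,G$ are real-valued, analytic in their arguments, and $2\pi$-periodic in $\alpha$ and $t$; $\varepsilon,C$ are real parameters; $p,q$ are relatively prime nonzero integers with $q\ge1$; $T=2\pi q$. Primes on $C_0$ denote derivatives with respect to $t_0$. Subharmonic Melnikov function: with $\alpha_0(t)=\omega(A_0)t$, $$M(t_0,C)=\frac1T\int_0^T G(\alpha_0(t),A_0,C,t+t_0)\,dt .$$ Subharmonic solution of order $q/p$ at parameter values $(\varepsilon_*,C_* )$: a solution $(\alpha(t),A(t))$ of the system such that $A(t)$ and $\alpha(t)-(p/q)t$ are periodic with period $T=2\pi q$ and which continues an unperturbed solution on the torus $\{A=A_0\}$, i.e. it is the member at $\varepsilon=\varepsilon_*$ of a family of such solutions depending analytically on $\varepsilon$ in an interval containing $0$ and $\varepsilon_*$, corresponding to an analytic choice $C=C(\varepsilon)$ of the parameter with $\varepsilon_*C(\varepsilon_* )=\varepsilon_*C_*$, and reducing at $\varepsilon=0$ to $((p/q)t+\mathrm{const},A_0)$. *)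

theory Defs
  imports "HOL-Analysis.Analysis"
begin

(* Real analyticity in several variables: near each point of S the function is the sum of an
   (unconditionally, hence absolutely) convergent power series. The coefficients are indexed by
   multi-indices, i.e. maps from the coordinate directions to nat. *)
definition real_analytic_on :: "('a::euclidean_space \<Rightarrow> real) \<Rightarrow> 'a set \<Rightarrow> bool"
  where "real_analytic_on f S \<longleftrightarrow>
    (\<forall>x\<in>S. \<exists>r>0. \<exists>c :: ('a \<Rightarrow> nat) \<Rightarrow> real. \<forall>y\<in>ball x r.
      ((\<lambda>m. c m * (\<Prod>b\<in>Basis. ((y - x) \<bullet> b) ^ m b)) has_sum f y)
        (Basis \<rightarrow>\<^sub>E UNIV))"

lemma real_analytic_on_real_iff:
  fixes f :: "real \<Rightarrow> real"
  shows "real_analytic_on f S \<longleftrightarrow>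
    (\<forall>x\<in>S. \<exists>r>0. \<exists>c :: nat \<Rightarrow> real. \<forall>y\<in>ball x r.
      ((\<lambda>n. c n * (y - x) ^ n) has_sum f y) UNIV)"
proof -
  let ?e = "\<lambda>n::nat. restrict (\<lambda>_. n) {1::real}"
  have bij: "bij_betw ?e UNIV (Basis \<rightarrow>\<^sub>E (UNIV :: nat set))"
  proof (rule bij_betw_byWitness[where f' = "\<lambda>m. m 1"])
    show "\<forall>m\<in>Basis \<rightarrow>\<^sub>E UNIV. ?e (m 1) = m"
      by (auto simp: fun_eq_iff PiE_def extensional_def)
  qed (auto split: if_splits)
  have re: "((\<lambda>m. c m * (\<Prod>b\<in>Basis. ((y - x) \<bullet> b) ^ m b)) has_sum s) (Basis \<rightarrow>\<^sub>E UNIV)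
      \<longleftrightarrow> ((\<lambda>n. c (?e n) * (y - x) ^ n) has_sum s) UNIV"
    for c :: "(real \<Rightarrow> nat) \<Rightarrow> real" and x y s :: real
    using has_sum_reindex_bij_betw[OF bij,
        of "\<lambda>m. c m * (\<Prod>b\<in>Basis. ((y - x) \<bullet> b) ^ m b)" s]
    by simp
  have ex: "(\<exists>c :: (real \<Rightarrow> nat) \<Rightarrow> real. Q (\<lambda>n. c (?e n))) \<longleftrightarrow> (\<exists>c. Q c)"
    for Q :: "(nat \<Rightarrow> real) \<Rightarrow> bool"
  proof
    assume "\<exists>c. Q c"
    then obtain c where "Q c" ..
    then show "\<exists>c :: (real \<Rightarrow> nat) \<Rightarrow> real. Q (\<lambda>n. c (?e n))"
      by (intro exI[of _ "\<lambda>m. c (m 1)"]) simp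
  qed auto
  show ?thesis
    unfolding real_analytic_on_def re
    by (subst ex[of "\<lambda>c. \<forall>y\<in>ball x r. ((\<lambda>n. c n * (y - x) ^ n) has_sum f y) UNIV" for x r])
       (rule refl)
qed

(* Arguments of the vector field components are ordered as alpha, A, C, t. The angle alpha lives
   on the circle: the right-hand sides are 2 pi-periodic in it, and solutions are described by
   their real-valued lifts. *)
definition admissible_perturbation ::
    "real set \<Rightarrow> (real \<Rightarrow> real \<Rightarrow> real \<Rightarrow> real \<Rightarrow> real) \<Rightarrow> bool"
  where "admissible_perturbation W H \<longleftrightarrow>
    real_analytic_on (\<lambda>(a, A, C, t). H a A C t) (UNIV \<times> W \<times> UNIV \<times> UNIV) \<and>
    (\<forall>a C t. \<forall>A\<in>W. H (a + 2 * pi) A C t = H a A C t \<and> H a A C (t + 2 * pi) = H a A C t)"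

definition solves_system ::
    "real set \<Rightarrow> (real \<Rightarrow> real) \<Rightarrow> (real \<Rightarrow> real \<Rightarrow> real \<Rightarrow> real \<Rightarrow> real) \<Rightarrow>
     (real \<Rightarrow> real \<Rightarrow> real \<Rightarrow> real \<Rightarrow> real) \<Rightarrow> real \<Rightarrow> real \<Rightarrow> (real \<Rightarrow> real) \<Rightarrow> (real \<Rightarrow> real) \<Rightarrow> bool"
  where "solves_system W \<omega> F G \<epsilon> C \<alpha> A \<longleftrightarrow>
    (\<forall>t. A t \<in> W \<and>
         (\<alpha> has_real_derivative \<omega> (A t) + \<epsilon> * F (\<alpha> t) (A t) C t) (at t) \<and>
         (A has_real_derivative \<epsilon> * G (\<alpha> t) (A t) C t) (at t))"

definition resonant_periodic :: "int \<Rightarrow> int \<Rightarrow> (real \<Rightarrow> real) \<Rightarrow> (real \<Rightarrow> real) \<Rightarrow> bool"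
  where "resonant_periodic p q \<alpha> A \<longleftrightarrow>
    (let T = 2 * pi * of_int q; \<beta> = (\<lambda>t. \<alpha> t - of_int p / of_int q * t)
     in \<forall>t. A (t + T) = A t \<and> \<beta> (t + T) = \<beta> t)"

(* The interval I of the continuation parameter is taken open, so that analyticity at its points
   (in particular at eps itself) is the usual two-sided notion. Analytic dependence of the family
   is joint analyticity in (parameter, time). *)
definition subharmonic_solution ::
    "real set \<Rightarrow> (real \<Rightarrow> real) \<Rightarrow> (real \<Rightarrow> real \<Rightarrow> real \<Rightarrow> real \<Rightarrow> real) \<Rightarrow>
     (real \<Rightarrow> real \<Rightarrow> real \<Rightarrow> real \<Rightarrow> real) \<Rightarrow> real \<Rightarrow> int \<Rightarrow> int \<Rightarrow> real \<Rightarrow> real \<Rightarrow>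
     (real \<Rightarrow> real) \<Rightarrow> (real \<Rightarrow> real) \<Rightarrow> bool"
  where "subharmonic_solution W \<omega> F G A\<^sub>0 p q \<epsilon> C \<alpha> A \<longleftrightarrow>
    solves_system W \<omega> F G \<epsilon> C \<alpha> A \<and> resonant_periodic p q \<alpha> A \<and>
    (\<exists>I c a b.
       open I \<and> is_interval I \<and> 0 \<in> I \<and> \<epsilon> \<in> I \<and>
       real_analytic_on c I \<and>
       real_analytic_on (\<lambda>(e, t). a e t) (I \<times> UNIV) \<and>
       real_analytic_on (\<lambda>(e, t). b e t) (I \<times> UNIV) \<and>
       (\<forall>e\<in>I. solves_system W \<omega> F G e (c e) (a e) (b e) \<and> resonant_periodic p q (a e) (b e)) \<and>
       \<epsilon> * c \<epsilon> = \<epsilon> * C \<and> a \<epsilon> = \<alpha> \<and> b \<epsilon> = A \<and>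
       (\<exists>k. \<forall>t. a 0 t = of_int p / of_int q * t + k \<and> b 0 t = A\<^sub>0))"

definition subharmonic_Melnikov ::
    "(real \<Rightarrow> real) \<Rightarrow> (real \<Rightarrow> real \<Rightarrow> real \<Rightarrow> real \<Rightarrow> real) \<Rightarrow> real \<Rightarrow> int \<Rightarrow> real \<Rightarrow> real \<Rightarrow> real"
  where "subharmonic_Melnikov \<omega> G A\<^sub>0 q t\<^sub>0 C =
    (let T = 2 * pi * of_int q
     in 1 / T * integral {0..T} (\<lambda>t. G (\<omega> A\<^sub>0 * t) A\<^sub>0 C (t + t\<^sub>0)))"

end

theory Submission
  imports Defs "HOL-Complex_Analysis.Complex_Analysis"
begin

text \<open>
  The claim asks for subharmonic solutions in some sector bounded by two analytic curves with
  different tangents, and a sector bounded by straight lines \<open>\<epsilon> (C\<^sub>1 - c)\<close> and \<open>\<epsilon> (C\<^sub>1 + c)\<close> is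
  enough. So it suffices to find, for all \<open>C\<close> in a neighbourhood of a single value \<open>C\<^sub>1\<close> and with a
  common bound on \<open>\<epsilon>\<close>, an analytic family of periodic solutions with the parameter \<open>C\<close> held fixed.

  The nondegenerate extrema make \<open>C\<^sub>0\<close> nonconstant, so that \<open>C\<^sub>0' t\<^sub>1 \<noteq> 0\<close> for some \<open>t\<^sub>1\<close>; put \<open>C\<^sub>1 = C\<^sub>0 t\<^sub>1\<close>.
  Differentiating the identity \<open>M (t, C\<^sub>0 t) = 0\<close> shows that \<open>\<partial>M/\<partial>t\<^sub>0\<close> does not vanish at \<open>(t\<^sub>1, C\<^sub>1)\<close>
  (\<open>Melnikov_phase_derivative_nonzero\<close>). Hence near this point the Melnikov equation can be solved for
  the phase when the parameter is given, and the same is true of the perturbed problem: the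
  solution is sought as \<open>\<alpha> = \<Omega> t + k + X\<close>, \<open>A = A\<^sub>0 + Y\<close> with \<open>\<Omega> = p/q\<close>, a constant phase \<open>k\<close> and
  periodic corrections, where
  \<open>Y' = \<epsilon> G\<close> and \<open>X' = \<omega>' (A\<^sub>0) Y + f\<close>, the term \<open>f\<close> collecting \<open>\<epsilon> F\<close> and the part of \<open>\<omega>\<close> of second order.
  Periodicity demands that \<open>G\<close> has mean zero, which determines the phase, and that \<open>\<omega>' (A\<^sub>0) Y + f\<close> has
  mean zero, which determines the mean of \<open>Y\<close> because \<open>\<omega>' (A\<^sub>0) \<noteq> 0\<close>. These conditions together with
  the zero-mean primitives of both equations form a fixed point problem. It is a contraction in the
  sup norm because the new \<open>Y\<close> and, computed from it, the new \<open>X\<close> depend on the old state only through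
  \<open>\<epsilon>\<close> and through second order terms, and the new \<open>k\<close> is a Newton step.

  For analyticity the fixed point problem is solved in functions of complex \<open>\<epsilon>\<close> in a disc and
  complex \<open>t\<close> in a strip, holomorphic in each variable and real at real arguments. These properties
  survive every step of the iteration and uniform limits (\<open>contraction_fixpoint_in_closed_class\<close>,
  \<open>fixpoint_exists\<close>). Two bridges connect this with real analyticity as convergence of power series.
  On the way in, the local power series of \<open>F\<close> and \<open>G\<close> glue to periodic holomorphic functions with
  uniform bounds near the torus (\<open>complex_extension_exists\<close>). On the way out, a separately holomorphic
  function has a double power series, by Cauchy estimates (\<open>sep_holomorphic_imp_real_analytic\<close>).
\<close>

section \<open>Holomorphic extension of real-analytic functions\<close>

text \<open>A point of the complexified space is given by its complex coordinates, a function on the basis of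
the real space; this makes the complexification available for every Euclidean space at once.\<close>

definition polydisc :: "'a::euclidean_space \<Rightarrow> real \<Rightarrow> ('a \<Rightarrow> complex) set"
  where "polydisc x \<rho> = {z. \<forall>b\<in>Basis. norm (z b - of_real (x \<bullet> b)) < \<rho>}"

text \<open>Summability is demanded at the corner of the polydisc, where it dominates all terms of the
series in the whole polydisc. That the real polydisc lies in \<open>S\<close> is recorded because the values
of \<open>f\<close> are only controlled there: a periodicity of \<open>f\<close> on \<open>S\<close> then carries over to expansions.\<close>

definition expands ::
    "'a::euclidean_space set \<Rightarrow> ('a \<Rightarrow> real) \<Rightarrow> 'a \<Rightarrow> real \<Rightarrow> (('a \<Rightarrow> nat) \<Rightarrow> real) \<Rightarrow> bool"
  where "expands S f x \<rho> c \<longleftrightarrow>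
    (\<lambda>m. norm (c m) * \<rho> ^ (\<Sum>b\<in>Basis. m b)) summable_on (Basis \<rightarrow>\<^sub>E UNIV) \<and>
    (\<forall>y. (\<forall>b\<in>Basis. \<bar>(y - x) \<bullet> b\<bar> < \<rho>) \<longrightarrow> y \<in> S \<and>
      ((\<lambda>m. c m * (\<Prod>b\<in>Basis. ((y - x) \<bullet> b) ^ m b)) has_sum f y) (Basis \<rightarrow>\<^sub>E UNIV))"

definition power_series ::
    "(('a::euclidean_space \<Rightarrow> nat) \<Rightarrow> real) \<Rightarrow> 'a \<Rightarrow> ('a \<Rightarrow> complex) \<Rightarrow> complex"
  where "power_series c x z =
    (\<Sum>\<^sub>\<infinity>m\<in>Basis \<rightarrow>\<^sub>E UNIV. of_real (c m) * (\<Prod>b\<in>Basis. (z b - of_real (x \<bullet> b)) ^ m b))"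

text \<open>Multi-indexed summability is absolute summability, so evaluating the given series at the single
point \<open>x + (\<rho>, ..., \<rho>)\<close> gives the dominating series. The radius is divided by twice the dimension
to keep this corner inside the ball where the series is known to converge.\<close>

lemma real_analytic_on_imp_expands:
  fixes f :: "'a::euclidean_space \<Rightarrow> real"
  assumes "real_analytic_on f S" "open S" "x \<in> S"
  obtains \<rho> c where "\<rho> > 0" "expands S f x \<rho> c"
proof -
  obtain r0 c where r0: "r0 > 0" and c0: "\<And>y. y \<in> ball x r0 \<Longrightarrow>
      ((\<lambda>m. c m * (\<Prod>b\<in>Basis. ((y - x) \<bullet> b) ^ m b)) has_sum f y) (Basis \<rightarrow>\<^sub>E UNIV)"
    using assms(1,3) unfolding real_analytic_on_def by blast
  obtain r1 where r1: "r1 > 0" "ball x r1 \<subseteq> S"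
    using assms(2,3) openE by blast
  define r where "r = min r0 r1"
  have r: "r > 0" "ball x r \<subseteq> S" "ball x r \<subseteq> ball x r0"
    using r0 r1 by (auto simp: r_def)
  define \<rho> where "\<rho> = r / (2 * DIM('a))"
  have \<rho>: "\<rho> > 0" using r by (simp add: \<rho>_def)
  have near: "y \<in> ball x r" if "\<forall>b\<in>Basis. \<bar>(y - x) \<bullet> b\<bar> \<le> \<rho>" for y
  proof -
    have "norm (y - x) \<le> (\<Sum>b\<in>Basis. \<bar>(y - x) \<bullet> b\<bar>)" by (rule norm_le_l1)
    also have "\<dots> \<le> (\<Sum>b\<in>(Basis::'a set). \<rho>)" using that by (intro sum_mono) auto
    also have "\<dots> = r / 2" by (simp add: \<rho>_def)
    also have "\<dots> < r" using r by simp
    finally show ?thesis by (simp add: dist_norm norm_minus_commute)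
  qed
  define y0 where "y0 = x + (\<Sum>b\<in>Basis. \<rho> *\<^sub>R b)"
  have y0: "(y0 - x) \<bullet> b = \<rho>" if "b \<in> Basis" for b
    using that by (simp add: y0_def inner_sum_left inner_Basis if_distrib cong: if_cong)
  have "y0 \<in> ball x r" using \<rho> by (intro near) (auto simp: y0)
  then have "((\<lambda>m. c m * (\<Prod>b\<in>Basis. ((y0 - x) \<bullet> b) ^ m b)) has_sum f y0) (Basis \<rightarrow>\<^sub>E UNIV)"
    using c0 r by blast
  then have "(\<lambda>m. norm (c m * (\<Prod>b\<in>Basis. ((y0 - x) \<bullet> b) ^ m b))) summable_on (Basis \<rightarrow>\<^sub>E UNIV)"
    by (intro summable_on_iff_abs_summable_on_real[THEN iffD1] has_sum_imp_summable)
  moreover have "norm (c m * (\<Prod>b\<in>Basis. ((y0 - x) \<bullet> b) ^ m b)) = norm (c m) * \<rho> ^ (\<Sum>b\<in>Basis. m b)" for m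
  proof -
    have "(\<Prod>b\<in>Basis. ((y0 - x) \<bullet> b) ^ m b) = (\<Prod>b\<in>Basis. \<rho> ^ m b)"
      by (intro prod.cong) (simp_all only: y0)
    then show ?thesis using \<rho> by (simp only: power_sum[symmetric]) (simp add: abs_mult)
  qed
  ultimately have sM: "(\<lambda>m. norm (c m) * \<rho> ^ (\<Sum>b\<in>Basis. m b)) summable_on (Basis \<rightarrow>\<^sub>E UNIV)"
    by simp
  have "expands S f x \<rho> c"
    unfolding expands_def
  proof (intro conjI allI impI sM)
    fix y assume "\<forall>b\<in>Basis. \<bar>(y - x) \<bullet> b\<bar> < \<rho>"
    then have "y \<in> ball x r" by (intro near) (auto intro: less_imp_le)
    then show "y \<in> S" "((\<lambda>m. c m * (\<Prod>b\<in>Basis. ((y - x) \<bullet> b) ^ m b)) has_sum f y) (Basis \<rightarrow>\<^sub>E UNIV)"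
      using r c0 by blast+
  qed
  then show ?thesis using that \<rho> by blast
qed

lemma power_series_term_bound:
  fixes z :: "'a::euclidean_space \<Rightarrow> complex"
  assumes "z \<in> polydisc x \<rho>"
  shows "norm (of_real (c m) * (\<Prod>b\<in>Basis. (z b - of_real (x \<bullet> b)) ^ m b)) \<le>
    norm (c m) * \<rho> ^ (\<Sum>b\<in>Basis. m b)"
proof -
  have "(\<Prod>b\<in>Basis. norm (z b - of_real (x \<bullet> b)) ^ m b) \<le> (\<Prod>b\<in>Basis. \<rho> ^ m b)"
    using assms by (intro prod_mono) (auto simp: polydisc_def less_imp_le intro!: power_mono)
  then show ?thesis
    by (simp add: norm_mult prod_norm[symmetric] norm_power power_sum mult_left_mono)
qed

lemma norm_power_series_le:
  assumes "expands S f x \<rho> c" "z \<in> polydisc x \<rho>"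
  shows "norm (power_series c x z) \<le>
    (\<Sum>\<^sub>\<infinity>m\<in>Basis \<rightarrow>\<^sub>E UNIV. norm (c m) * \<rho> ^ (\<Sum>b\<in>Basis. m b))"
  unfolding power_series_def
proof (rule norm_infsum_le)
  show sM: "((\<lambda>m. norm (c m) * \<rho> ^ (\<Sum>b\<in>Basis. m b)) has_sum
      (\<Sum>\<^sub>\<infinity>m\<in>Basis \<rightarrow>\<^sub>E UNIV. norm (c m) * \<rho> ^ (\<Sum>b\<in>Basis. m b))) (Basis \<rightarrow>\<^sub>E UNIV)"
    using assms(1) by (simp add: expands_def)
  have sum: "(\<lambda>m. norm (of_real (c m) * (\<Prod>b\<in>Basis. (z b - of_real (x \<bullet> b)) ^ m b))) summable_on
      (Basis \<rightarrow>\<^sub>E UNIV)"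
    by (rule Infinite_Sum.abs_summable_on_comparison_test'[OF has_sum_imp_summable[OF sM]])
       (rule power_series_term_bound[OF assms(2)])
  show "((\<lambda>m. of_real (c m) * (\<Prod>b\<in>Basis. (z b - of_real (x \<bullet> b)) ^ m b)) has_sum
      (\<Sum>\<^sub>\<infinity>m\<in>Basis \<rightarrow>\<^sub>E UNIV. of_real (c m) * (\<Prod>b\<in>Basis. (z b - of_real (x \<bullet> b)) ^ m b)))
      (Basis \<rightarrow>\<^sub>E UNIV)"
    by (rule has_sum_infsum[OF abs_summable_summable[OF sum]])
qed (rule power_series_term_bound[OF assms(2)])

text \<open>Holomorphy in several variables is only ever used along holomorphic curves. Along a curve the
series is a uniform limit of finite sums of products of holomorphic functions.\<close>

lemma holomorphic_power_series_compose:
  fixes x :: "'a::euclidean_space"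
  assumes ex: "expands S f x \<rho> c" and "open U"
    and hol: "\<And>b. b \<in> Basis \<Longrightarrow> (\<lambda>s. u s b) holomorphic_on U"
    and in_disc: "\<And>s. s \<in> U \<Longrightarrow> u s \<in> polydisc x \<rho>"
  shows "(\<lambda>s. power_series c x (u s)) holomorphic_on U"
proof -
  have "(\<lambda>s. power_series c x (u s)) field_differentiable at s0" if "s0 \<in> U" for s0
  proof -
    obtain d where d: "d > 0" "cball s0 d \<subseteq> U"
      using \<open>open U\<close> \<open>s0 \<in> U\<close> open_contains_cball by blast
    have lim: "uniform_limit (cball s0 d)
        (\<lambda>M s. \<Sum>m\<in>M. of_real (c m) * (\<Prod>b\<in>Basis. (u s b - of_real (x \<bullet> b)) ^ m b))
        (\<lambda>s. power_series c x (u s)) (finite_subsets_at_top (Basis \<rightarrow>\<^sub>E UNIV))"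
      unfolding power_series_def
    proof (rule Weierstrass_m_test_general[where M = "\<lambda>m. norm (c m) * \<rho> ^ (\<Sum>b\<in>Basis. m b)"])
      fix m s assume "s \<in> cball s0 d"
      then show "norm (of_real (c m) * (\<Prod>b\<in>Basis. (u s b - of_real (x \<bullet> b)) ^ m b)) \<le>
          norm (c m) * \<rho> ^ (\<Sum>b\<in>Basis. m b)"
        using d in_disc by (intro power_series_term_bound) auto
    qed (use ex in \<open>simp add: expands_def\<close>)
    have part: "(\<lambda>s. \<Sum>m\<in>M. of_real (c m) * (\<Prod>b\<in>Basis. (u s b - of_real (x \<bullet> b)) ^ m b))
        holomorphic_on U" for M
      using hol by (intro holomorphic_intros) auto
    have "(\<lambda>s. power_series c x (u s)) holomorphic_on ball s0 d"
    proof (rule holomorphic_uniform_limit[OF always_eventually lim])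
      show "\<forall>M. continuous_on (cball s0 d)
            (\<lambda>s. \<Sum>m\<in>M. of_real (c m) * (\<Prod>b\<in>Basis. (u s b - of_real (x \<bullet> b)) ^ m b)) \<and>
          (\<lambda>s. \<Sum>m\<in>M. of_real (c m) * (\<Prod>b\<in>Basis. (u s b - of_real (x \<bullet> b)) ^ m b)) holomorphic_on ball s0 d"
        using part d(2) ball_subset_cball[of s0 d]
        by (meson holomorphic_on_imp_continuous_on holomorphic_on_subset subset_trans)
    qed auto
    then show ?thesis
      using d holomorphic_on_imp_differentiable_at by (metis centre_in_ball open_ball)
  qed
  then show ?thesis
    by (simp add: holomorphic_on_def field_differentiable_at_within)
qed

lemma power_series_of_real:
  assumes "expands S f x \<rho> c" "\<And>b. b \<in> Basis \<Longrightarrow> z b = of_real (y \<bullet> b)" "z \<in> polydisc x \<rho>"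
  shows "power_series c x z = of_real (f y)"
proof -
  have "norm (z b - complex_of_real (x \<bullet> b)) = \<bar>(y - x) \<bullet> b\<bar>" if "b \<in> Basis" for b
    using assms(2)[OF that] by (metis inner_diff_left norm_of_real of_real_diff)
  then have "((\<lambda>m. c m * (\<Prod>b\<in>Basis. ((y - x) \<bullet> b) ^ m b)) has_sum f y) (Basis \<rightarrow>\<^sub>E UNIV)"
    using assms(1,3) unfolding expands_def polydisc_def by auto
  then have "((\<lambda>m. complex_of_real (c m * (\<Prod>b\<in>Basis. ((y - x) \<bullet> b) ^ m b))) has_sum of_real (f y))
      (Basis \<rightarrow>\<^sub>E UNIV)"
    by (rule has_sum_of_real)
  also have "?this \<longleftrightarrow> ((\<lambda>m. of_real (c m) * (\<Prod>b\<in>Basis. (z b - of_real (x \<bullet> b)) ^ m b))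
      has_sum of_real (f y)) (Basis \<rightarrow>\<^sub>E UNIV)"
    by (intro has_sum_cong) (simp add: assms(2) inner_diff_left)
  finally show ?thesis
    unfolding power_series_def by (rule infsumI)
qed

text \<open>The complex line \<open>s \<mapsto> Re z + s \<i> Im z\<close> passes through \<open>z\<close> at \<open>s = 1\<close> and through real points when \<open>s\<close>
is imaginary. It meets the two polydiscs in a convex set of parameters containing \<open>0\<close> and \<open>1\<close>, and
both series agree with \<open>f\<close> at the real points; the identity theorem in one variable does the rest.\<close>

lemma power_series_unique:
  fixes z :: "'a::euclidean_space \<Rightarrow> complex"
  assumes ex: "expands S f x \<rho> c" "expands S f x' \<rho>' c'"
    and z: "z \<in> polydisc x \<rho>" "z \<in> polydisc x' \<rho>'"
  shows "power_series c x z = power_series c' x' z"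
proof -
  define u where "u = (\<lambda>s b. of_real (Re (z b)) + s * (\<i> * of_real (Im (z b))))"
  define U where "U = {s. u s \<in> polydisc x \<rho> \<inter> polydisc x' \<rho>'}"
  have U_eq: "U = (\<Inter>b\<in>Basis. (\<lambda>s. u s b) -` (ball (of_real (x \<bullet> b)) \<rho> \<inter> ball (of_real (x' \<bullet> b)) \<rho>'))"
    by (auto simp: U_def polydisc_def dist_norm norm_minus_commute)
  have "open U" unfolding U_eq
    by (intro open_INT finite_Basis ballI open_vimage open_Int open_ball)
       (auto simp: u_def intro!: continuous_intros)
  have "convex U"
  proof (unfold U_eq, rule convex_INT)
    fix b :: 'a
    have conv: "u ((1 - t) *\<^sub>R s1 + t *\<^sub>R s2) b = (1 - t) *\<^sub>R u s1 b + t *\<^sub>R u s2 b" for t s1 s2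
      by (simp add: u_def scaleR_conv_of_real algebra_simps)
    show "convex ((\<lambda>s. u s b) -` (ball (of_real (x \<bullet> b)) \<rho> \<inter> ball (of_real (x' \<bullet> b)) \<rho>'))"
      unfolding convex_alt
      using convex_Int[OF convex_ball convex_ball, of "of_real (x \<bullet> b)" \<rho> "of_real (x' \<bullet> b)" \<rho>']
      unfolding convex_alt by (auto simp: conv simp del: mem_ball)
  qed
  have u1: "u 1 = z" by (auto simp: u_def fun_eq_iff complex_eq_iff)
  then have "1 \<in> U" using z by (simp add: U_def)
  have Re_le: "norm (of_real (Re w) - of_real r :: complex) \<le> norm (w - of_real r)" for w and r
    using abs_Re_le_cmod[of "w - of_real r"] by (metis Re_complex_of_real minus_complex.sel(1) norm_of_real of_real_diff)
  have "u 0 \<in> polydisc x \<rho> \<inter> polydisc x' \<rho>'"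
    using z unfolding u_def polydisc_def by (auto intro: le_less_trans[OF Re_le])
  then have "0 \<in> U" by (simp add: U_def)
  have hol: "(\<lambda>s. power_series c x (u s)) holomorphic_on U" "(\<lambda>s. power_series c' x' (u s)) holomorphic_on U"
    using ex \<open>open U\<close>
    by (auto simp: U_def u_def intro!: holomorphic_power_series_compose holomorphic_intros)
  have agree: "power_series c x (u (\<i> * of_real \<tau>)) = power_series c' x' (u (\<i> * of_real \<tau>))"
    if "\<i> * of_real \<tau> \<in> U" for \<tau>
  proof -
    define y where "y = (\<Sum>b\<in>Basis. (Re (z b) - \<tau> * Im (z b)) *\<^sub>R b)"
    have "u (\<i> * of_real \<tau>) b = of_real (y \<bullet> b)" if "b \<in> Basis" for b
      using that by (simp add: u_def y_def complex_eq_iff)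
    then show ?thesis
      using power_series_of_real[OF ex(1), of _ y] power_series_of_real[OF ex(2), of _ y] that
      by (simp add: U_def)
  qed
  have lim: "(0::complex) islimpt U \<inter> range (\<lambda>\<tau>. \<i> * of_real \<tau>)"
    unfolding islimpt_approachable
  proof (intro allI impI)
    fix e :: real assume "e > 0"
    obtain d where d: "d > 0" "ball 0 d \<subseteq> U"
      using \<open>open U\<close> \<open>0 \<in> U\<close> openE by blast
    define \<tau> where "\<tau> = min e d / 2"
    have "\<tau> > 0" "\<tau> < d" "\<tau> < e" using \<open>e > 0\<close> d by (auto simp: \<tau>_def min_def)
    then show "\<exists>x'\<in>U \<inter> range (\<lambda>\<tau>. \<i> * of_real \<tau>). x' \<noteq> 0 \<and> dist x' 0 < e"
      using d by (intro bexI[of _ "\<i> * of_real \<tau>"]) (auto simp: norm_mult subset_iff)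
  qed
  have "power_series c x (u 1) - power_series c' x' (u 1) = 0"
    by (rule analytic_continuation[of "\<lambda>s. power_series c x (u s) - power_series c' x' (u s)" U
          "U \<inter> range (\<lambda>\<tau>. \<i> * of_real \<tau>)" 0])
       (use hol \<open>open U\<close> \<open>convex U\<close> \<open>0 \<in> U\<close> \<open>1 \<in> U\<close> lim agree
         in \<open>auto intro!: holomorphic_intros convex_connected\<close>)
  then show ?thesis by (simp add: u1)
qed

definition extension_domain :: "'a::euclidean_space set \<Rightarrow> ('a \<Rightarrow> real) \<Rightarrow> ('a \<Rightarrow> complex) set"
  where "extension_domain S f = (\<Union>{polydisc x \<rho> |x \<rho>. \<exists>c. expands S f x \<rho> c})"

lemma extension_domainI: "expands S f x \<rho> c \<Longrightarrow> z \<in> polydisc x \<rho> \<Longrightarrow> z \<in> extension_domain S f"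
  unfolding extension_domain_def by blast

text \<open>The extension collects all expansions of \<open>f\<close> instead of fixing one expansion at each point.
Being canonical, it inherits the periods of \<open>f\<close>.\<close>

definition complexify :: "'a::euclidean_space set \<Rightarrow> ('a \<Rightarrow> real) \<Rightarrow> ('a \<Rightarrow> complex) \<Rightarrow> complex"
  where "complexify S f z =
    (THE v. \<exists>x \<rho> c. expands S f x \<rho> c \<and> z \<in> polydisc x \<rho> \<and> v = power_series c x z)"

lemma complexify_eq_power_series:
  assumes "expands S f x \<rho> c" "z \<in> polydisc x \<rho>"
  shows "complexify S f z = power_series c x z"
  unfolding complexify_def
  by (rule the_equality) (use assms power_series_unique in blast)+

lemma open_polydisc_preimage:
  fixes x :: "'a::euclidean_space"
  assumes "open U" "\<And>b. b \<in> Basis \<Longrightarrow> continuous_on U (\<lambda>s. u s b)"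
  shows "open {s\<in>U. u s \<in> polydisc x \<rho>}"
proof -
  have "{s\<in>U. u s \<in> polydisc x \<rho>} = (\<Inter>b\<in>Basis. (\<lambda>s. u s b) -` ball (of_real (x \<bullet> b)) \<rho> \<inter> U)"
    by (auto simp: polydisc_def dist_norm norm_minus_commute)
  also have "open \<dots>"
    using assms by (intro open_INT finite_Basis ballI) (auto intro!: continuous_open_vimage simp: continuous_on_open_vimage)
  finally show ?thesis .
qed

lemma holomorphic_complexify_compose:
  fixes S :: "'a::euclidean_space set"
  assumes "open U" and hol: "\<And>b. b \<in> Basis \<Longrightarrow> (\<lambda>s. u s b) holomorphic_on U"
    and dom: "\<And>s. s \<in> U \<Longrightarrow> u s \<in> extension_domain S f"
  shows "(\<lambda>s. complexify S f (u s)) holomorphic_on U"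
proof -
  have "(\<lambda>s. complexify S f (u s)) field_differentiable at s0" if "s0 \<in> U" for s0
  proof -
    obtain x \<rho> c where ex: "expands S f x \<rho> c" "u s0 \<in> polydisc x \<rho>"
      using dom[OF \<open>s0 \<in> U\<close>] unfolding extension_domain_def by blast
    define V where "V = {s\<in>U. u s \<in> polydisc x \<rho>}"
    have "open V" unfolding V_def
      using assms by (intro open_polydisc_preimage holomorphic_on_imp_continuous_on)
    have "(\<lambda>s. power_series c x (u s)) holomorphic_on V"
      using \<open>open V\<close> hol
      by (intro holomorphic_power_series_compose[OF ex(1)]) (auto simp: V_def intro: holomorphic_on_subset)
    then have "(\<lambda>s. complexify S f (u s)) holomorphic_on V"
      by (rule holomorphic_transform) (auto simp: V_def complexify_eq_power_series[OF ex(1)])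
    then show ?thesis
      using \<open>open V\<close> that ex(2) by (intro holomorphic_on_imp_differentiable_at[of _ V]) (auto simp: V_def)
  qed
  then show ?thesis
    by (simp add: holomorphic_on_def field_differentiable_at_within)
qed

lemma complexify_of_real:
  assumes "z \<in> extension_domain S f" "\<And>b. b \<in> Basis \<Longrightarrow> z b = of_real (y \<bullet> b)"
  shows "complexify S f z = of_real (f y)"
  using assms by (auto simp: extension_domain_def complexify_eq_power_series power_series_of_real)

lemma expands_translate:
  assumes "expands S f x \<rho> c" and per: "\<And>y. y \<in> S \<Longrightarrow> y + v \<in> S \<and> f (y + v) = f y"
  shows "expands S f (x + v) \<rho> c"
proof -
  have "y \<in> S \<and> ((\<lambda>m. c m * (\<Prod>b\<in>Basis. ((y - (x + v)) \<bullet> b) ^ m b)) has_sum f y) (Basis \<rightarrow>\<^sub>E UNIV)"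
    if "\<forall>b\<in>Basis. \<bar>(y - (x + v)) \<bullet> b\<bar> < \<rho>" for y
  proof -
    have eq: "y - (x + v) = (y - v) - x" by simp
    have "y - v \<in> S \<and> ((\<lambda>m. c m * (\<Prod>b\<in>Basis. (((y - v) - x) \<bullet> b) ^ m b)) has_sum f (y - v)) (Basis \<rightarrow>\<^sub>E UNIV)"
      using assms(1) that unfolding expands_def eq by blast
    then show ?thesis using per[of "y - v"] unfolding eq by simp
  qed
  then show ?thesis using assms(1) unfolding expands_def by blast
qed

lemma polydisc_translate:
  "(\<lambda>b. z b + of_real (v \<bullet> b)) \<in> polydisc (x + v) \<rho> \<longleftrightarrow> z \<in> polydisc x \<rho>"
  by (simp add: polydisc_def inner_add_left)

text \<open>An expansion of \<open>f\<close> moved by a period is again an expansion of \<open>f\<close>, with the same coefficients.\<close>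

lemma complexify_translate:
  assumes "z \<in> extension_domain S f" and "\<And>y. y \<in> S \<Longrightarrow> y + v \<in> S \<and> f (y + v) = f y"
  shows "(\<lambda>b. z b + of_real (v \<bullet> b)) \<in> extension_domain S f"
    and "complexify S f (\<lambda>b. z b + of_real (v \<bullet> b)) = complexify S f z"
proof -
  obtain x \<rho> c where ex: "expands S f x \<rho> c" "z \<in> polydisc x \<rho>"
    using assms(1) by (auto simp: extension_domain_def)
  note ex' = expands_translate[OF ex(1) assms(2)] polydisc_translate[THEN iffD2, OF ex(2)]
  show "(\<lambda>b. z b + of_real (v \<bullet> b)) \<in> extension_domain S f"
    by (rule extension_domainI[OF ex'])
  show "complexify S f (\<lambda>b. z b + of_real (v \<bullet> b)) = complexify S f z"
    using complexify_eq_power_series[OF ex] complexify_eq_power_series[OF ex']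
    by (simp add: power_series_def inner_add_left)
qed

text \<open>Finitely many polydiscs of half the radius of expansion cover \<open>K\<close>; the other half of the smallest
radius is a width that serves all points of \<open>K\<close>.\<close>

lemma complexify_bounded_near_compact:
  fixes f :: "'a::euclidean_space \<Rightarrow> real"
  assumes "real_analytic_on f S" "open S" "compact K" "K \<subseteq> S"
  obtains \<delta> B where "\<delta> > 0" "\<And>y z. y \<in> K \<Longrightarrow> z \<in> polydisc y \<delta> \<Longrightarrow>
    z \<in> extension_domain S f \<and> norm (complexify S f z) \<le> B"
proof -
  have "\<forall>x\<in>K. \<exists>\<rho> c. \<rho> > 0 \<and> expands S f x \<rho> c"
    using real_analytic_on_imp_expands[OF assms(1,2)] assms(4) by (metis subset_iff)
  then obtain \<rho> c where ex: "\<And>x. x \<in> K \<Longrightarrow> \<rho> x > 0" "\<And>x. x \<in> K \<Longrightarrow> expands S f x (\<rho> x) (c x)"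
    by metis
  have "\<exists>D\<subseteq>K. finite D \<and> K \<subseteq> (\<Union>x\<in>D. ball x (\<rho> x / 2))"
  proof -
    have "K \<subseteq> (\<Union>x\<in>K. ball x (\<rho> x / 2))" using ex(1) by force
    then show ?thesis
      by (rule compactE_image[OF \<open>compact K\<close> open_ball]) blast
  qed
  then obtain D where D: "D \<subseteq> K" "finite D" "K \<subseteq> (\<Union>x\<in>D. ball x (\<rho> x / 2))" by blast
  define \<delta> where "\<delta> = Min (insert 1 ((\<lambda>x. \<rho> x / 2) ` D))"
  define M where "M = (\<lambda>x. \<Sum>\<^sub>\<infinity>m\<in>Basis \<rightarrow>\<^sub>E UNIV. norm (c x m) * \<rho> x ^ (\<Sum>b\<in>Basis. m b))"
  have M0: "M x \<ge> 0" if "x \<in> K" for x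
    unfolding M_def using ex(1)[OF that] by (intro infsum_nonneg) simp
  have "\<delta> > 0" using D ex(1) by (auto simp: \<delta>_def)
  have res: "z \<in> extension_domain S f \<and> norm (complexify S f z) \<le> sum M D"
    if "y \<in> K" "z \<in> polydisc y \<delta>" for y z
  proof -
    obtain x where x: "x \<in> D" "dist x y < \<rho> x / 2" using D(3) \<open>y \<in> K\<close> by force
    have "\<delta> \<le> \<rho> x / 2" unfolding \<delta>_def using D(2) x(1) by (intro Min_le) auto
    have "norm (z b - of_real (x \<bullet> b)) < \<rho> x" if "b \<in> Basis" for b
    proof -
      have "norm (complex_of_real (y \<bullet> b) - of_real (x \<bullet> b)) \<le> norm (y - x)"
        using Basis_le_norm[OF that, of "y - x"] by (metis inner_diff_left norm_of_real of_real_diff)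
      moreover have "norm (z b - of_real (y \<bullet> b)) < \<delta>"
        using \<open>z \<in> polydisc y \<delta>\<close> that by (simp add: polydisc_def)
      moreover have "norm (z b - of_real (x \<bullet> b)) \<le>
          norm (z b - of_real (y \<bullet> b)) + norm (complex_of_real (y \<bullet> b) - of_real (x \<bullet> b))"
        using norm_triangle_ineq[of "z b - of_real (y \<bullet> b)" "of_real (y \<bullet> b) - of_real (x \<bullet> b)"] by simp
      ultimately show ?thesis
        using x \<open>\<delta> \<le> \<rho> x / 2\<close> by (simp add: dist_norm norm_minus_commute)
    qed
    then have z: "z \<in> polydisc x (\<rho> x)" by (simp add: polydisc_def)
    have exx: "expands S f x (\<rho> x) (c x)" using ex x D by auto
    have "norm (complexify S f z) \<le> M x"
      unfolding complexify_eq_power_series[OF exx z] M_def by (rule norm_power_series_le[OF exx z])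
    also have "\<dots> \<le> sum M D" using D x M0 by (intro member_le_sum) auto
    finally show ?thesis using extension_domainI[OF exx z] by simp
  qed
  show ?thesis by (rule that[of \<delta> "sum M D", OF \<open>\<delta> > 0\<close> res])
qed

section \<open>Extension of the vector field to a complex neighbourhood of a torus\<close>

lemma real_analytic_on_imp_holomorphic_extension:
  fixes f :: "real \<Rightarrow> real"
  assumes "real_analytic_on f S" "open S" "x \<in> S"
  obtains \<rho> g where "\<rho> > 0" "g holomorphic_on ball (of_real x) \<rho>"
    "\<And>y. \<bar>y - x\<bar> < \<rho> \<Longrightarrow> y \<in> S \<and> g (of_real y) = of_real (f y)"
proof -
  obtain \<rho> c where \<rho>: "\<rho> > 0" and ex: "expands S f x \<rho> c"
    using real_analytic_on_imp_expands[OF assms] by blast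
  define g where "g = (\<lambda>s. power_series c x (\<lambda>b. s * of_real b))"
  have disc: "(\<lambda>b. s * of_real b) \<in> polydisc x \<rho>" if "s \<in> ball (of_real x) \<rho>" for s
    using that by (simp add: polydisc_def dist_norm norm_minus_commute)
  have "g holomorphic_on ball (of_real x) \<rho>"
    unfolding g_def
    by (rule holomorphic_power_series_compose[OF ex]) (use disc in \<open>auto intro!: holomorphic_intros\<close>)
  moreover have "y \<in> S \<and> g (of_real y) = of_real (f y)" if "\<bar>y - x\<bar> < \<rho>" for y
  proof -
    have "complex_of_real y \<in> ball (of_real x) \<rho>"
      using that by (simp add: dist_norm abs_minus_commute flip: of_real_diff)
    then have "g (of_real y) = of_real (f y)"
      unfolding g_def by (intro power_series_of_real[OF ex] disc) auto
    then show ?thesis using that ex by (auto simp: expands_def)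
  qed
  ultimately show ?thesis using that[of \<rho> g] \<rho> by blast
qed

text \<open>A complex neighbourhood of the set where the action is \<open>A\<^sub>0\<close> and the parameter is \<open>C\<^sub>1\<close>. Angle and
time are restricted in their imaginary parts only, so the width does not depend on the base point.\<close>

definition near_torus ::
    "real \<Rightarrow> real \<Rightarrow> real \<Rightarrow> complex \<Rightarrow> complex \<Rightarrow> complex \<Rightarrow> complex \<Rightarrow> bool"
  where "near_torus A\<^sub>0 C\<^sub>1 \<delta> a A C t \<longleftrightarrow>
    \<bar>Im a\<bar> < \<delta> \<and> norm (A - of_real A\<^sub>0) < \<delta> \<and> norm (C - of_real C\<^sub>1) < \<delta> \<and> \<bar>Im t\<bar> < \<delta>"

text \<open>The arguments of the extension \<open>E\<close> are the angle, the action, the parameter and the time.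
Holomorphy along curves contains holomorphy in each variable, and also holomorphy on complex
lines, from which Cauchy estimates for differences of values are obtained.\<close>

definition complex_extension ::
    "(real \<Rightarrow> real \<Rightarrow> real \<Rightarrow> real \<Rightarrow> real) \<Rightarrow> real \<Rightarrow> real \<Rightarrow> real \<Rightarrow> real \<Rightarrow>
     (complex \<Rightarrow> complex \<Rightarrow> complex \<Rightarrow> complex \<Rightarrow> complex) \<Rightarrow> bool"
  where "complex_extension H A\<^sub>0 C\<^sub>1 \<delta> B E \<longleftrightarrow>
    (\<forall>U a A C t. open U \<and> a holomorphic_on U \<and> A holomorphic_on U \<and> C holomorphic_on U \<and>
       t holomorphic_on U \<and> (\<forall>s\<in>U. near_torus A\<^sub>0 C\<^sub>1 \<delta> (a s) (A s) (C s) (t s)) \<longrightarrow>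
       (\<lambda>s. E (a s) (A s) (C s) (t s)) holomorphic_on U) \<and>
    (\<forall>a A C t. near_torus A\<^sub>0 C\<^sub>1 \<delta> a A C t \<longrightarrow> norm (E a A C t) \<le> B \<and>
       E (a + 2 * of_real pi) A C t = E a A C t \<and> E a A C (t + 2 * of_real pi) = E a A C t) \<and>
    (\<forall>a A C t. \<bar>A - A\<^sub>0\<bar> < \<delta> \<and> \<bar>C - C\<^sub>1\<bar> < \<delta> \<longrightarrow>
       E (of_real a) (of_real A) (of_real C) (of_real t) = of_real (H a A C t))"

lemma complex_extensionD:
  assumes "complex_extension H A\<^sub>0 C\<^sub>1 \<delta> B E"
  shows "\<And>U a A C t. open U \<Longrightarrow> a holomorphic_on U \<Longrightarrow> A holomorphic_on U \<Longrightarrow> C holomorphic_on U \<Longrightarrow>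
       t holomorphic_on U \<Longrightarrow> (\<And>s. s \<in> U \<Longrightarrow> near_torus A\<^sub>0 C\<^sub>1 \<delta> (a s) (A s) (C s) (t s)) \<Longrightarrow>
       (\<lambda>s. E (a s) (A s) (C s) (t s)) holomorphic_on U"
    and "\<And>a A C t. near_torus A\<^sub>0 C\<^sub>1 \<delta> a A C t \<Longrightarrow> norm (E a A C t) \<le> B"
    and "\<And>a A C t. near_torus A\<^sub>0 C\<^sub>1 \<delta> a A C t \<Longrightarrow> E (a + 2 * of_real pi) A C t = E a A C t"
    and "\<And>a A C t. near_torus A\<^sub>0 C\<^sub>1 \<delta> a A C t \<Longrightarrow> E a A C (t + 2 * of_real pi) = E a A C t"
    and "\<And>a A C t. \<bar>A - A\<^sub>0\<bar> < \<delta> \<Longrightarrow> \<bar>C - C\<^sub>1\<bar> < \<delta> \<Longrightarrow>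
       E (of_real a) (of_real A) (of_real C) (of_real t) = of_real (H a A C t)"
  using assms unfolding complex_extension_def by blast+

lemma periodic_of_int_mult:
  fixes h :: "'a::comm_ring_1 \<Rightarrow> 'b"
  assumes "\<And>x. h (x + p) = h x"
  shows "h (x + of_int n * p) = h x"
proof (induction n rule: int_induct[of _ 0])
  case (step1 i)
  then show ?case using assms[of "x + of_int i * p"] by (simp add: algebra_simps)
next
  case (step2 i)
  then show ?case using assms[of "x + of_int (i - 1) * p"] by (simp add: algebra_simps)
qed simp

definition complex_point :: "complex \<Rightarrow> complex \<Rightarrow> complex \<Rightarrow> complex \<Rightarrow> real \<times> real \<times> real \<times> real \<Rightarrow> complex"
  where "complex_point a A C t b =
    a * of_real (fst b) + A * of_real (fst (snd b)) + C * of_real (fst (snd (snd b))) +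
    t * of_real (snd (snd (snd b)))"

lemma Basis_quadruple:
  "(Basis :: (real \<times> real \<times> real \<times> real) set) = {(1,0,0,0), (0,1,0,0), (0,0,1,0), (0,0,0,1)}"
  by (auto simp: Basis_prod_def zero_prod_def)

lemma complex_point_in_polydisc:
  "complex_point a A C t \<in> polydisc (a', A', C', t') \<rho> \<longleftrightarrow>
    norm (a - of_real a') < \<rho> \<and> norm (A - of_real A') < \<rho> \<and> norm (C - of_real C') < \<rho> \<and>
    norm (t - of_real t') < \<rho>"
  by (simp add: polydisc_def Basis_quadruple complex_point_def)

text \<open>The width and the bound come from the compact fundamental domain \<open>[0, 2\<pi>]\<times>{A\<^sub>0}\<times>{C\<^sub>1}\<times>[0, 2\<pi>]\<close>;
translation by multiples of the periods brings every point of the neighbourhood close to it.\<close>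

lemma complex_extension_exists:
  assumes "open W" "admissible_perturbation W H" "A\<^sub>0 \<in> W"
  obtains \<delta> B E where "\<delta> > 0" "complex_extension H A\<^sub>0 C\<^sub>1 \<delta> B E"
proof -
  define S where "S = (UNIV :: real set) \<times> W \<times> (UNIV :: real set) \<times> (UNIV :: real set)"
  define f where "f = (\<lambda>(a, A, C, t). H a A C t)"
  have an: "real_analytic_on f S" and S: "open S"
    using assms by (auto simp: admissible_perturbation_def f_def S_def intro!: open_Times)
  have per_a: "H (a + 2 * pi) A C t = H a A C t" and per_t: "H a A C (t + 2 * pi) = H a A C t"
    if "A \<in> W" for a A C t
    using assms(2) that by (auto simp: admissible_perturbation_def)
  define per where "per = (\<lambda>n m. (of_int n * (2 * pi), 0, 0, of_int m * (2 * pi)) :: real \<times> real \<times> real \<times> real)"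
  have per: "y + per n m \<in> S \<and> f (y + per n m) = f y" if "y \<in> S" for y n m
  proof -
    obtain a A C t where y: "y = (a, A, C, t)" by (metis prod_cases4)
    have "A \<in> W" using that by (simp add: y S_def)
    have "H (a + of_int n * (2 * pi)) A C (t + of_int m * (2 * pi)) = H (a + of_int n * (2 * pi)) A C t"
      by (rule periodic_of_int_mult[where h = "\<lambda>t. H _ A C t"]) (rule per_t[OF \<open>A \<in> W\<close>])
    also have "\<dots> = H a A C t"
      by (rule periodic_of_int_mult[where h = "\<lambda>a. H a A C t"]) (rule per_a[OF \<open>A \<in> W\<close>])
    finally show ?thesis using \<open>A \<in> W\<close> by (simp add: y S_def f_def per_def)
  qed
  have translate: "(\<lambda>b. complex_point a A C t b + of_real (per n m \<bullet> b)) =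
      complex_point (a + of_int n * (2 * of_real pi)) A C (t + of_int m * (2 * of_real pi))"
    for a A C t n m
    by (auto simp: complex_point_def per_def fun_eq_iff algebra_simps)
  define K where "K = {0..2*pi} \<times> {A\<^sub>0} \<times> {C\<^sub>1} \<times> {0..2*pi}"
  have "compact K" "K \<subseteq> S"
    using assms by (auto simp: K_def S_def intro!: compact_Times)
  then obtain \<delta> B where \<delta>: "\<delta> > 0" and bd: "\<And>y z. y \<in> K \<Longrightarrow> z \<in> polydisc y \<delta> \<Longrightarrow>
      z \<in> extension_domain S f \<and> norm (complexify S f z) \<le> B"
    using complexify_bounded_near_compact[OF an S] by metis
  have dom: "complex_point a A C t \<in> extension_domain S f \<and>
      norm (complexify S f (complex_point a A C t)) \<le> B"
    if "near_torus A\<^sub>0 C\<^sub>1 \<delta> a A C t" for a A C t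
  proof -
    define n where "n = \<lfloor>Re a / (2 * pi)\<rfloor>"
    define m where "m = \<lfloor>Re t / (2 * pi)\<rfloor>"
    define a' where "a' = a - of_int n * (2 * of_real pi)"
    define t' where "t' = t - of_int m * (2 * of_real pi)"
    have range: "x - \<lfloor>x / (2 * pi)\<rfloor> * (2 * pi) \<in> {0..2*pi}" for x
      using floor_divide_lower[of "2 * pi" x] floor_divide_upper[of "2 * pi" x] by (simp add: algebra_simps)
    have "norm (w - of_real (Re w)) = \<bar>Im w\<bar>" for w :: complex
      by (simp add: cmod_def)
    moreover have "Im a' = Im a" "Im t' = Im t" by (simp_all add: a'_def t'_def)
    ultimately have disc: "complex_point a' A C t' \<in> polydisc (Re a', A\<^sub>0, C\<^sub>1, Re t') \<delta>"
      using that by (simp add: complex_point_in_polydisc near_torus_def)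
    have "(Re a', A\<^sub>0, C\<^sub>1, Re t') \<in> K"
      using range[of "Re a"] range[of "Re t"] by (simp add: K_def a'_def t'_def n_def m_def)
    note bd' = bd[OF this disc]
    have "complex_point a A C t = (\<lambda>b. complex_point a' A C t' b + of_real (per n m \<bullet> b))"
      unfolding translate by (simp add: a'_def t'_def)
    then show ?thesis
      using complexify_translate[OF bd'[THEN conjunct1] per] bd' by simp
  qed
  define E where "E = (\<lambda>a A C t. complexify S f (complex_point a A C t))"
  have "complex_extension H A\<^sub>0 C\<^sub>1 \<delta> B E"
    unfolding complex_extension_def
  proof (intro conjI allI impI; (elim conjE)?)
    fix U a A C t
    assume "open U" "a holomorphic_on U" "A holomorphic_on U" "C holomorphic_on U"
      "t holomorphic_on U" "\<forall>s\<in>U. near_torus A\<^sub>0 C\<^sub>1 \<delta> (a s) (A s) (C s) (t s)"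
    then show "(\<lambda>s. E (a s) (A s) (C s) (t s)) holomorphic_on U"
      unfolding E_def using dom
      by (intro holomorphic_complexify_compose) (auto simp: complex_point_def intro!: holomorphic_intros)
  next
    fix a A C t assume near: "near_torus A\<^sub>0 C\<^sub>1 \<delta> a A C t"
    show "norm (E a A C t) \<le> B" using dom[OF near] by (simp add: E_def)
    have per_eq: "complexify S f (complex_point (a + of_int n * (2 * of_real pi)) A C (t + of_int m * (2 * of_real pi))) =
        complexify S f (complex_point a A C t)" for n m
      using complexify_translate(2)[OF dom[OF near, THEN conjunct1] per] unfolding translate .
    show "E (a + 2 * of_real pi) A C t = E a A C t" "E a A C (t + 2 * of_real pi) = E a A C t"
      using per_eq[of 1 0] per_eq[of 0 1] by (simp_all add: E_def)
  next
    fix a A C t assume near: "\<bar>A - A\<^sub>0\<bar> < \<delta>" "\<bar>C - C\<^sub>1\<bar> < \<delta>"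
    have "near_torus A\<^sub>0 C\<^sub>1 \<delta> (of_real a) (of_real A) (of_real C) (of_real t)"
      using near \<delta> by (auto simp: near_torus_def simp flip: of_real_diff)
    then have "E (of_real a) (of_real A) (of_real C) (of_real t) = of_real (f (a, A, C, t))"
      unfolding E_def using dom
      by (intro complexify_of_real) (auto simp: complex_point_def Basis_quadruple)
    then show "E (of_real a) (of_real A) (of_real C) (of_real t) = of_real (H a A C t)"
      by (simp add: f_def)
  qed
  then show ?thesis using that \<delta> by blast
qed

lemma complex_extension_shrink:
  assumes "complex_extension H A\<^sub>0 C\<^sub>1 \<delta> B E" "\<delta>' \<le> \<delta>" "B \<le> B'"
  shows "complex_extension H A\<^sub>0 C\<^sub>1 \<delta>' B' E"
proof -
  have "near_torus A\<^sub>0 C\<^sub>1 \<delta>' a A C t \<Longrightarrow> near_torus A\<^sub>0 C\<^sub>1 \<delta> a A C t" for a A C t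
    using assms(2) by (auto simp: near_torus_def)
  then show ?thesis
    using complex_extensionD[OF assms(1)] assms(2,3)
    unfolding complex_extension_def by (smt (verit))
qed

text \<open>The Cauchy estimate is applied on the closed disc of half the radius, whence the factor 2.\<close>

lemma norm_deriv_le_of_bounded:
  assumes hol: "f holomorphic_on ball z r" and "r > 0" and bd: "\<And>w. w \<in> ball z r \<Longrightarrow> norm (f w) \<le> B"
  shows "norm (deriv f z) \<le> 2 * B / r"
proof -
  have sub: "cball z (r / 2) \<subseteq> ball z r" using \<open>r > 0\<close> by auto
  have "norm ((deriv ^^ 1) f z) \<le> fact 1 * B / (r / 2) ^ 1"
  proof (rule Cauchy_inequality)
    show "f holomorphic_on ball z (r / 2)"
      using hol \<open>r > 0\<close> by (auto intro: holomorphic_on_subset)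
    show "continuous_on (cball z (r / 2)) f"
      using hol sub by (meson holomorphic_on_imp_continuous_on holomorphic_on_subset)
    show "norm (f w) \<le> B" if "norm (z - w) = r / 2" for w
      using that \<open>r > 0\<close> by (intro bd) (auto simp: dist_norm)
  qed (use \<open>r > 0\<close> in simp)
  then show ?thesis by (simp add: field_simps)
qed

lemma holomorphic_imp_lipschitz:
  assumes hol: "f holomorphic_on U" and "r > 0" "convex K" and sub: "\<And>x. x \<in> K \<Longrightarrow> ball x r \<subseteq> U"
    and bd: "\<And>x. x \<in> U \<Longrightarrow> norm (f x) \<le> B" and "x \<in> K" "y \<in> K"
  shows "norm (f x - f y) \<le> 2 * B / r * norm (x - y)"
proof (rule field_differentiable_bound[OF \<open>convex K\<close> _ _ \<open>x \<in> K\<close> \<open>y \<in> K\<close>])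
  fix z assume "z \<in> K"
  have hol': "f holomorphic_on ball z r" using hol sub[OF \<open>z \<in> K\<close>] holomorphic_on_subset by blast
  have "(f has_field_derivative deriv f z) (at z)"
    using hol' \<open>r > 0\<close> by (intro holomorphic_derivI[of f "ball z r"]) auto
  then show "(f has_field_derivative deriv f z) (at z within K)"
    by (rule has_field_derivative_at_within)
  show "norm (deriv f z) \<le> 2 * B / r"
    using hol' \<open>r > 0\<close> bd sub[OF \<open>z \<in> K\<close>] by (intro norm_deriv_le_of_bounded) auto
qed

text \<open>Restricted to the complex line through the two points, \<open>E\<close> is holomorphic and bounded in a
neighbourhood of the unit segment whose radius is inversely proportional to the distance \<open>d\<close> of
the points. The Cauchy estimate therefore bounds the increment by a multiple of \<open>d\<close>.\<close>

lemma complex_extension_lipschitz: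
  assumes E: "complex_extension H A\<^sub>0 C\<^sub>1 \<delta> B E" and "\<delta> > 0"
    and near: "near_torus A\<^sub>0 C\<^sub>1 (\<delta> / 2) a A C t" "near_torus A\<^sub>0 C\<^sub>1 (\<delta> / 2) a' A' C' t'"
  shows "norm (E a A C t - E a' A' C' t') \<le>
    4 * B / \<delta> * (norm (a - a') + norm (A - A') + norm (C - C') + norm (t - t'))"
proof -
  define d where "d = norm (a - a') + norm (A - A') + norm (C - C') + norm (t - t')"
  have d_ge: "norm (a - a') \<le> d" "norm (A - A') \<le> d" "norm (C - C') \<le> d" "norm (t - t') \<le> d" "d \<ge> 0"
    by (simp_all add: d_def)
  show ?thesis
  proof (cases "d = 0")
    case True
    then have "a = a'" "A = A'" "C = C'" "t = t'" using d_ge by auto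
    then show ?thesis by simp
  next
    case False
    then have "d > 0" using d_ge by simp
    define r where "r = \<delta> / (2 * d)"
    have "r > 0" using \<open>\<delta> > 0\<close> \<open>d > 0\<close> by (simp add: r_def)
    define K where "K = closed_segment 0 (1::complex)"
    define U where "U = (\<Union>s\<in>K. ball s r)"
    define l where "l = (\<lambda>w w' s. w' + s * (w - w') :: complex)"
    have on_K: "norm (l w w' s - x) < \<delta> / 2" if "s \<in> K" "norm (w - x) < \<delta> / 2" "norm (w' - x) < \<delta> / 2" for w w' s x
    proof -
      obtain \<tau> where \<tau>: "0 \<le> \<tau>" "\<tau> \<le> 1" "s = of_real \<tau>"
        using \<open>s \<in> K\<close> by (auto simp: K_def in_segment scaleR_conv_of_real)
      have "l w w' s = (1 - \<tau>) *\<^sub>R w' + \<tau> *\<^sub>R w"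
        by (simp add: l_def \<tau> scaleR_conv_of_real algebra_simps)
      then have "l w w' s \<in> ball x (\<delta> / 2)"
        using convex_ball[of x "\<delta>/2"] \<tau> that unfolding convex_alt
        by (auto simp: dist_norm norm_minus_commute)
      then show ?thesis by (simp add: dist_norm norm_minus_commute)
    qed
    have on_K': "\<bar>Im (l w w' s)\<bar> < \<delta> / 2" if "s \<in> K" "\<bar>Im w\<bar> < \<delta> / 2" "\<bar>Im w'\<bar> < \<delta> / 2" for w w' s
    proof -
      obtain \<tau> where \<tau>: "0 \<le> \<tau>" "\<tau> \<le> 1" "s = of_real \<tau>"
        using \<open>s \<in> K\<close> by (auto simp: K_def in_segment scaleR_conv_of_real)
      have "Im (l w w' s) = (1 - \<tau>) *\<^sub>R Im w' + \<tau> *\<^sub>R Im w"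
        by (simp add: l_def \<tau> algebra_simps)
      then have "Im (l w w' s) \<in> ball 0 (\<delta> / 2)"
        using convex_ball[of "0::real" "\<delta>/2"] \<tau> that unfolding convex_alt by auto
      then show ?thesis by simp
    qed
    have shift: "norm (l w w' s - l w w' s0) < \<delta> / 2" if "s \<in> ball s0 r" "norm (w - w') \<le> d" for w w' s s0
    proof -
      have "norm (l w w' s - l w w' s0) = norm (s - s0) * norm (w - w')"
        by (simp add: l_def norm_mult[symmetric] algebra_simps)
      also have "\<dots> \<le> norm (s - s0) * d" using that by (intro mult_left_mono) auto
      also have "\<dots> < r * d" using that \<open>d > 0\<close> by (simp add: dist_norm norm_minus_commute)
      also have "\<dots> = \<delta> / 2" using \<open>d > 0\<close> by (simp add: r_def)
      finally show ?thesis .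
    qed
    have far: "norm (l w w' s - x) < \<delta>"
      if "s \<in> ball s0 r" "s0 \<in> K" "norm (w - w') \<le> d" "norm (w - x) < \<delta> / 2" "norm (w' - x) < \<delta> / 2" for w w' s s0 x
      using shift[OF that(1,3)] on_K[OF that(2,4,5)] norm_triangle_ineq[of "l w w' s - l w w' s0" "l w w' s0 - x"] by simp
    have far': "\<bar>Im (l w w' s)\<bar> < \<delta>"
      if "s \<in> ball s0 r" "s0 \<in> K" "norm (w - w') \<le> d" "\<bar>Im w\<bar> < \<delta> / 2" "\<bar>Im w'\<bar> < \<delta> / 2" for w w' s s0
      using shift[OF that(1,3)] on_K'[OF that(2,4,5)] abs_Im_le_cmod[of "l w w' s - l w w' s0"] by simp
    have nearU: "near_torus A\<^sub>0 C\<^sub>1 \<delta> (l a a' s) (l A A' s) (l C C' s) (l t t' s)" if s: "s \<in> U" for s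
    proof -
      obtain s0 where "s0 \<in> K" "s \<in> ball s0 r" using s by (auto simp: U_def)
      then show ?thesis
        using near d_ge unfolding near_torus_def by (auto intro!: far far' simp del: mem_ball)
    qed
    have hol: "(\<lambda>s. E (l a a' s) (l A A' s) (l C C' s) (l t t' s)) holomorphic_on U"
      by (rule complex_extensionD(1)[OF E]) (auto simp: U_def l_def intro!: holomorphic_intros nearU[unfolded U_def l_def])
    have "norm (E (l a a' 1) (l A A' 1) (l C C' 1) (l t t' 1) - E (l a a' 0) (l A A' 0) (l C C' 0) (l t t' 0)) \<le>
        2 * B / r * norm (1 - 0 :: complex)"
      by (rule holomorphic_imp_lipschitz[OF hol \<open>r > 0\<close>, of K])
         (auto simp: K_def U_def intro!: complex_extensionD(2)[OF E] nearU[unfolded U_def K_def])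
    then show ?thesis
      using \<open>d > 0\<close> \<open>\<delta> > 0\<close> by (simp add: l_def r_def d_def field_simps)
  qed
qed

text \<open>As a function of the shift \<open>s\<close> of the angle, the difference of the values of \<open>E\<close> at the two points
is holomorphic, and by the Lipschitz bound it is of the size of their distance. One more Cauchy
estimate gives the product of this distance and \<open>norm s\<close>. This replaces estimates of second
derivatives: it controls how far \<open>\<partial>E/\<partial>a\<close> varies.\<close>

lemma complex_extension_second_difference:
  assumes E: "complex_extension H A\<^sub>0 C\<^sub>1 \<delta> B E" and "\<delta> > 0"
    and near: "near_torus A\<^sub>0 C\<^sub>1 (\<delta> / 4) a A C t" "near_torus A\<^sub>0 C\<^sub>1 (\<delta> / 4) a' A' C' t'"
    and s: "norm s < \<delta> / 8"
  shows "norm ((E (a + s) A C t - E a A C t) - (E (a' + s) A' C' t' - E a' A' C' t')) \<le>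
    64 * B / \<delta>\<^sup>2 * (norm (a - a') + norm (A - A') + norm (C - C') + norm (t - t')) * norm s"
proof -
  define d where "d = norm (a - a') + norm (A - A') + norm (C - C') + norm (t - t')"
  define D where "D = (\<lambda>s. E (a + s) A C t - E (a' + s) A' C' t')"
  have near2: "near_torus A\<^sub>0 C\<^sub>1 (\<delta> / 2) (a + s) A C t" "near_torus A\<^sub>0 C\<^sub>1 (\<delta> / 2) (a' + s) A' C' t'"
    if "s \<in> ball 0 (\<delta> / 4)" for s
    using near that \<open>\<delta> > 0\<close> abs_Im_le_cmod[of s] abs_triangle_ineq[of "Im a" "Im s"] abs_triangle_ineq[of "Im a'" "Im s"]
    by (auto simp: near_torus_def)
  have weaken: "near_torus A\<^sub>0 C\<^sub>1 (\<delta> / 2) a A C t \<Longrightarrow> near_torus A\<^sub>0 C\<^sub>1 \<delta> a A C t" for a A C t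
    using \<open>\<delta> > 0\<close> by (auto simp: near_torus_def)
  have hol: "D holomorphic_on ball 0 (\<delta> / 4)"
    unfolding D_def
    by (intro holomorphic_on_diff complex_extensionD(1)[OF E])
       (auto intro!: holomorphic_intros weaken near2)
  have bd: "norm (D s) \<le> 4 * B / \<delta> * d" if "s \<in> ball 0 (\<delta> / 4)" for s
    unfolding D_def d_def using complex_extension_lipschitz[OF E \<open>\<delta> > 0\<close> near2[OF that]] by simp
  have "norm (D s - D 0) \<le> 2 * (4 * B / \<delta> * d) / (\<delta> / 8) * norm (s - 0)"
  proof (rule holomorphic_imp_lipschitz[OF hol _ _ _ bd, of _ "ball 0 (\<delta> / 8)"])
    show "ball x (\<delta> / 8) \<subseteq> ball 0 (\<delta> / 4)" if "x \<in> ball 0 (\<delta> / 8)" for x :: complex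
    proof
      fix y assume "y \<in> ball x (\<delta> / 8)"
      then show "y \<in> ball 0 (\<delta> / 4)"
        using that dist_triangle[of 0 y x] by simp
    qed
  qed (use s \<open>\<delta> > 0\<close> in auto)
  also have "2 * (4 * B / \<delta> * d) / (\<delta> / 8) * norm (s - 0) = 64 * B / \<delta>\<^sup>2 * d * norm s"
    using \<open>\<delta> > 0\<close> by (simp add: power2_eq_square field_simps)
  finally show ?thesis by (simp add: D_def d_def algebra_simps)
qed

section \<open>Separately holomorphic functions of two variables\<close>

text \<open>Joint continuity is part of the notion because differentiation under the integral sign uses it;
for separately holomorphic functions it amounts to local boundedness.\<close>

definition sep_holomorphic :: "complex set \<Rightarrow> complex set \<Rightarrow> (complex \<Rightarrow> complex \<Rightarrow> complex) \<Rightarrow> bool"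
  where "sep_holomorphic U V v \<longleftrightarrow>
    (\<forall>t\<in>V. (\<lambda>e. v e t) holomorphic_on U) \<and> (\<forall>e\<in>U. v e holomorphic_on V) \<and>
    continuous_on (U \<times> V) (\<lambda>(e, t). v e t)"

lemma sep_holomorphicD:
  assumes "sep_holomorphic U V v"
  shows "t \<in> V \<Longrightarrow> (\<lambda>e. v e t) holomorphic_on U" "e \<in> U \<Longrightarrow> v e holomorphic_on V"
    "continuous_on (U \<times> V) (\<lambda>(e, t). v e t)"
  using assms by (auto simp: sep_holomorphic_def)

text \<open>A local bound makes the functions \<open>\<lambda>e. v e t\<close> Lipschitz with a constant independent of \<open>t\<close>.
Joint continuity follows from this and continuity in \<open>t\<close> at the single value \<open>e1\<close>.\<close>

lemma sep_holomorphicI_locally_bounded: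
  assumes "open U" "open V"
    and hole: "\<And>t. t \<in> V \<Longrightarrow> (\<lambda>e. v e t) holomorphic_on U"
    and holt: "\<And>e. e \<in> U \<Longrightarrow> v e holomorphic_on V"
    and bd: "\<And>e t. e \<in> U \<Longrightarrow> t \<in> V \<Longrightarrow> \<exists>r>0. \<exists>B. ball e r \<subseteq> U \<and> ball t r \<subseteq> V \<and>
      (\<forall>e'\<in>ball e r. \<forall>t'\<in>ball t r. norm (v e' t') \<le> B)"
  shows "sep_holomorphic U V v"
proof -
  have "isCont (\<lambda>(e, t). v e t) (e1, t1)" if in_dom: "e1 \<in> U" "t1 \<in> V" for e1 t1
  proof -
    obtain r B where r: "r > 0" "ball e1 r \<subseteq> U" "ball t1 r \<subseteq> V"
      and B: "\<And>e t. e \<in> ball e1 r \<Longrightarrow> t \<in> ball t1 r \<Longrightarrow> norm (v e t) \<le> B"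
      using bd[OF in_dom] by blast
    have lip: "norm (v e t - v e1 t) \<le> 2 * B / (r / 2) * norm (e - e1)"
      if "e \<in> ball e1 (r / 2)" "t \<in> ball t1 r" for e t
    proof (rule holomorphic_imp_lipschitz[of "\<lambda>e. v e t" "ball e1 r" "r / 2" "ball e1 (r / 2)"])
      show "(\<lambda>e. v e t) holomorphic_on ball e1 r"
        using hole that r by (meson holomorphic_on_subset subsetD)
      show "ball x (r / 2) \<subseteq> ball e1 r" if "x \<in> ball e1 (r / 2)" for x
      proof
        fix y assume "y \<in> ball x (r / 2)"
        then show "y \<in> ball e1 r" using that dist_triangle[of e1 y x] by simp
      qed
    qed (use that B r in auto)
    define V' where "V' = ball e1 (r / 2) \<times> ball t1 r"
    have "open V'" "(e1, t1) \<in> V'" using r by (auto simp: V'_def intro!: open_Times)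
    then have ev: "eventually (\<lambda>x. x \<in> V') (at (e1, t1))"
      by (meson eventually_at_topological)
    have "isCont (v e1) t1"
      using holt[OF in_dom(1)] \<open>open V\<close> in_dom(2)
      by (meson continuous_on_eq_continuous_at holomorphic_on_imp_continuous_on)
    then have "((\<lambda>x. v e1 (snd x)) \<longlongrightarrow> v e1 t1) (at (e1, t1))"
      by (rule isCont_tendsto_compose) (auto intro!: tendsto_eq_intros)
    moreover have "((\<lambda>x. v (fst x) (snd x) - v e1 (snd x)) \<longlongrightarrow> 0) (at (e1, t1))"
    proof (rule Lim_null_comparison)
      show "eventually (\<lambda>x. norm (v (fst x) (snd x) - v e1 (snd x)) \<le> 2 * B / (r / 2) * norm (fst x - e1)) (at (e1, t1))"
        using ev by eventually_elim (use lip in \<open>auto simp: V'_def\<close>)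
      show "((\<lambda>x. 2 * B / (r / 2) * norm (fst x - e1)) \<longlongrightarrow> 0) (at (e1, t1))"
        using r(1) by (auto intro!: tendsto_eq_intros)
    qed
    ultimately have "((\<lambda>x. (v (fst x) (snd x) - v e1 (snd x)) + v e1 (snd x)) \<longlongrightarrow> 0 + v e1 t1) (at (e1, t1))"
      by (intro tendsto_add)
    then show ?thesis by (simp add: isCont_def case_prod_unfold)
  qed
  then have "continuous_on (U \<times> V) (\<lambda>(e, t). v e t)"
    by (intro continuous_at_imp_continuous_on) auto
  then show ?thesis using hole holt by (simp add: sep_holomorphic_def)
qed

lemma sep_holomorphicI_bounded:
  assumes "open U" "open V"
    and hole: "\<And>t. t \<in> V \<Longrightarrow> (\<lambda>e. v e t) holomorphic_on U"
    and holt: "\<And>e. e \<in> U \<Longrightarrow> v e holomorphic_on V"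
    and bd: "\<And>e t. e \<in> U \<Longrightarrow> t \<in> V \<Longrightarrow> norm (v e t) \<le> B"
  shows "sep_holomorphic U V v"
proof (rule sep_holomorphicI_locally_bounded[OF assms(1-4)])
  fix e t assume "e \<in> U" "t \<in> V"
  then obtain r1 r2 where "r1 > 0" "ball e r1 \<subseteq> U" "r2 > 0" "ball t r2 \<subseteq> V"
    using assms(1,2) by (meson openE)
  then show "\<exists>r>0. \<exists>B. ball e r \<subseteq> U \<and> ball t r \<subseteq> V \<and>
      (\<forall>e'\<in>ball e r. \<forall>t'\<in>ball t r. norm (v e' t') \<le> B)"
    using bd by (intro exI[of _ "min r1 r2"] conjI exI[of _ B]) (auto simp: subset_iff)
qed

lemma sep_holomorphic_locally_bounded:
  assumes v: "sep_holomorphic U V v" and "open U" "open V" "e \<in> U" "t \<in> V"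
  obtains r B where "r > 0" "cball e r \<subseteq> U" "cball t r \<subseteq> V"
    "\<And>e' t'. e' \<in> cball e r \<Longrightarrow> t' \<in> cball t r \<Longrightarrow> norm (v e' t') \<le> B"
proof -
  obtain r1 r2 where r12: "r1 > 0" "cball e r1 \<subseteq> U" "r2 > 0" "cball t r2 \<subseteq> V"
    using assms(2-5) by (meson open_contains_cball)
  define r where "r = min r1 r2"
  have r: "r > 0" "cball e r \<subseteq> U" "cball t r \<subseteq> V"
    using r12 by (auto simp: r_def subset_iff)
  have "compact ((\<lambda>(e, t). v e t) ` (cball e r \<times> cball t r))"
    using r by (intro compact_continuous_image compact_Times compact_cball
        continuous_on_subset[OF sep_holomorphicD(3)[OF v]]) auto
  then have "bounded ((\<lambda>(e, t). v e t) ` (cball e r \<times> cball t r))"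
    by (rule compact_imp_bounded)
  then obtain B where "\<And>x. x \<in> (\<lambda>(e, t). v e t) ` (cball e r \<times> cball t r) \<Longrightarrow> norm x \<le> B"
    unfolding bounded_iff by blast
  then show ?thesis
    by (intro that[OF r, of B]) force
qed

text \<open>Holomorphy of the derivative in the other variable \<open>t\<close>: the difference quotients in \<open>e\<close> are
holomorphic in \<open>t\<close> and, by Cauchy estimates for the second derivative in \<open>e\<close>, converge
uniformly in \<open>t\<close>.\<close>

lemma sep_holomorphic_deriv:
  assumes v: "sep_holomorphic U V v" and "open U" "open V"
  shows "sep_holomorphic U V (\<lambda>e t. deriv (\<lambda>e. v e t) e)"
proof (rule sep_holomorphicI_locally_bounded[OF assms(2,3)])
  show "(\<lambda>e. deriv (\<lambda>e. v e t) e) holomorphic_on U" if "t \<in> V" for t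
    by (intro holomorphic_deriv sep_holomorphicD(1)[OF v that] \<open>open U\<close>)
next
  fix e t assume "e \<in> U" "t \<in> V"
  then obtain r B where r: "r > 0" "cball e r \<subseteq> U" "cball t r \<subseteq> V"
    and B: "\<And>e' t'. e' \<in> cball e r \<Longrightarrow> t' \<in> cball t r \<Longrightarrow> norm (v e' t') \<le> B"
    using sep_holomorphic_locally_bounded[OF assms] by metis
  have "norm (deriv (\<lambda>e. v e t') e') \<le> 2 * B / (r / 2)" if "e' \<in> ball e (r / 2)" "t' \<in> ball t (r / 2)" for e' t'
  proof (rule norm_deriv_le_of_bounded)
    have sub: "ball e' (r / 2) \<subseteq> cball e r"
    proof
      fix y assume "y \<in> ball e' (r / 2)"
      then show "y \<in> cball e r" using that dist_triangle[of e y e'] by simp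
    qed
    show "(\<lambda>e. v e t') holomorphic_on ball e' (r / 2)"
      using that r sub by (intro holomorphic_on_subset[OF sep_holomorphicD(1)[OF v]]) auto
    show "norm (v w t') \<le> B" if "w \<in> ball e' (r / 2)" for w
      using that sub \<open>t' \<in> ball t (r / 2)\<close> r(1) by (intro B) auto
  qed (use r in simp)
  then show "\<exists>r>0. \<exists>B. ball e r \<subseteq> U \<and> ball t r \<subseteq> V \<and>
      (\<forall>e'\<in>ball e r. \<forall>t'\<in>ball t r. norm (deriv (\<lambda>e. v e t') e') \<le> B)"
    using r by (intro exI[of _ "r / 2"] conjI exI[of _ "2 * B / (r / 2)"]) (auto simp: subset_iff)
next
  fix e1 assume e1: "e1 \<in> U"
  have "(\<lambda>t. deriv (\<lambda>e. v e t) e1) field_differentiable at t1" if t1: "t1 \<in> V" for t1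
  proof -
    obtain r B where r: "r > 0" "cball e1 r \<subseteq> U" "cball t1 r \<subseteq> V"
      and B: "\<And>e t. e \<in> cball e1 r \<Longrightarrow> t \<in> cball t1 r \<Longrightarrow> norm (v e t) \<le> B"
      using sep_holomorphic_locally_bounded[OF assms e1 t1] by metis
    define h where "h = (\<lambda>n::nat. of_real (r / (8 + real n)) :: complex)"
    have h: "norm (h n) = r / (8 + real n)" "h n \<noteq> 0" for n
      using r(1) unfolding h_def norm_of_real by (auto simp del: of_real_divide of_real_add)
    have h_less: "norm (h n) < r / 4" for n
      unfolding h(1) using r(1) by (intro divide_strict_left_mono) auto
    define L where "L = 2 * (2 * B / (r / 2)) / (r / 4)"
    have sub1: "ball x (r / 2) \<subseteq> cball e1 r" if "x \<in> ball e1 (r / 2)" for x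
    proof
      fix y assume "y \<in> ball x (r / 2)"
      then show "y \<in> cball e1 r" using that dist_triangle[of e1 y x] by simp
    qed
    have sub2: "ball x (r / 4) \<subseteq> ball e1 (r / 2)" if "x \<in> ball e1 (r / 4)" for x
    proof
      fix y assume "y \<in> ball x (r / 4)"
      then show "y \<in> ball e1 (r / 2)" using that dist_triangle[of e1 y x] by simp
    qed
    have quot: "norm ((v (e1 + h n) t - v e1 t) / h n - deriv (\<lambda>e. v e t) e1) \<le> L * norm (h n)"
      if t: "t \<in> cball t1 r" for t n
    proof -
      have "t \<in> V" using t r by auto
      have hol: "(\<lambda>e. v e t) holomorphic_on U" by (rule sep_holomorphicD(1)[OF v \<open>t \<in> V\<close>])
      let ?d = "deriv (\<lambda>e. v e t)"
      have hold: "?d holomorphic_on U" by (intro holomorphic_deriv hol \<open>open U\<close>)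
      have d_le: "norm (?d x) \<le> 2 * B / (r / 2)" if "x \<in> ball e1 (r / 2)" for x
        using sub1[OF that] r t by (intro norm_deriv_le_of_bounded holomorphic_on_subset[OF hol] B) auto
      have d_lip: "norm (?d x - ?d e1) \<le> L * norm (x - e1)" if "x \<in> ball e1 (r / 4)" for x
        unfolding L_def using r that sub2 d_le
        by (intro holomorphic_imp_lipschitz[of ?d "ball e1 (r / 2)" "r / 4" "ball e1 (r / 4)"]
              holomorphic_on_subset[OF hold]) (auto simp: subset_iff)
      have L0: "L \<ge> 0"
        using order_trans[OF norm_ge_zero B[of e1 t]] t r(1) by (simp add: L_def)
      define S where "S = closed_segment e1 (e1 + h n)"
      have S: "x \<in> ball e1 (r / 4)" "norm (x - e1) \<le> norm (h n)" if "x \<in> S" for x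
      proof -
        show "norm (x - e1) \<le> norm (h n)"
          using segment_bound(1)[of x e1 "e1 + h n"] that by (simp add: S_def)
        then show "x \<in> ball e1 (r / 4)" using h_less[of n] by (simp add: dist_norm norm_minus_commute)
      qed
      have "norm ((v (e1 + h n) t - (e1 + h n) * ?d e1) - (v e1 t - e1 * ?d e1)) \<le>
          L * norm (h n) * norm (e1 + h n - e1)"
      proof (rule field_differentiable_bound[of S "\<lambda>e. v e t - e * ?d e1" "\<lambda>e. ?d e - ?d e1"])
        fix x assume "x \<in> S"
        then have "x \<in> U" using S(1)[OF \<open>x \<in> S\<close>] r by (auto simp: subset_iff)
        then have "((\<lambda>e. v e t) has_field_derivative ?d x) (at x)"
          by (intro holomorphic_derivI[OF hol \<open>open U\<close>])
        then have "((\<lambda>e. v e t - e * ?d e1) has_field_derivative ?d x - 1 * ?d e1) (at x)"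
          by (rule DERIV_diff[OF _ DERIV_cmult_right[OF DERIV_ident]])
        then show "((\<lambda>e. v e t - e * ?d e1) has_field_derivative ?d x - ?d e1) (at x within S)"
          by (simp add: has_field_derivative_at_within)
        show "norm (?d x - ?d e1) \<le> L * norm (h n)"
          using d_lip[OF S(1)[OF \<open>x \<in> S\<close>]] S(2)[OF \<open>x \<in> S\<close>] L0 by (meson mult_left_mono order_trans)
      qed (auto simp: S_def)
      then have "norm ((v (e1 + h n) t - v e1 t) - h n * ?d e1) \<le> L * norm (h n) * norm (h n)"
        by (simp add: algebra_simps)
      moreover have "norm ((v (e1 + h n) t - v e1 t) / h n - ?d e1) =
          norm ((v (e1 + h n) t - v e1 t) - h n * ?d e1) / norm (h n)"
        using h(2)[of n] by (simp add: norm_divide[symmetric] diff_divide_distrib)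
      ultimately show ?thesis using h(2)[of n] by (simp add: divide_le_eq)
    qed
    have lim: "uniform_limit (cball t1 r) (\<lambda>n t. (v (e1 + h n) t - v e1 t) / h n)
        (\<lambda>t. deriv (\<lambda>e. v e t) e1) sequentially"
    proof (rule uniform_limitI)
      fix \<epsilon> :: real assume "\<epsilon> > 0"
      have "(\<lambda>n. L * (r / (8 + real n))) \<longlonglongrightarrow> 0" by real_asymp
      then have "eventually (\<lambda>n. L * (r / (8 + real n)) < \<epsilon>) sequentially"
        using \<open>\<epsilon> > 0\<close> by (rule order_tendstoD)
      then show "\<forall>\<^sub>F n in sequentially. \<forall>t\<in>cball t1 r.
          dist ((v (e1 + h n) t - v e1 t) / h n) (deriv (\<lambda>e. v e t) e1) < \<epsilon>"
      proof eventually_elim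
        case (elim n)
        show ?case
        proof
          fix t assume "t \<in> cball t1 r"
          then show "dist ((v (e1 + h n) t - v e1 t) / h n) (deriv (\<lambda>e. v e t) e1) < \<epsilon>"
            using quot[of t n] elim by (simp add: dist_norm h(1))
        qed
      qed
    qed
    have "(\<lambda>t. (v (e1 + h n) t - v e1 t) / h n) holomorphic_on V" for n
    proof -
      have "e1 + h n \<in> U" using r h_less[of n] by (auto simp: subset_iff dist_norm)
      then show ?thesis
        using e1 h(2)[of n] by (auto intro!: holomorphic_intros sep_holomorphicD(2)[OF v])
    qed
    then have "\<forall>n. continuous_on (cball t1 r) (\<lambda>t. (v (e1 + h n) t - v e1 t) / h n) \<and>
        (\<lambda>t. (v (e1 + h n) t - v e1 t) / h n) holomorphic_on ball t1 r"
      using r(3) ball_subset_cball[of t1 r]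
      by (meson holomorphic_on_imp_continuous_on holomorphic_on_subset subset_trans)
    then have "(\<lambda>t. deriv (\<lambda>e. v e t) e1) holomorphic_on ball t1 r"
      by (rule holomorphic_uniform_limit[OF always_eventually lim]) auto
    then show ?thesis
      using r by (intro holomorphic_on_imp_differentiable_at[of _ "ball t1 r"]) auto
  qed
  then show "(\<lambda>t. deriv (\<lambda>e. v e t) e1) holomorphic_on V"
    by (simp add: holomorphic_on_def field_differentiable_at_within)
qed

lemma holomorphic_integral_param:
  assumes v: "sep_holomorphic U V v" and "open U" "open V" and "convex U"
    and \<gamma>: "continuous_on {0..1} \<gamma>" "\<And>s. s \<in> {0..1::real} \<Longrightarrow> \<gamma> s \<in> V"
  shows "(\<lambda>e. integral {0..1} (\<lambda>s. v e (\<gamma> s))) holomorphic_on U"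
proof -
  have "(\<lambda>e. integral (cbox 0 1) (\<lambda>s. v e (\<gamma> s))) holomorphic_on U"
  proof (rule leibniz_rule_holomorphic[OF _ _ _ \<open>convex U\<close>])
    fix e and s :: real assume es: "e \<in> U" "s \<in> cbox 0 1"
    then have "\<gamma> s \<in> V" using \<gamma>(2) by simp
    show "((\<lambda>e. v e (\<gamma> s)) has_field_derivative deriv (\<lambda>e. v e (\<gamma> s)) e) (at e within U)"
      by (rule has_field_derivative_at_within[OF holomorphic_derivI[OF
            sep_holomorphicD(1)[OF v \<open>\<gamma> s \<in> V\<close>] \<open>open U\<close> es(1)]])
  next
    fix e assume "e \<in> U"
    have "continuous_on {0..1} (\<lambda>s. v e (\<gamma> s))"
      by (rule continuous_on_compose2[OF holomorphic_on_imp_continuous_on[OF sep_holomorphicD(2)[OF v \<open>e \<in> U\<close>]] \<gamma>(1)])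
         (use \<gamma>(2) in auto)
    then show "(\<lambda>s. v e (\<gamma> s)) integrable_on cbox 0 1"
      using integrable_continuous_interval by auto
  next
    have c: "continuous_on (U \<times> V) (\<lambda>x. deriv (\<lambda>e. v e (snd x)) (fst x))"
      using sep_holomorphicD(3)[OF sep_holomorphic_deriv[OF assms(1-3)]] by (simp add: case_prod_unfold)
    show "continuous_on (U \<times> cbox 0 1) (\<lambda>(e, s). deriv (\<lambda>e. v e (\<gamma> s)) e)"
      unfolding case_prod_unfold
      by (rule continuous_on_compose2[OF c, of _ "\<lambda>x. (fst x, \<gamma> (snd x))", simplified])
         (use \<gamma> in \<open>auto intro!: continuous_intros continuous_on_compose2[OF \<gamma>(1)]\<close>)
  qed
  then show ?thesis by simp
qed

section \<open>Zero-mean primitives of periodic functions on a strip\<close>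

definition strip :: "real \<Rightarrow> complex set"
  where "strip \<delta> = {t. \<bar>Im t\<bar> < \<delta>}"

lemma open_strip: "open (strip \<delta>)"
proof -
  have "strip \<delta> = Im -` {-\<delta><..<\<delta>}" by (auto simp: strip_def)
  then show ?thesis by (simp add: open_vimage continuous_on_Im)
qed

lemma convex_strip: "convex (strip \<delta>)"
proof -
  have "strip \<delta> = {t. Im t < \<delta>} \<inter> {t. Im t > - \<delta>}" by (auto simp: strip_def)
  then show ?thesis by (simp add: convex_Int convex_halfspace_Im_lt convex_halfspace_Im_gt)
qed

lemma of_real_in_strip: "\<delta> > 0 \<Longrightarrow> of_real x \<in> strip \<delta>"
  by (simp add: strip_def)

lemma scaled_in_strip: "t \<in> strip \<delta> \<Longrightarrow> s \<in> {0..1} \<Longrightarrow> of_real s * t \<in> strip \<delta>"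
proof -
  assume t: "t \<in> strip \<delta>" and s: "s \<in> {0..1}"
  have "\<bar>Im (of_real s * t)\<bar> \<le> 1 * \<bar>Im t\<bar>"
    using s by (simp add: abs_mult mult_left_le_one_le)
  then show ?thesis using t by (simp add: strip_def)
qed

lemma add_of_real_in_strip: "t + of_real x \<in> strip \<delta> \<longleftrightarrow> t \<in> strip \<delta>"
  by (simp add: strip_def)

definition mean :: "real \<Rightarrow> (complex \<Rightarrow> complex) \<Rightarrow> complex"
  where "mean T g = integral {0..1} (\<lambda>s. g (of_real (s * T)))"

text \<open>The primitive vanishing at \<open>0\<close>, written as an integral over a fixed interval so that holomorphic
dependence on parameters is differentiation under the integral sign.\<close>

definition primitive0 :: "(complex \<Rightarrow> complex) \<Rightarrow> complex \<Rightarrow> complex"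
  where "primitive0 g t = t * integral {0..1} (\<lambda>s. g (of_real s * t))"

definition osc_primitive :: "real \<Rightarrow> (complex \<Rightarrow> complex) \<Rightarrow> complex \<Rightarrow> complex"
  where "osc_primitive T g t = primitive0 g t - t * mean T g"

definition zero_mean_primitive :: "real \<Rightarrow> (complex \<Rightarrow> complex) \<Rightarrow> complex \<Rightarrow> complex"
  where "zero_mean_primitive T g t = osc_primitive T g t - mean T (osc_primitive T g)"

lemma integrable_on_segment:
  assumes "g holomorphic_on strip \<delta>" "t \<in> strip \<delta>"
  shows "(\<lambda>s. g (of_real s * t)) integrable_on {0..1}"
  by (intro integrable_continuous_interval
      continuous_on_compose2[OF holomorphic_on_imp_continuous_on[OF assms(1)]] continuous_intros)
     (use scaled_in_strip[OF assms(2)] in auto)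

lemma integrable_on_period:
  assumes "g holomorphic_on strip \<delta>" "\<delta> > 0"
  shows "(\<lambda>s. g (of_real (s * T))) integrable_on {0..1}"
  using integrable_on_segment[OF assms(1) of_real_in_strip[OF assms(2), of T]] by simp

lemma mean_diff:
  assumes "g holomorphic_on strip \<delta>" "h holomorphic_on strip \<delta>" "\<delta> > 0"
  shows "mean T (\<lambda>t. g t - h t) = mean T g - mean T h"
  unfolding mean_def by (intro integral_diff integrable_on_period[OF _ assms(3)] assms)

lemma mean_add:
  assumes "g holomorphic_on strip \<delta>" "h holomorphic_on strip \<delta>" "\<delta> > 0"
  shows "mean T (\<lambda>t. g t + h t) = mean T g + mean T h"
  unfolding mean_def by (intro integral_add integrable_on_period[OF _ assms(3)] assms)

lemma mean_const: "mean T (\<lambda>t. c) = c"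
  by (simp add: mean_def)

lemma mean_cmult: "mean T (\<lambda>t. c * g t) = c * mean T g"
  by (simp add: mean_def)

lemma norm_integral_unit_interval_le:
  fixes f :: "real \<Rightarrow> complex"
  assumes "f integrable_on {0..1}" "\<And>s. s \<in> {0..1} \<Longrightarrow> norm (f s) \<le> B"
  shows "norm (integral {0..1} f) \<le> B"
proof -
  have "norm (integral {0..1} f) \<le> integral {0..1} (\<lambda>s::real. B)"
    by (rule integral_norm_bound_integral[OF assms(1) _ assms(2)]) auto
  then show ?thesis by simp
qed

lemma norm_mean_le:
  assumes "g holomorphic_on strip \<delta>" "\<delta> > 0" "\<And>t. t \<in> strip \<delta> \<Longrightarrow> norm (g t) \<le> B"
  shows "norm (mean T g) \<le> B"
  unfolding mean_def
  by (rule norm_integral_unit_interval_le[OF integrable_on_period[OF assms(1,2)]])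
     (use assms(2,3) of_real_in_strip in blast)

lemma integral_Reals:
  fixes f :: "real \<Rightarrow> complex"
  assumes "f integrable_on {0..1}" "\<And>s. s \<in> {0..1} \<Longrightarrow> f s \<in> \<real>"
  shows "integral {0..1} f \<in> \<real>"
proof -
  have "Im (integral {0..1} f) = integral {0..1} (\<lambda>s. Im (f s))"
    using integral_linear[OF assms(1) bounded_linear_Im] by (simp add: o_def)
  also have "\<dots> = integral {0..1} (\<lambda>s::real. 0)"
    using assms(2) by (intro integral_cong) (simp add: complex_is_Real_iff)
  finally show ?thesis by (simp add: complex_is_Real_iff)
qed

lemma mean_Reals:
  assumes "g holomorphic_on strip \<delta>" "\<delta> > 0" "\<And>x. g (of_real x) \<in> \<real>"
  shows "mean T g \<in> \<real>"
  unfolding mean_def by (rule integral_Reals[OF integrable_on_period[OF assms(1,2)] assms(3)])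

lemma primitive0_Reals:
  assumes "g holomorphic_on strip \<delta>" "\<delta> > 0" "\<And>x. g (of_real x) \<in> \<real>"
  shows "primitive0 g (of_real x) \<in> \<real>"
  unfolding primitive0_def
  by (intro Reals_mult Reals_of_real integral_Reals[OF integrable_on_segment[OF assms(1)]])
     (use assms(2,3) of_real_in_strip in \<open>auto simp flip: of_real_mult\<close>)

lemma primitive0_eq:
  assumes "\<And>x. x \<in> strip \<delta> \<Longrightarrow> (G has_field_derivative g x) (at x)" "t \<in> strip \<delta>"
  shows "primitive0 g t = G t - G 0"
proof -
  have "((\<lambda>s. G (of_real s * t)) has_vector_derivative g (of_real s * t) * t) (at s within {0..1})"
    if "s \<in> {0..1}" for s :: real
  proof -
    have "((\<lambda>s. of_real s * t) has_vector_derivative of_real 1 * t) (at s within {0..1})"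
      by (intro has_vector_derivative_mult_left has_vector_derivative_of_real DERIV_ident)
    from field_vector_diff_chain_within[OF this, of G "g (of_real s * t)"]
    show ?thesis
      using assms(1)[OF scaled_in_strip[OF assms(2) that]]
      by (simp add: o_def has_field_derivative_at_within mult.commute)
  qed
  then have "((\<lambda>s. g (of_real s * t) * t) has_integral (G (of_real 1 * t) - G (of_real 0 * t))) {0..1}"
    by (intro fundamental_theorem_of_calculus) auto
  then have "integral {0..1} (\<lambda>s. g (of_real s * t) * t) = G t - G 0"
    by (intro integral_unique) simp
  then show ?thesis by (simp add: primitive0_def mult.commute)
qed

lemma primitive_on_strip:
  assumes "g holomorphic_on strip \<delta>"
  obtains G where "\<And>x. x \<in> strip \<delta> \<Longrightarrow> (G has_field_derivative g x) (at x)"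
proof -
  obtain G where "\<And>x. x \<in> strip \<delta> \<Longrightarrow> (G has_field_derivative g x) (at x within strip \<delta>)"
    using holomorphic_convex_primitive'[OF convex_strip open_strip assms] by blast
  then show ?thesis using that[of G] by (simp add: at_within_open[OF _ open_strip])
qed

lemma primitive0_has_derivative:
  assumes "g holomorphic_on strip \<delta>" "t \<in> strip \<delta>"
  shows "(primitive0 g has_field_derivative g t) (at t)"
proof -
  obtain G where G: "\<And>x. x \<in> strip \<delta> \<Longrightarrow> (G has_field_derivative g x) (at x)"
    using primitive_on_strip[OF assms(1)] by blast
  have "((\<lambda>x. G x - G 0) has_field_derivative g t - 0) (at t)"
    by (intro DERIV_diff G assms(2) DERIV_const)
  then have "((\<lambda>x. G x - G 0) has_field_derivative g t) (at t)" by simp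
  then show ?thesis
    by (rule has_field_derivative_transform_within_open[OF _ open_strip assms(2)])
       (rule primitive0_eq[OF G, symmetric])
qed

lemma osc_primitive_has_derivative:
  assumes "g holomorphic_on strip \<delta>" "t \<in> strip \<delta>"
  shows "(osc_primitive T g has_field_derivative g t - mean T g) (at t)"
proof -
  have "((\<lambda>t. primitive0 g t - t * mean T g) has_field_derivative g t - 1 * mean T g) (at t)"
    by (intro DERIV_diff primitive0_has_derivative[OF assms] DERIV_cmult_right[OF DERIV_ident])
  then show ?thesis by (simp add: osc_primitive_def[abs_def])
qed

lemma osc_primitive_holomorphic:
  assumes "g holomorphic_on strip \<delta>"
  shows "osc_primitive T g holomorphic_on strip \<delta>"
  using osc_primitive_has_derivative[OF assms] open_strip by (auto simp: holomorphic_on_open)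

lemma zero_mean_primitive_has_derivative:
  assumes "g holomorphic_on strip \<delta>" "t \<in> strip \<delta>"
  shows "(zero_mean_primitive T g has_field_derivative g t - mean T g) (at t)"
proof -
  have "((\<lambda>t. osc_primitive T g t - mean T (osc_primitive T g)) has_field_derivative g t - mean T g - 0) (at t)"
    by (intro DERIV_diff osc_primitive_has_derivative[OF assms] DERIV_const)
  then show ?thesis by (simp add: zero_mean_primitive_def[abs_def])
qed

lemma zero_mean_primitive_holomorphic:
  assumes "g holomorphic_on strip \<delta>"
  shows "zero_mean_primitive T g holomorphic_on strip \<delta>"
  using zero_mean_primitive_has_derivative[OF assms] open_strip by (auto simp: holomorphic_on_open)

text \<open>The increment over a period has vanishing derivative, hence equals its value at \<open>0\<close>, which is the
integral of \<open>g - mean T g\<close> over one period.\<close>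

lemma osc_primitive_periodic:
  assumes g: "g holomorphic_on strip \<delta>" and per: "\<And>t. t \<in> strip \<delta> \<Longrightarrow> g (t + of_real T) = g t"
    and "\<delta> > 0" "t \<in> strip \<delta>"
  shows "osc_primitive T g (t + of_real T) = osc_primitive T g t"
proof -
  let ?D = "\<lambda>t. osc_primitive T g (t + of_real T) - osc_primitive T g t"
  have "(?D has_field_derivative 0) (at x)" if "x \<in> strip \<delta>" for x
  proof -
    have "((\<lambda>x. osc_primitive T g (x + of_real T)) has_field_derivative g (x + of_real T) - mean T g) (at x)"
      using osc_primitive_has_derivative[OF g, of "x + of_real T"] that
      by (simp add: add_of_real_in_strip DERIV_shift)
    from DERIV_diff[OF this osc_primitive_has_derivative[OF g that, of T]] show ?thesis
      by (simp add: per[OF that])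
  qed
  then have "\<exists>c. \<forall>x\<in>strip \<delta>. ?D x = c"
    by (intro has_field_derivative_zero_constant[OF convex_strip]) (auto intro: has_field_derivative_at_within)
  then obtain c where c: "\<And>x. x \<in> strip \<delta> \<Longrightarrow> ?D x = c" by blast
  have "?D 0 = 0"
    by (simp add: osc_primitive_def primitive0_def mean_def)
  then have "c = 0" using c[of 0] \<open>\<delta> > 0\<close> by (simp add: strip_def)
  then show ?thesis using c[OF assms(4)] by simp
qed

lemma zero_mean_primitive_periodic:
  assumes "g holomorphic_on strip \<delta>" "\<And>t. t \<in> strip \<delta> \<Longrightarrow> g (t + of_real T) = g t" "\<delta> > 0" "t \<in> strip \<delta>"
  shows "zero_mean_primitive T g (t + of_real T) = zero_mean_primitive T g t"
  using osc_primitive_periodic[OF assms] by (simp add: zero_mean_primitive_def)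

lemma mean_zero_mean_primitive:
  assumes "g holomorphic_on strip \<delta>" "\<delta> > 0"
  shows "mean T (zero_mean_primitive T g) = 0"
  using mean_diff[OF osc_primitive_holomorphic[OF assms(1)] holomorphic_on_const assms(2)]
  by (simp add: zero_mean_primitive_def[abs_def] mean_const)

lemma zero_mean_primitive_Reals:
  assumes "g holomorphic_on strip \<delta>" "\<delta> > 0" "\<And>x. g (of_real x) \<in> \<real>"
  shows "zero_mean_primitive T g (of_real x) \<in> \<real>"
proof -
  have "osc_primitive T g (of_real x) \<in> \<real>" for x
    unfolding osc_primitive_def by (intro Reals_diff Reals_mult Reals_of_real mean_Reals[OF assms] primitive0_Reals[OF assms])
  then show ?thesis unfolding zero_mean_primitive_def
    by (intro Reals_diff mean_Reals[OF osc_primitive_holomorphic[OF assms(1)] assms(2)])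
qed

lemma norm_primitive0_le:
  assumes "g holomorphic_on strip \<delta>" "t \<in> strip \<delta>" "\<And>t. t \<in> strip \<delta> \<Longrightarrow> norm (g t) \<le> B"
  shows "norm (primitive0 g t) \<le> norm t * B"
  unfolding primitive0_def norm_mult
  by (intro mult_left_mono norm_integral_unit_interval_le integrable_on_segment[OF assms(1,2)] assms(3)
      scaled_in_strip assms(2)) auto

lemma periodic_on_strip_of_int_mult:
  assumes per: "\<And>t. t \<in> strip \<delta> \<Longrightarrow> g (t + of_real T) = g t" and "t \<in> strip \<delta>"
  shows "g (t + of_int n * of_real T) = g t"
proof -
  define g' where "g' = (\<lambda>t. if t \<in> strip \<delta> then g t else undefined)"
  have "g' (t + of_int n * of_real T) = g' t"
    by (rule periodic_of_int_mult) (simp add: g'_def add_of_real_in_strip per)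
  moreover have "t + of_int n * of_real T \<in> strip \<delta>"
    using assms(2) by (simp add: strip_def)
  ultimately show ?thesis using assms(2) by (simp add: g'_def)
qed

text \<open>A point of the infinite strip is moved by a multiple of the period to one of norm at most \<open>T + \<delta>\<close>,
so the bound on the primitive is uniform on the strip.\<close>

lemma norm_osc_primitive_le:
  assumes g: "g holomorphic_on strip \<delta>" and per: "\<And>t. t \<in> strip \<delta> \<Longrightarrow> g (t + of_real T) = g t"
    and "\<delta> > 0" "T > 0" and bd: "\<And>t. t \<in> strip \<delta> \<Longrightarrow> norm (g t) \<le> B" and t: "t \<in> strip \<delta>"
  shows "norm (osc_primitive T g t) \<le> 2 * (T + \<delta>) * B"
proof -
  have "B \<ge> 0" using order_trans[OF norm_ge_zero bd[OF t]] .
  define n where "n = \<lfloor>Re t / T\<rfloor>"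
  define t' where "t' = t - of_int n * of_real T"
  have t': "t' \<in> strip \<delta>" using t by (simp add: t'_def strip_def)
  have "0 \<le> Re t'" "Re t' \<le> T"
    using floor_divide_lower[OF \<open>T > 0\<close>, of "Re t"] floor_divide_upper[OF \<open>T > 0\<close>, of "Re t"]
    by (simp_all add: t'_def n_def algebra_simps)
  then have "norm t' \<le> T + \<delta>"
    using cmod_le[of t'] t' by (simp add: strip_def)
  have "osc_primitive T g t = osc_primitive T g t'"
    using periodic_on_strip_of_int_mult[of \<delta> "osc_primitive T g" T, OF osc_primitive_periodic[OF g per \<open>\<delta> > 0\<close>] t', of n]
    by (simp add: t'_def)
  also have "norm \<dots> \<le> norm (primitive0 g t') + norm (t' * mean T g)"
    unfolding osc_primitive_def by (rule norm_triangle_ineq4)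
  also have "\<dots> \<le> norm t' * B + norm t' * B"
    unfolding norm_mult
    by (intro add_mono norm_primitive0_le[OF g t' bd] mult_left_mono norm_mean_le[OF g \<open>\<delta> > 0\<close> bd]) auto
  also have "\<dots> = 2 * norm t' * B" by simp
  also have "\<dots> \<le> 2 * (T + \<delta>) * B"
    using \<open>norm t' \<le> T + \<delta>\<close> \<open>B \<ge> 0\<close> by (intro mult_right_mono) auto
  finally show ?thesis .
qed

lemma norm_zero_mean_primitive_le:
  assumes "g holomorphic_on strip \<delta>" "\<And>t. t \<in> strip \<delta> \<Longrightarrow> g (t + of_real T) = g t"
    and "\<delta> > 0" "T > 0" "\<And>t. t \<in> strip \<delta> \<Longrightarrow> norm (g t) \<le> B" "t \<in> strip \<delta>"
  shows "norm (zero_mean_primitive T g t) \<le> 4 * (T + \<delta>) * B"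
proof -
  have "norm (zero_mean_primitive T g t) \<le> norm (osc_primitive T g t) + norm (mean T (osc_primitive T g))"
    unfolding zero_mean_primitive_def by (rule norm_triangle_ineq4)
  also have "\<dots> \<le> 2 * (T + \<delta>) * B + 2 * (T + \<delta>) * B"
    by (intro add_mono norm_osc_primitive_le[OF assms]
        norm_mean_le[OF osc_primitive_holomorphic[OF assms(1)] assms(3)] norm_osc_primitive_le[OF assms(1-5)])
  finally show ?thesis by (simp add: algebra_simps)
qed

lemma primitive0_diff:
  assumes "g holomorphic_on strip \<delta>" "h holomorphic_on strip \<delta>" "t \<in> strip \<delta>"
  shows "primitive0 (\<lambda>t. g t - h t) t = primitive0 g t - primitive0 h t"
  unfolding primitive0_def
  by (subst integral_diff) (use integrable_on_segment assms in \<open>auto simp: algebra_simps\<close>)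

lemma zero_mean_primitive_diff:
  assumes "g holomorphic_on strip \<delta>" "h holomorphic_on strip \<delta>" "\<delta> > 0" "t \<in> strip \<delta>"
  shows "zero_mean_primitive T (\<lambda>t. g t - h t) t = zero_mean_primitive T g t - zero_mean_primitive T h t"
proof -
  have osc: "osc_primitive T (\<lambda>t. g t - h t) t = osc_primitive T g t - osc_primitive T h t" if "t \<in> strip \<delta>" for t
    unfolding osc_primitive_def primitive0_diff[OF assms(1,2) that] mean_diff[OF assms(1-3)]
    by (simp add: algebra_simps)
  have "mean T (osc_primitive T (\<lambda>t. g t - h t)) = mean T (\<lambda>t. osc_primitive T g t - osc_primitive T h t)"
    unfolding mean_def by (intro integral_cong osc of_real_in_strip assms(3))
  also have "\<dots> = mean T (osc_primitive T g) - mean T (osc_primitive T h)"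
    by (intro mean_diff[OF _ _ assms(3)] osc_primitive_holomorphic assms)
  finally show ?thesis by (simp add: zero_mean_primitive_def osc[OF assms(4)])
qed

lemma sep_holomorphic_mean:
  assumes v: "sep_holomorphic U (strip \<delta>) v" and "open U" "convex U" "\<delta> > 0"
  shows "(\<lambda>e. mean T (v e)) holomorphic_on U"
  unfolding mean_def
  by (rule holomorphic_integral_param[OF v \<open>open U\<close> open_strip \<open>convex U\<close>])
     (use of_real_in_strip[OF \<open>\<delta> > 0\<close>] in \<open>auto intro!: continuous_intros simp del: of_real_mult\<close>)

lemma sep_holomorphic_zero_mean_primitive:
  assumes v: "sep_holomorphic U (strip \<delta>) v" and U: "open U" "convex U" and "\<delta> > 0" "T > 0"
    and per: "\<And>e t. e \<in> U \<Longrightarrow> t \<in> strip \<delta> \<Longrightarrow> v e (t + of_real T) = v e t"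
    and bd: "\<And>e t. e \<in> U \<Longrightarrow> t \<in> strip \<delta> \<Longrightarrow> norm (v e t) \<le> B"
  shows "sep_holomorphic U (strip \<delta>) (\<lambda>e. zero_mean_primitive T (v e))"
proof -
  have hole: "(\<lambda>e. osc_primitive T (v e) t) holomorphic_on U" if "t \<in> strip \<delta>" for t
    unfolding osc_primitive_def primitive0_def
    by (intro holomorphic_intros sep_holomorphic_mean[OF v U \<open>\<delta> > 0\<close>]
        holomorphic_integral_param[OF v \<open>open U\<close> open_strip \<open>convex U\<close>] scaled_in_strip[OF that])
       (auto intro!: continuous_intros)
  have osc: "sep_holomorphic U (strip \<delta>) (\<lambda>e. osc_primitive T (v e))"
    by (rule sep_holomorphicI_bounded[OF U(1) open_strip hole])
       (auto intro!: osc_primitive_holomorphic norm_osc_primitive_le sep_holomorphicD(2)[OF v] per bd \<open>\<delta> > 0\<close> \<open>T > 0\<close>)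
  show ?thesis
  proof (rule sep_holomorphicI_bounded[OF U(1) open_strip])
    show "(\<lambda>e. zero_mean_primitive T (v e) t) holomorphic_on U" if "t \<in> strip \<delta>" for t
      unfolding zero_mean_primitive_def
      by (intro holomorphic_on_diff hole[OF that] sep_holomorphic_mean[OF osc U \<open>\<delta> > 0\<close>])
    show "zero_mean_primitive T (v e) holomorphic_on strip \<delta>" if "e \<in> U" for e
      by (intro zero_mean_primitive_holomorphic sep_holomorphicD(2)[OF v that])
    show "norm (zero_mean_primitive T (v e) t) \<le> 4 * (T + \<delta>) * B" if "e \<in> U" "t \<in> strip \<delta>" for e t
      by (rule norm_zero_mean_primitive_le[OF sep_holomorphicD(2)[OF v that(1)] per[OF that(1)] \<open>\<delta> > 0\<close> \<open>T > 0\<close> bd[OF that(1)] that(2)])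
  qed
qed

section \<open>Joint real analyticity of separately holomorphic functions\<close>

lemma sep_holomorphic_higher_deriv:
  assumes "sep_holomorphic U V v" "open U" "open V"
  shows "sep_holomorphic U V (\<lambda>e t. (deriv ^^ n) (\<lambda>e. v e t) e)"
proof (induction n)
  case (Suc n)
  from sep_holomorphic_deriv[OF this assms(2,3)] show ?case by simp
qed (use assms(1) in simp)

lemma geometric_has_sum:
  fixes q :: real
  assumes "0 \<le> q" "q < 1"
  shows "((\<lambda>n. q ^ n) has_sum 1 / (1 - q)) UNIV"
  using assms by (intro norm_summable_imp_has_sum geometric_sums) (auto simp: norm_power intro!: summable_geometric)

text \<open>Expand in \<open>e\<close>; the coefficients \<open>a n\<close> are holomorphic in \<open>t\<close>, as derivatives of a separately
holomorphic function, and are expanded in turn. Cauchy estimates in both variables dominate the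
double series by a product of two geometric series.\<close>

lemma sep_holomorphic_double_power_series:
  assumes v: "sep_holomorphic U V v" and "open U" "open V" "e1 \<in> U" "t1 \<in> V"
  obtains r c where "r > 0" "\<And>e t. e \<in> ball e1 r \<Longrightarrow> t \<in> ball t1 r \<Longrightarrow>
    ((\<lambda>(n, m). c n m * (e - e1) ^ n * (t - t1) ^ m) has_sum v e t) (UNIV \<times> UNIV)"
proof -
  obtain r B where r: "r > 0" "cball e1 r \<subseteq> U" "cball t1 r \<subseteq> V"
    and B: "\<And>e t. e \<in> cball e1 r \<Longrightarrow> t \<in> cball t1 r \<Longrightarrow> norm (v e t) \<le> B"
    using sep_holomorphic_locally_bounded[OF assms] by metis
  define a where "a = (\<lambda>n t. (deriv ^^ n) (\<lambda>e. v e t) e1)"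
  have hola: "a n holomorphic_on V" for n
    unfolding a_def by (rule sep_holomorphicD(2)[OF sep_holomorphic_higher_deriv[OF assms(1-3)] \<open>e1 \<in> U\<close>])
  have hole: "(\<lambda>e. v e t) holomorphic_on U" if "t \<in> V" for t
    by (rule sep_holomorphicD(1)[OF v that])
  have a_le: "norm (a n t) \<le> fact n * B / r ^ n" if "t \<in> cball t1 r" for n t
    unfolding a_def
  proof (rule Cauchy_inequality)
    have "t \<in> V" using that r by auto
    then show "(\<lambda>e. v e t) holomorphic_on ball e1 r" "continuous_on (cball e1 r) (\<lambda>e. v e t)"
      using hole r ball_subset_cball[of e1 r]
      by (meson holomorphic_on_imp_continuous_on holomorphic_on_subset subset_trans)+
    show "norm (v e t) \<le> B" if "norm (e1 - e) = r" for e
      using that \<open>t \<in> cball t1 r\<close> by (intro B) (auto simp: dist_norm)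
  qed (use r in simp)
  define c where "c = (\<lambda>n m. (deriv ^^ m) (a n) t1 / fact m / fact n)"
  have c_le: "norm (c n m) \<le> B / r ^ n / r ^ m" for n m
  proof -
    have "norm ((deriv ^^ m) (a n) t1) \<le> fact m * (fact n * B / r ^ n) / r ^ m"
    proof (rule Cauchy_inequality)
      show "a n holomorphic_on ball t1 r" "continuous_on (cball t1 r) (a n)"
        using hola r ball_subset_cball[of t1 r]
        by (meson holomorphic_on_imp_continuous_on holomorphic_on_subset subset_trans)+
      show "norm (a n t) \<le> fact n * B / r ^ n" if "norm (t1 - t) = r" for t
        using that by (intro a_le) (auto simp: dist_norm)
    qed (use r in simp)
    then have "norm ((deriv ^^ m) (a n) t1) / fact m / fact n \<le> fact m * (fact n * B / r ^ n) / r ^ m / fact m / fact n"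
      by (intro divide_right_mono) auto
    then show ?thesis by (simp only: c_def norm_divide norm_fact) (simp add: field_simps)
  qed
  have B0: "B \<ge> 0" using order_trans[OF norm_ge_zero B[of e1 t1]] r(1) by simp
  have main: "((\<lambda>(n, m). c n m * (e - e1) ^ n * (t - t1) ^ m) has_sum v e t) (UNIV \<times> UNIV)"
    if e: "e \<in> ball e1 r" and t: "t \<in> ball t1 r" for e t
  proof -
    define q p where "q = norm (e - e1) / r" and "p = norm (t - t1) / r"
    have q: "0 \<le> q" "q < 1" "0 \<le> p" "p < 1"
      using e t r by (auto simp: q_def p_def dist_norm norm_minus_commute)
    have term_le: "norm (c n m * (e - e1) ^ n * (t - t1) ^ m) \<le> B * q ^ n * p ^ m" for n m
    proof -
      have "norm (c n m * (e - e1) ^ n * (t - t1) ^ m) = norm (c n m) * (norm (e - e1) ^ n * norm (t - t1) ^ m)"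
        by (simp add: norm_mult norm_power)
      also have "\<dots> \<le> B / r ^ n / r ^ m * (norm (e - e1) ^ n * norm (t - t1) ^ m)"
        by (intro mult_right_mono c_le) auto
      also have "\<dots> = B * q ^ n * p ^ m"
        by (simp add: q_def p_def power_divide)
      finally show ?thesis .
    qed
    have inner: "((\<lambda>m. B * q ^ n * p ^ m) has_sum B * q ^ n * (1 / (1 - p))) UNIV" for n
      by (rule has_sum_cmult_right[OF geometric_has_sum]) (use q in auto)
    have outer: "((\<lambda>n. B * (1 / (1 - p)) * q ^ n) has_sum B * (1 / (1 - p)) * (1 / (1 - q))) UNIV"
      by (rule has_sum_cmult_right[OF geometric_has_sum]) (use q in auto)
    have "(\<lambda>(n, m). B * q ^ n * p ^ m) summable_on (UNIV \<times> UNIV)"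
    proof (rule summable_on_SigmaI)
      show "((\<lambda>m. (\<lambda>(n, m). B * q ^ n * p ^ m) (n, m)) has_sum B * (1 / (1 - p)) * q ^ n) UNIV" for n
        using inner[of n] by (simp add: mult_ac)
      show "(\<lambda>n. B * (1 / (1 - p)) * q ^ n) summable_on UNIV"
        using outer by (rule has_sum_imp_summable)
    qed (use B0 q in auto)
    then have "(\<lambda>x. norm ((\<lambda>(n, m). c n m * (e - e1) ^ n * (t - t1) ^ m) x)) summable_on (UNIV \<times> UNIV)"
      by (rule Infinite_Sum.abs_summable_on_comparison_test') (use term_le in auto)
    then have total: "(\<lambda>(n, m). c n m * (e - e1) ^ n * (t - t1) ^ m) summable_on (UNIV \<times> UNIV)"
      by (rule abs_summable_summable)
    have "t \<in> V" using t r ball_subset_cball by blast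
    have sums_t: "((\<lambda>m. c n m * (e - e1) ^ n * (t - t1) ^ m) has_sum a n t / fact n * (e - e1) ^ n) UNIV" for n
    proof (rule norm_summable_imp_has_sum)
      show "summable (\<lambda>m. norm (c n m * (e - e1) ^ n * (t - t1) ^ m))"
        by (rule summable_comparison_test'[of "\<lambda>m. B * q ^ n * p ^ m" 0])
           (use q term_le in \<open>auto intro!: summable_mult summable_geometric\<close>)
      have "(\<lambda>m. (deriv ^^ m) (a n) t1 / fact m * (t - t1) ^ m) sums a n t"
      proof (rule holomorphic_power_series[OF _ t])
        show "a n holomorphic_on ball t1 r"
          using hola r ball_subset_cball[of t1 r] by (meson holomorphic_on_subset subset_trans)
      qed
      from sums_mult[OF this, of "(e - e1) ^ n / fact n"]
      show "(\<lambda>m. c n m * (e - e1) ^ n * (t - t1) ^ m) sums (a n t / fact n * (e - e1) ^ n)"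
        by (simp add: c_def algebra_simps)
    qed
    have "((\<lambda>n. a n t / fact n * (e - e1) ^ n) has_sum v e t) UNIV"
    proof (rule norm_summable_imp_has_sum)
      have a_term_le: "norm (norm (a n t / fact n * (e - e1) ^ n)) \<le> B * q ^ n" for n
      proof -
        have "norm (a n t) / fact n \<le> fact n * B / r ^ n / fact n"
          using a_le[of t n] t by (intro divide_right_mono) auto
        then have "norm (a n t) / fact n * norm (e - e1) ^ n \<le> B / r ^ n * norm (e - e1) ^ n"
          by (intro mult_right_mono) auto
        then show ?thesis by (simp add: norm_mult norm_divide norm_power q_def power_divide)
      qed
      have "summable (\<lambda>n. B * q ^ n)"
        using q by (simp add: summable_geometric)
      then show "summable (\<lambda>n. norm (a n t / fact n * (e - e1) ^ n))"
        by (rule summable_comparison_test'[of _ 0]) (rule a_term_le)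
      show "(\<lambda>n. a n t / fact n * (e - e1) ^ n) sums v e t"
        unfolding a_def
      proof (rule holomorphic_power_series[OF _ e])
        show "(\<lambda>e. v e t) holomorphic_on ball e1 r"
          using hole[OF \<open>t \<in> V\<close>] r ball_subset_cball[of e1 r] by (meson holomorphic_on_subset subset_trans)
      qed
    qed
    from has_sum_SigmaI[OF _ this total] sums_t show ?thesis by simp
  qed
  show ?thesis by (rule that[OF r(1) main])
qed

theorem sep_holomorphic_imp_real_analytic:
  assumes v: "sep_holomorphic U V v" and "open U" "open V"
    and S: "\<And>e t. (e, t) \<in> S \<Longrightarrow> of_real e \<in> U \<and> of_real t \<in> V"
  shows "real_analytic_on (\<lambda>(e, t). Re (v (of_real e) (of_real t))) S"
  unfolding real_analytic_on_def
proof
  fix x :: "real \<times> real" assume "x \<in> S"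
  obtain e1 t1 where x: "x = (e1, t1)" by (rule prod.exhaust)
  have "complex_of_real e1 \<in> U" "complex_of_real t1 \<in> V" using S \<open>x \<in> S\<close> by (auto simp: x)
  from sep_holomorphic_double_power_series[OF assms(1-3) this]
  obtain r c where "r > 0" and sum: "\<And>e t. e \<in> ball (complex_of_real e1) r \<Longrightarrow> t \<in> ball (complex_of_real t1) r \<Longrightarrow>
    ((\<lambda>(n, m). c n m * (e - complex_of_real e1) ^ n * (t - complex_of_real t1) ^ m) has_sum v e t) (UNIV \<times> UNIV)"
    by blast
  \<comment> \<open>multi-indices over the basis of the plane correspond to pairs of exponents\<close>
  define \<phi> where "\<phi> = (\<lambda>(n::nat, m::nat). \<lambda>b\<in>(Basis::(real \<times> real) set). if b = (1, 0) then n else m)"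
  have Basis2: "(Basis :: (real \<times> real) set) = {(1,0), (0,1)}"
    by (auto simp: Basis_prod_def)
  have bij: "bij_betw \<phi> (UNIV \<times> UNIV) (Basis \<rightarrow>\<^sub>E UNIV)"
  proof (rule bij_betw_byWitness[where f' = "\<lambda>\<mu>. (\<mu> (1,0), \<mu> (0,1))"])
    show "\<forall>\<mu>\<in>Basis \<rightarrow>\<^sub>E UNIV. \<phi> (\<mu> (1, 0), \<mu> (0, 1)) = \<mu>"
    proof
      fix \<mu> :: "real \<times> real \<Rightarrow> nat" assume \<mu>: "\<mu> \<in> Basis \<rightarrow>\<^sub>E UNIV"
      show "\<phi> (\<mu> (1, 0), \<mu> (0, 1)) = \<mu>"
      proof
        fix b show "\<phi> (\<mu> (1, 0), \<mu> (0, 1)) b = \<mu> b"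
        proof (cases "b \<in> Basis")
          case True
          then show ?thesis by (auto simp: \<phi>_def Basis2)
        next
          case False
          then show ?thesis using PiE_arb[OF \<mu> False] by (simp add: \<phi>_def)
        qed
      qed
    qed
    show "\<forall>p\<in>UNIV \<times> UNIV. (\<phi> p (1, 0), \<phi> p (0, 1)) = p"
      by (simp add: \<phi>_def Basis2)
    show "\<phi> ` (UNIV \<times> UNIV) \<subseteq> Basis \<rightarrow>\<^sub>E UNIV"
    proof
      fix \<mu> assume "\<mu> \<in> \<phi> ` (UNIV \<times> UNIV)"
      then obtain n m where "\<mu> = \<phi> (n, m)" by (elim imageE) (metis surj_pair)
      then show "\<mu> \<in> Basis \<rightarrow>\<^sub>E UNIV" by (simp add: \<phi>_def)
    qed
  qed simp
  show "\<exists>r>0. \<exists>c::((real \<times> real) \<Rightarrow> nat) \<Rightarrow> real. \<forall>y\<in>ball x r.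
      ((\<lambda>m. c m * (\<Prod>b\<in>Basis. ((y - x) \<bullet> b) ^ m b)) has_sum
        (case y of (e, t) \<Rightarrow> Re (v (complex_of_real e) (complex_of_real t)))) (Basis \<rightarrow>\<^sub>E UNIV)"
  proof (intro exI[of _ r] exI[of _ "\<lambda>\<mu>. Re (c (\<mu> (1,0)) (\<mu> (0,1)))"] conjI \<open>r > 0\<close> ballI)
    fix y assume y: "y \<in> ball x r"
    obtain e t where et: "y = (e, t)" by (rule prod.exhaust)
    have "dist e1 e < r" "dist t1 t < r"
      using y dist_fst_le[of x y] dist_snd_le[of x y] by (auto simp: x et)
    then have "((\<lambda>(n, m). c n m * (complex_of_real e - complex_of_real e1) ^ n * (complex_of_real t - complex_of_real t1) ^ m)
        has_sum v (complex_of_real e) (complex_of_real t)) (UNIV \<times> UNIV)"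
      by (intro sum) (auto simp: dist_of_real)
    from has_sum_Re[OF this]
    have "((\<lambda>(n, m). Re (c n m) * ((e - e1) ^ n * (t - t1) ^ m)) has_sum Re (v (complex_of_real e) (complex_of_real t))) (UNIV \<times> UNIV)"
      by (simp add: case_prod_unfold mult.assoc flip: of_real_diff of_real_power of_real_mult)
    also have "(\<lambda>(n, m). Re (c n m) * ((e - e1) ^ n * (t - t1) ^ m)) =
        (\<lambda>p. (\<lambda>\<mu>. Re (c (\<mu> (1,0)) (\<mu> (0,1))) * (\<Prod>b\<in>Basis. ((y - x) \<bullet> b) ^ \<mu> b)) (\<phi> p))"
    proof
      fix p :: "nat \<times> nat"
      obtain n m where "p = (n, m)" by (rule prod.exhaust)
      then show "(case p of (n, m) \<Rightarrow> Re (c n m) * ((e - e1) ^ n * (t - t1) ^ m)) =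
          (\<lambda>\<mu>. Re (c (\<mu> (1,0)) (\<mu> (0,1))) * (\<Prod>b\<in>Basis. ((y - x) \<bullet> b) ^ \<mu> b)) (\<phi> p)"
        by (simp add: \<phi>_def Basis2 x et)
    qed
    finally show "((\<lambda>\<mu>. Re (c (\<mu> (1,0)) (\<mu> (0,1))) * (\<Prod>b\<in>Basis. ((y - x) \<bullet> b) ^ \<mu> b)) has_sum
        (case y of (e, t) \<Rightarrow> Re (v (complex_of_real e) (complex_of_real t)))) (Basis \<rightarrow>\<^sub>E UNIV)"
      unfolding et prod.case by (rule has_sum_reindex_bij_betw[OF bij, THEN iffD1])
  qed
qed

section \<open>Fixed points of contractions in a class closed under uniform limits\<close>

text \<open>Banach iteration in a ball around \<open>u\<^sub>0\<close>, in the sup norm on \<open>X\<close>. The class \<open>Q\<close> is arbitrary up to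
closedness, so qualitative properties such as holomorphy in a parameter pass to the fixed point
although the contraction estimate concerns each value of the parameter separately.\<close>

lemma contraction_fixpoint_in_closed_class:
  fixes \<Phi> :: "('x \<Rightarrow> complex) \<Rightarrow> 'x \<Rightarrow> complex"
  assumes Q_closed: "\<And>w u. (\<And>n. Q (w n)) \<Longrightarrow> uniform_limit X w u sequentially \<Longrightarrow> Q u"
    and maps: "\<And>u. Q u \<Longrightarrow> (\<And>x. x \<in> X \<Longrightarrow> norm (u x - u\<^sub>0 x) \<le> R) \<Longrightarrow> Q (\<Phi> u)"
    and contr: "\<And>u w d x. Q u \<Longrightarrow> Q w \<Longrightarrow> (\<And>x. x \<in> X \<Longrightarrow> norm (u x - u\<^sub>0 x) \<le> R) \<Longrightarrow>
        (\<And>x. x \<in> X \<Longrightarrow> norm (w x - u\<^sub>0 x) \<le> R) \<Longrightarrow> (\<And>x. x \<in> X \<Longrightarrow> norm (u x - w x) \<le> d) \<Longrightarrow>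
        x \<in> X \<Longrightarrow> norm (\<Phi> u x - \<Phi> w x) \<le> d / 2"
    and start: "Q u\<^sub>0" "\<And>x. x \<in> X \<Longrightarrow> norm (\<Phi> u\<^sub>0 x - u\<^sub>0 x) \<le> R / 2" and "R > 0"
  obtains u where "Q u" "\<And>x. x \<in> X \<Longrightarrow> norm (u x - u\<^sub>0 x) \<le> R" "\<And>x. x \<in> X \<Longrightarrow> \<Phi> u x = u x"
proof -
  define w where "w = (\<lambda>n. (\<Phi> ^^ n) u\<^sub>0)"
  have w0: "w 0 = u\<^sub>0" and wS: "w (Suc n) = \<Phi> (w n)" for n
    by (simp_all add: w_def)
  have inv: "Q (w n) \<and> (\<forall>x\<in>X. norm (w n x - u\<^sub>0 x) \<le> R)" for n
  proof (induction n)
    case (Suc n)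
    have "norm (w (Suc n) x - u\<^sub>0 x) \<le> R" if "x \<in> X" for x
    proof -
      have "norm (\<Phi> (w n) x - \<Phi> u\<^sub>0 x) \<le> R / 2"
        using Suc \<open>R > 0\<close> by (intro contr start that) auto
      then show ?thesis
        using start(2)[OF that] norm_triangle_ineq[of "\<Phi> (w n) x - \<Phi> u\<^sub>0 x" "\<Phi> u\<^sub>0 x - u\<^sub>0 x"] by (simp add: wS)
    qed
    then show ?case using Suc maps by (auto simp: wS)
  qed (use start \<open>R > 0\<close> in \<open>simp add: w0\<close>)
  have step: "norm (w (Suc n) x - w n x) \<le> R / 2 * (1 / 2) ^ n" if "x \<in> X" for n x
    using that
  proof (induction n arbitrary: x)
    case (Suc n)
    have "norm (\<Phi> (w (Suc n)) x - \<Phi> (w n) x) \<le> (R / 2 * (1 / 2) ^ n) / 2"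
      by (rule contr) (use inv Suc in auto)
    then show ?case by (simp add: wS)
  qed (use start in \<open>simp add: w0 wS\<close>)
  have "uniform_limit X (\<lambda>n x. \<Sum>i<n. w (Suc i) x - w i x) (\<lambda>x. \<Sum>i. w (Suc i) x - w i x) sequentially"
    by (rule Weierstrass_m_test[OF step]) (auto intro!: summable_mult summable_geometric)
  then have "uniform_limit X (\<lambda>n x. (\<Sum>i<n. w (Suc i) x - w i x) + w 0 x)
      (\<lambda>x. (\<Sum>i. w (Suc i) x - w i x) + w 0 x) sequentially"
    by (intro uniform_limit_intros)
  moreover have "(\<Sum>i<n. w (Suc i) x - w i x) + w 0 x = w n x" for n x
    using sum_lessThan_telescope[of "\<lambda>i. w i x" n] by simp
  ultimately obtain u where lim: "uniform_limit X w u sequentially"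
    by auto
  have Qu: "Q u" using Q_closed[OF _ lim] inv by blast
  have lim_x: "(\<lambda>n. w n x) \<longlonglongrightarrow> u x" if "x \<in> X" for x
    by (rule tendsto_uniform_limitI[OF lim that])
  have uR: "norm (u x - u\<^sub>0 x) \<le> R" if "x \<in> X" for x
  proof (rule Lim_norm_ubound[OF _ tendsto_diff[OF lim_x[OF that] tendsto_const]])
    show "eventually (\<lambda>n. norm (w n x - u\<^sub>0 x) \<le> R) sequentially"
      using inv that by (intro always_eventually) auto
  qed simp
  have fixed: "\<Phi> u x = u x" if x: "x \<in> X" for x
  proof -
    have "(\<lambda>n. w (Suc n) x) \<longlonglongrightarrow> \<Phi> u x"
    proof (rule tendstoI)
      fix \<epsilon> :: real assume "\<epsilon> > 0"
      have "eventually (\<lambda>n. \<forall>x\<in>X. dist (w n x) (u x) < \<epsilon>) sequentially"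
        using lim \<open>\<epsilon> > 0\<close> by (simp add: uniform_limit_iff)
      then show "eventually (\<lambda>n. dist (w (Suc n) x) (\<Phi> u x) < \<epsilon>) sequentially"
      proof eventually_elim
        case (elim n)
        have "norm (\<Phi> (w n) x - \<Phi> u x) \<le> \<epsilon> / 2"
          by (rule contr[OF _ Qu _ uR _ x]) (use inv elim in \<open>auto simp: dist_norm intro: less_imp_le\<close>)
        then show ?case using \<open>\<epsilon> > 0\<close> by (simp add: wS dist_norm)
      qed
    qed
    moreover have "(\<lambda>n. w (Suc n) x) \<longlonglongrightarrow> u x"
      using lim_x[OF x] by (rule LIMSEQ_Suc)
    ultimately show ?thesis by (rule LIMSEQ_unique)
  qed
  show ?thesis by (rule that[OF Qu uR fixed])
qed

section \<open>Holomorphic families of periodic functions\<close>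

definition periodic_family :: "real \<Rightarrow> complex set \<Rightarrow> real \<Rightarrow> (complex \<Rightarrow> complex \<Rightarrow> complex) \<Rightarrow> bool"
  where "periodic_family T U \<sigma> v \<longleftrightarrow> sep_holomorphic U (strip \<sigma>) v \<and>
    (\<forall>e\<in>U. \<forall>t\<in>strip \<sigma>. v e (t + complex_of_real T) = v e t) \<and>
    (\<forall>e t. complex_of_real e \<in> U \<longrightarrow> v (complex_of_real e) (complex_of_real t) \<in> \<real>)"

lemma periodic_familyD:
  assumes "periodic_family T U \<sigma> v"
  shows "sep_holomorphic U (strip \<sigma>) v"
    and "e \<in> U \<Longrightarrow> t \<in> strip \<sigma> \<Longrightarrow> v e (t + complex_of_real T) = v e t"
    and "complex_of_real e' \<in> U \<Longrightarrow> v (complex_of_real e') (complex_of_real t') \<in> \<real>"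
    and "e \<in> U \<Longrightarrow> v e holomorphic_on strip \<sigma>"
    and "t \<in> strip \<sigma> \<Longrightarrow> (\<lambda>e. v e t) holomorphic_on U"
  using assms sep_holomorphicD by (auto simp: periodic_family_def)

lemma sep_holomorphic_fst:
  assumes "f holomorphic_on U"
  shows "sep_holomorphic U V (\<lambda>e t. f e)"
  unfolding sep_holomorphic_def case_prod_unfold
  using assms by (auto intro!: continuous_on_compose2[OF holomorphic_on_imp_continuous_on[OF assms]] continuous_intros)

lemma sep_holomorphic_snd:
  assumes "f holomorphic_on V"
  shows "sep_holomorphic U V (\<lambda>e t. f t)"
  unfolding sep_holomorphic_def case_prod_unfold
  using assms by (auto intro!: continuous_on_compose2[OF holomorphic_on_imp_continuous_on[OF assms]] continuous_intros)

lemma sep_holomorphic_add: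
  assumes "sep_holomorphic U V v" "sep_holomorphic U V w"
  shows "sep_holomorphic U V (\<lambda>e t. v e t + w e t)"
  using assms unfolding sep_holomorphic_def case_prod_unfold
  by (auto intro!: holomorphic_intros continuous_intros)

lemma sep_holomorphic_mult:
  assumes "sep_holomorphic U V v" "sep_holomorphic U V w"
  shows "sep_holomorphic U V (\<lambda>e t. v e t * w e t)"
  using assms unfolding sep_holomorphic_def case_prod_unfold
  by (auto intro!: holomorphic_intros continuous_intros)

lemma periodic_family_const: "periodic_family T U \<sigma> (\<lambda>e t. complex_of_real c)"
  unfolding periodic_family_def by (auto intro!: sep_holomorphic_fst)

lemma periodic_family_parameter: "periodic_family T U \<sigma> (\<lambda>e t. e)"
  unfolding periodic_family_def by (auto intro!: sep_holomorphic_fst holomorphic_intros)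

lemma periodic_family_add:
  assumes "periodic_family T U \<sigma> v" "periodic_family T U \<sigma> w"
  shows "periodic_family T U \<sigma> (\<lambda>e t. v e t + w e t)"
  using assms unfolding periodic_family_def by (auto intro!: sep_holomorphic_add Reals_add)

lemma periodic_family_mult:
  assumes "periodic_family T U \<sigma> v" "periodic_family T U \<sigma> w"
  shows "periodic_family T U \<sigma> (\<lambda>e t. v e t * w e t)"
  using assms unfolding periodic_family_def by (auto intro!: sep_holomorphic_mult Reals_mult)

lemma periodic_family_diff:
  assumes "periodic_family T U \<sigma> v" "periodic_family T U \<sigma> w"
  shows "periodic_family T U \<sigma> (\<lambda>e t. v e t - w e t)"
  using periodic_family_add[OF assms(1) periodic_family_mult[OF periodic_family_const[of _ _ _ "-1"] assms(2)]]
  by simp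

lemma periodic_family_divide_const:
  assumes "periodic_family T U \<sigma> v"
  shows "periodic_family T U \<sigma> (\<lambda>e t. v e t / complex_of_real c)"
  using periodic_family_mult[OF assms periodic_family_const[of _ _ _ "inverse c"]]
  by (simp add: divide_inverse)

lemma periodic_family_mean:
  assumes "periodic_family T U \<sigma> v" "open U" "convex U" "\<sigma> > 0"
  shows "periodic_family T U \<sigma> (\<lambda>e t. mean T (v e))"
  unfolding periodic_family_def
  using periodic_familyD[OF assms(1)] assms(2-4)
  by (auto intro!: sep_holomorphic_fst sep_holomorphic_mean mean_Reals)

lemma periodic_family_zero_mean_primitive:
  assumes v: "periodic_family T U \<sigma> v" and U: "open U" "convex U" and "\<sigma> > 0" "T > 0"
    and bd: "\<And>e t. e \<in> U \<Longrightarrow> t \<in> strip \<sigma> \<Longrightarrow> norm (v e t) \<le> B"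
  shows "periodic_family T U \<sigma> (\<lambda>e. zero_mean_primitive T (v e))"
  unfolding periodic_family_def
proof (intro conjI ballI allI impI)
  note D = periodic_familyD[OF v]
  show "sep_holomorphic U (strip \<sigma>) (\<lambda>e. zero_mean_primitive T (v e))"
    by (rule sep_holomorphic_zero_mean_primitive[OF D(1) U assms(4,5) D(2) bd])
  show "zero_mean_primitive T (v e) (t + complex_of_real T) = zero_mean_primitive T (v e) t"
    if "e \<in> U" "t \<in> strip \<sigma>" for e t
    by (rule zero_mean_primitive_periodic[OF D(4)[OF that(1)] D(2)[OF that(1)] \<open>\<sigma> > 0\<close> that(2)])
  show "zero_mean_primitive T (v (complex_of_real e)) (complex_of_real t) \<in> \<real>"
    if "complex_of_real e \<in> U" for e t
    by (rule zero_mean_primitive_Reals[OF D(4)[OF that] \<open>\<sigma> > 0\<close> D(3)[OF that]])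
qed

lemma holomorphic_on_uniform_limit:
  assumes "open S" "\<And>n. w n holomorphic_on S" "uniform_limit S w u sequentially"
  shows "u holomorphic_on S"
proof (rule holomorphic_uniform_sequence[OF assms(1,2)])
  fix x assume "x \<in> S"
  then obtain d where "d > 0" "cball x d \<subseteq> S"
    using \<open>open S\<close> open_contains_cball by blast
  then show "\<exists>d>0. cball x d \<subseteq> S \<and> uniform_limit (cball x d) w u sequentially"
    using uniform_limit_on_subset[OF assms(3)] by blast
qed

lemma periodic_family_uniform_limit:
  assumes w: "\<And>n. periodic_family T U \<sigma> (w n)" and "open U" "\<sigma> > 0"
    and lim: "uniform_limit (U \<times> strip \<sigma>) (\<lambda>n (e, t). w n e t) (\<lambda>(e, t). v e t) sequentially"
  shows "periodic_family T U \<sigma> v"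
  unfolding periodic_family_def sep_holomorphic_def
proof (intro conjI ballI allI impI)
  note D = periodic_familyD[OF w]
  have pt: "(\<lambda>n. w n e t) \<longlonglongrightarrow> v e t" if "e \<in> U" "t \<in> strip \<sigma>" for e t
    using tendsto_uniform_limitI[OF lim, of "(e, t)"] that by simp
  show "(\<lambda>e. v e t) holomorphic_on U" if "t \<in> strip \<sigma>" for t
  proof (rule holomorphic_on_uniform_limit[OF \<open>open U\<close> D(5)[OF that]])
    show "uniform_limit U (\<lambda>n e. w n e t) (\<lambda>e. v e t) sequentially"
      unfolding uniform_limit_iff
    proof (intro allI impI)
      fix \<epsilon> :: real assume "\<epsilon> > 0"
      then show "\<forall>\<^sub>F n in sequentially. \<forall>e\<in>U. dist (w n e t) (v e t) < \<epsilon>"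
        by (rule eventually_mono[OF lim[unfolded uniform_limit_iff, rule_format]]) (use that in auto)
    qed
  qed
  show "v e holomorphic_on strip \<sigma>" if "e \<in> U" for e
  proof (rule holomorphic_on_uniform_limit[OF open_strip D(4)[OF that]])
    show "uniform_limit (strip \<sigma>) (\<lambda>n. w n e) (v e) sequentially"
      unfolding uniform_limit_iff
    proof (intro allI impI)
      fix \<epsilon> :: real assume "\<epsilon> > 0"
      then show "\<forall>\<^sub>F n in sequentially. \<forall>t\<in>strip \<sigma>. dist (w n e t) (v e t) < \<epsilon>"
        by (rule eventually_mono[OF lim[unfolded uniform_limit_iff, rule_format]]) (use that in auto)
    qed
  qed
  show "continuous_on (U \<times> strip \<sigma>) (\<lambda>(e, t). v e t)"
    by (rule uniform_limit_theorem[OF _ lim]) (use sep_holomorphicD(3)[OF D(1)] in auto)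
  show "v e (t + complex_of_real T) = v e t" if "e \<in> U" "t \<in> strip \<sigma>" for e t
  proof -
    have "(\<lambda>n. w n e (t + complex_of_real T)) \<longlonglongrightarrow> v e (t + complex_of_real T)"
      using that by (intro pt) (simp_all add: add_of_real_in_strip)
    then show ?thesis
      unfolding D(2)[OF that] using pt[OF that] by (rule LIMSEQ_unique)
  qed
  show "v (complex_of_real e) (complex_of_real t) \<in> \<real>" if "complex_of_real e \<in> U" for e t
    by (rule Lim_in_closed_set[OF closed_complex_Reals _ _ pt[OF that of_real_in_strip[OF \<open>\<sigma> > 0\<close>]]])
       (use D(3)[OF that] in auto)
qed

section \<open>The contraction near a resonant torus\<close>

lemma complex_extension_periodic:
  assumes E: "complex_extension H A\<^sub>0 C\<^sub>1 \<delta> B E" and near: "near_torus A\<^sub>0 C\<^sub>1 \<delta> x A c t"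
  shows "E (x + of_int n * (2 * of_real pi)) A c (t + of_int m * (2 * of_real pi)) = E x A c t"
proof -
  define E' where "E' = (\<lambda>x t. if near_torus A\<^sub>0 C\<^sub>1 \<delta> x A c t then E x A c t else 0)"
  have near': "near_torus A\<^sub>0 C\<^sub>1 \<delta> (x + of_int n * (2 * of_real pi)) A c (t + of_int m * (2 * of_real pi))" for n m
    using near by (simp add: near_torus_def)
  have "E' (x + of_int n * (2 * of_real pi)) (t + of_int m * (2 * of_real pi)) = E' (x + of_int n * (2 * of_real pi)) t"
    by (rule periodic_of_int_mult[where h = "\<lambda>t. E' _ t"])
       (use complex_extensionD(4)[OF E] in \<open>auto simp: E'_def near_torus_def\<close>)
  also have "\<dots> = E' x t"
    by (rule periodic_of_int_mult[where h = "\<lambda>x. E' x t"])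
       (use complex_extensionD(3)[OF E] in \<open>auto simp: E'_def near_torus_def\<close>)
  finally show ?thesis
    using near'[of n m] near by (simp add: E'_def)
qed

text \<open>Bookkeeping for the map defined below. Here \<open>L\<close> is a Lipschitz constant of the extended vector
field, \<open>Z\<close> bounds the operator taking zero-mean primitives, and \<open>\<rho>\<close> is a Lipschitz constant of the
nonlinear part of \<open>\<omega>\<close>. Then \<open>a\<close> and \<open>b\<close> are Lipschitz constants of the new action and of the new
angle, \<open>y\<close> and \<open>x\<close> bound their values at the starting point, and \<open>c\<close> bounds the distance of the
parameter from its reference value. The inequalities say that the map contracts by \<open>1/2\<close> and moves
the centre of the ball of radius \<open>R\<close> by at most \<open>R/2\<close>.\<close>

definition contraction_bounds :: "real \<Rightarrow> real \<Rightarrow> real \<Rightarrow> real \<Rightarrow> real \<Rightarrow> real \<Rightarrow> real \<Rightarrow> real \<Rightarrow>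
    real \<Rightarrow> real \<Rightarrow> real \<Rightarrow> real \<Rightarrow> real \<Rightarrow> bool"
  where "contraction_bounds L Z B \<omega>\<^sub>1 \<mu> \<rho> R \<epsilon>\<^sub>0 c a b y x \<longleftrightarrow>
    a = \<epsilon>\<^sub>0 * Z * (3 * L) + (\<rho> + \<epsilon>\<^sub>0 * (3 * L)) / \<bar>\<omega>\<^sub>1\<bar> \<and>
    b = Z * (\<rho> + \<epsilon>\<^sub>0 * (3 * L) + \<bar>\<omega>\<^sub>1\<bar> * a) \<and>
    y = \<epsilon>\<^sub>0 * Z * B + \<epsilon>\<^sub>0 * B / \<bar>\<omega>\<^sub>1\<bar> \<and> x = Z * (\<epsilon>\<^sub>0 * B + \<bar>\<omega>\<^sub>1\<bar> * y) \<and>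
    a \<le> 1 / 2 \<and> b \<le> 1 / 2 \<and> L * (a + b) \<le> \<bar>\<mu>\<bar> / 4 \<and> y \<le> R / 2 \<and> x \<le> R / 2 \<and>
    L * (x + y + c) \<le> \<bar>\<mu>\<bar> * (R / 2)"

text \<open>The frequency near \<open>A\<^sub>0\<close> is \<open>\<Omega> + \<omega>\<^sub>1 y + r y\<close> at action \<open>A\<^sub>0 + y\<close>. The functions \<open>EF\<close> and \<open>EG\<close> extend
the perturbation near parameter value \<open>C\<^sub>1\<close>, while \<open>C\<close> is the parameter value under
consideration. At \<open>C\<^sub>1\<close> the mean of \<open>G\<close> along the unperturbed solution of phase \<open>k\<close> has a zero at
\<open>k\<^sub>0\<close> with derivative \<open>\<mu>\<close> there. The width \<open>\<sigma>\<close> of the time strip keeps the imaginary part of \<open>\<Omega> t\<close> below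
an eighth of the width \<open>\<delta>\<close>, which leaves room for corrections of size \<open>R\<close>.\<close>

locale resonant_torus =
  fixes F G :: "real \<Rightarrow> real \<Rightarrow> real \<Rightarrow> real \<Rightarrow> real"
    and A\<^sub>0 C\<^sub>1 \<delta> B \<Omega> \<omega>\<^sub>1 \<sigma> :: real and p q :: int
    and EF EG :: "complex \<Rightarrow> complex \<Rightarrow> complex \<Rightarrow> complex \<Rightarrow> complex"
    and r :: "complex \<Rightarrow> complex" and k\<^sub>0 \<mu> R \<rho> \<epsilon>\<^sub>0 C a b y\<^sub>0 x\<^sub>0 :: real
  assumes EF: "complex_extension F A\<^sub>0 C\<^sub>1 \<delta> B EF" and EG: "complex_extension G A\<^sub>0 C\<^sub>1 \<delta> B EG"
    and B: "B \<ge> 0" and \<sigma>: "\<sigma> > 0" "8 * (\<bar>\<Omega>\<bar> + 1) * \<sigma> \<le> \<delta>"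
    and resonance: "\<Omega> = of_int p / of_int q" "q \<ge> 1"
    and nz: "\<omega>\<^sub>1 \<noteq> 0" "\<mu> \<noteq> 0"
    and R: "R > 0" "32 * R \<le> \<delta>"
    and r_hol: "r holomorphic_on ball 0 (2 * R)" and r_0: "r 0 = 0"
    and r_real: "\<And>y. \<bar>y\<bar> \<le> R \<Longrightarrow> r (complex_of_real y) \<in> \<real>"
    and r_lip: "\<And>y y'. norm y \<le> R \<Longrightarrow> norm y' \<le> R \<Longrightarrow> norm (r y - r y') \<le> \<rho> * norm (y - y')"
    and \<rho>: "\<rho> \<ge> 0"
    and melnikov_0: "mean (2 * pi * of_int q) (\<lambda>t. EG (of_real \<Omega> * t + of_real k\<^sub>0) (of_real A\<^sub>0) (of_real C\<^sub>1) t) = 0"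
    and melnikov_approx: "\<And>s. norm s \<le> 2 * R \<Longrightarrow>
      norm (mean (2 * pi * of_int q) (\<lambda>t. EG (of_real \<Omega> * t + of_real k\<^sub>0 + s) (of_real A\<^sub>0) (of_real C\<^sub>1) t)
        - of_real \<mu> * s) \<le> \<bar>\<mu>\<bar> / 8 * norm s"
    and R_small: "64 * B / \<delta>\<^sup>2 * (4 * R) \<le> \<bar>\<mu>\<bar> / 8"
    and \<epsilon>\<^sub>0: "\<epsilon>\<^sub>0 > 0" and C_near: "\<bar>C - C\<^sub>1\<bar> \<le> R"
    and bounds: "contraction_bounds (4 * B / \<delta>) (4 * (2 * pi * of_int q + \<sigma>)) B \<omega>\<^sub>1 \<mu> \<rho> R
      \<epsilon>\<^sub>0 \<bar>C - C\<^sub>1\<bar> a b y\<^sub>0 x\<^sub>0"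
begin

definition T :: real where "T = 2 * pi * of_int q"
definition L :: real where "L = 4 * B / \<delta>"
definition Z :: real where "Z = 4 * (T + \<sigma>)"

text \<open>A state \<open>(k, Y, X)\<close> stands for the motion \<open>\<alpha> = \<Omega> t + k + X\<close>, \<open>A = A\<^sub>0 + Y\<close>. The phase \<open>k\<close> is
a function of time only formally, so that the three unknowns are treated alike; it is constant
throughout the iteration.\<close>

definition along :: "(complex \<Rightarrow> complex \<Rightarrow> complex \<Rightarrow> complex \<Rightarrow> complex) \<Rightarrow>
    (complex \<Rightarrow> complex) \<Rightarrow> (complex \<Rightarrow> complex) \<Rightarrow> (complex \<Rightarrow> complex) \<Rightarrow> complex \<Rightarrow> complex"
  where "along E k Y X t = E (of_real \<Omega> * t + k t + X t) (of_real A\<^sub>0 + Y t) (of_real C) t"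

text \<open>Everything in the equation for \<open>X'\<close> except \<open>\<omega>\<^sub>1 Y\<close>; its Lipschitz constant is small.\<close>

definition forcing :: "complex \<Rightarrow> (complex \<Rightarrow> complex) \<Rightarrow> (complex \<Rightarrow> complex) \<Rightarrow> (complex \<Rightarrow> complex) \<Rightarrow> complex \<Rightarrow> complex"
  where "forcing e k Y X t = r (Y t) + e * along EF k Y X t"

text \<open>The oscillating part integrates \<open>A' = e G\<close> after removing the mean of \<open>G\<close>. The mean of the new
action is the one that makes \<open>forcing + \<omega>\<^sub>1 Y\<close> integrable to a periodic angle.\<close>

definition next_Y :: "complex \<Rightarrow> (complex \<Rightarrow> complex) \<Rightarrow> (complex \<Rightarrow> complex) \<Rightarrow> (complex \<Rightarrow> complex) \<Rightarrow> complex \<Rightarrow> complex"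
  where "next_Y e k Y X t =
    e * zero_mean_primitive T (along EG k Y X) t - mean T (forcing e k Y X) / of_real \<omega>\<^sub>1"

definition drive :: "complex \<Rightarrow> (complex \<Rightarrow> complex) \<Rightarrow> (complex \<Rightarrow> complex) \<Rightarrow> (complex \<Rightarrow> complex) \<Rightarrow> complex \<Rightarrow> complex"
  where "drive e k Y X t = forcing e k Y X t + of_real \<omega>\<^sub>1 * next_Y e k Y X t"

text \<open>The angle is computed from the new action, not from the old one. Since the new action depends on
the old state only through small terms, so does the new angle.\<close>

definition next_X :: "complex \<Rightarrow> (complex \<Rightarrow> complex) \<Rightarrow> (complex \<Rightarrow> complex) \<Rightarrow> (complex \<Rightarrow> complex) \<Rightarrow> complex \<Rightarrow> complex"
  where "next_X e k Y X =
    zero_mean_primitive T (drive e k Y X)"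

text \<open>A Newton step, with the derivative frozen at \<open>\<mu>\<close>, towards a zero of the mean of \<open>G\<close>; again the
updated action and angle are used.\<close>

definition next_k :: "complex \<Rightarrow> (complex \<Rightarrow> complex) \<Rightarrow> (complex \<Rightarrow> complex) \<Rightarrow> (complex \<Rightarrow> complex) \<Rightarrow> complex \<Rightarrow> complex"
  where "next_k e k Y X t =
    k t - mean T (along EG k (next_Y e k Y X) (next_X e k Y X)) / of_real \<mu>"

lemma \<delta>_pos: "\<delta> > 0"
  using R by simp

lemma T_pos: "T > 0"
  using resonance by (simp add: T_def)

lemma L_nonneg: "L \<ge> 0"
  using B \<delta>_pos by (simp add: L_def)

lemma contraction_bounds: "contraction_bounds L Z B \<omega>\<^sub>1 \<mu> \<rho> R \<epsilon>\<^sub>0 \<bar>C - C\<^sub>1\<bar> a b y\<^sub>0 x\<^sub>0"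
  using bounds by (simp only: Z_def L_def T_def)

lemma a_eq: "a = \<epsilon>\<^sub>0 * Z * (3 * L) + (\<rho> + \<epsilon>\<^sub>0 * (3 * L)) / \<bar>\<omega>\<^sub>1\<bar>"
  and b_eq: "b = Z * (\<rho> + \<epsilon>\<^sub>0 * (3 * L) + \<bar>\<omega>\<^sub>1\<bar> * a)"
  and y_eq: "y\<^sub>0 = \<epsilon>\<^sub>0 * Z * B + \<epsilon>\<^sub>0 * B / \<bar>\<omega>\<^sub>1\<bar>"
  and x_eq: "x\<^sub>0 = Z * (\<epsilon>\<^sub>0 * B + \<bar>\<omega>\<^sub>1\<bar> * y\<^sub>0)"
  and ab_le: "a \<le> 1 / 2" "b \<le> 1 / 2" "L * (a + b) \<le> \<bar>\<mu>\<bar> / 4"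
  and start_le: "y\<^sub>0 \<le> R / 2" "x\<^sub>0 \<le> R / 2" "L * (x\<^sub>0 + y\<^sub>0 + \<bar>C - C\<^sub>1\<bar>) \<le> \<bar>\<mu>\<bar> * (R / 2)"
  using contraction_bounds unfolding contraction_bounds_def by blast+

definition admissible :: "(complex \<Rightarrow> complex) \<Rightarrow> complex \<Rightarrow> bool"
  where "admissible v c \<longleftrightarrow> v holomorphic_on strip \<sigma> \<and>
    (\<forall>t\<in>strip \<sigma>. v (t + of_real T) = v t \<and> norm (v t - c) \<le> R)"

definition state :: "(complex \<Rightarrow> complex) \<Rightarrow> (complex \<Rightarrow> complex) \<Rightarrow> (complex \<Rightarrow> complex) \<Rightarrow> bool"
  where "state k Y X \<longleftrightarrow> admissible k (of_real k\<^sub>0) \<and> admissible Y 0 \<and> admissible X 0"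

text \<open>A quarter of the width is the room that the second difference estimate requires.\<close>

lemma near_quarter:
  assumes "t \<in> strip \<sigma>" "norm (k - of_real k\<^sub>0) \<le> R" "norm Y \<le> R" "norm X \<le> R"
  shows "near_torus A\<^sub>0 C\<^sub>1 (\<delta> / 4) (of_real \<Omega> * t + k + X) (of_real A\<^sub>0 + Y) (of_real C) t"
proof -
  have "\<bar>\<Omega>\<bar> * \<bar>Im t\<bar> \<le> \<bar>\<Omega>\<bar> * \<sigma>"
    using assms(1) by (intro mult_left_mono) (auto simp: strip_def)
  moreover have "8 * (\<bar>\<Omega>\<bar> * \<sigma>) + 8 * \<sigma> \<le> \<delta>" using \<sigma>(2) by (simp add: algebra_simps)
  moreover have "\<bar>Im t\<bar> < \<sigma>" using assms(1) by (simp add: strip_def)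
  moreover have "0 \<le> \<bar>\<Omega>\<bar> * \<sigma>" using \<sigma>(1) by simp
  moreover have "\<bar>Im (of_real \<Omega> * t)\<bar> = \<bar>\<Omega>\<bar> * \<bar>Im t\<bar>" by (simp add: abs_mult)
  ultimately have 1: "8 * \<bar>Im (of_real \<Omega> * t)\<bar> < \<delta>" and 2: "8 * \<bar>Im t\<bar> < \<delta>"
    using \<sigma>(1) by linarith+
  have "\<bar>Im k\<bar> \<le> R" "\<bar>Im X\<bar> \<le> R"
    using abs_Im_le_cmod[of "k - of_real k\<^sub>0"] abs_Im_le_cmod[of X] assms by auto
  then have "\<bar>Im (of_real \<Omega> * t + k + X)\<bar> < \<delta> / 4"
    using 1 R unfolding plus_complex.sel by linarith
  then show ?thesis
    using 2 R assms C_near by (auto simp: near_torus_def simp flip: of_real_diff)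
qed

lemma near_weaken: "near_torus A\<^sub>0 C\<^sub>1 (\<delta> / 4) x A c t \<Longrightarrow> \<delta> / 4 \<le> \<delta>' \<Longrightarrow> near_torus A\<^sub>0 C\<^sub>1 \<delta>' x A c t"
  by (auto simp: near_torus_def)

lemma state_near:
  assumes "state k Y X" "t \<in> strip \<sigma>"
  shows "near_torus A\<^sub>0 C\<^sub>1 (\<delta> / 4) (of_real \<Omega> * t + k t + X t) (of_real A\<^sub>0 + Y t) (of_real C) t"
  using assms by (intro near_quarter) (auto simp: state_def admissible_def)

lemma state_near_full:
  assumes "state k Y X" "t \<in> strip \<sigma>"
  shows "near_torus A\<^sub>0 C\<^sub>1 \<delta> (of_real \<Omega> * t + k t + X t) (of_real A\<^sub>0 + Y t) (of_real C) t"
  by (rule near_weaken[OF state_near[OF assms]]) (use \<delta>_pos in simp)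

lemma \<Omega>_period: "\<Omega> * T = of_int p * (2 * pi)" and T_period: "T = of_int q * (2 * pi)"
  using resonance by (auto simp: T_def)

lemma
  assumes E: "complex_extension H A\<^sub>0 C\<^sub>1 \<delta> B E" and s: "state k Y X"
  shows along_holomorphic: "along E k Y X holomorphic_on strip \<sigma>"
    and norm_along_le: "t \<in> strip \<sigma> \<Longrightarrow> norm (along E k Y X t) \<le> B"
    and along_periodic: "t \<in> strip \<sigma> \<Longrightarrow> along E k Y X (t + of_real T) = along E k Y X t"
proof -
  show "along E k Y X holomorphic_on strip \<sigma>"
    unfolding along_def
    by (rule complex_extensionD(1)[OF E open_strip])
       (use s in \<open>auto simp: state_def admissible_def intro!: holomorphic_intros state_near_full[OF s]\<close>)
  show "norm (along E k Y X t) \<le> B" if "t \<in> strip \<sigma>"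
    unfolding along_def by (rule complex_extensionD(2)[OF E state_near_full[OF s that]])
  show "along E k Y X (t + of_real T) = along E k Y X t" if t: "t \<in> strip \<sigma>"
  proof -
    have T': "complex_of_real T = of_int q * (2 * of_real pi)"
      by (simp add: T_period)
    have \<Omega>': "complex_of_real \<Omega> * of_real T = of_int p * (2 * of_real pi)"
      unfolding of_real_mult[symmetric] \<Omega>_period by simp
    note near = state_near_full[OF s t]
    have "along E k Y X (t + of_real T) =
        E (of_real \<Omega> * t + k t + X t + of_int p * (2 * of_real pi)) (of_real A\<^sub>0 + Y t) (of_real C) (t + of_int q * (2 * of_real pi))"
      using s t unfolding along_def state_def admissible_def T'[symmetric] \<Omega>'[symmetric]
      by (simp add: algebra_simps)
    also have "\<dots> = along E k Y X t"
      unfolding along_def by (rule complex_extension_periodic[OF E near])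
    finally show ?thesis .
  qed
qed

text \<open>The time and the parameter are the same in both states, so only the three unknowns contribute.\<close>

lemma along_lipschitz:
  assumes E: "complex_extension H A\<^sub>0 C\<^sub>1 \<delta> B E" and "state k Y X" "state k' Y' X'" "t \<in> strip \<sigma>"
  shows "norm (along E k Y X t - along E k' Y' X' t) \<le>
    L * (norm (k t - k' t) + norm (Y t - Y' t) + norm (X t - X' t))"
proof -
  have "norm (along E k Y X t - along E k' Y' X' t) \<le>
      L * (norm ((of_real \<Omega> * t + k t + X t) - (of_real \<Omega> * t + k' t + X' t)) +
        norm ((of_real A\<^sub>0 + Y t) - (of_real A\<^sub>0 + Y' t)) + norm (complex_of_real C - of_real C) + norm (t - t))"
    unfolding along_def L_def
    by (rule complex_extension_lipschitz[OF E \<delta>_pos near_weaken near_weaken])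
       (use state_near assms \<delta>_pos in auto)
  also have "\<dots> \<le> L * (norm (k t - k' t) + norm (Y t - Y' t) + norm (X t - X' t))"
    using norm_triangle_ineq[of "k t - k' t" "X t - X' t"] L_nonneg
    by (intro mult_left_mono) (auto simp: algebra_simps)
  finally show ?thesis .
qed

lemma forcing_holomorphic:
  assumes s: "state k Y X"
  shows "forcing e k Y X holomorphic_on strip \<sigma>"
proof -
  have "r \<circ> Y holomorphic_on strip \<sigma>"
    by (rule holomorphic_on_compose_gen[OF _ r_hol]) (use s R in \<open>force simp: state_def admissible_def\<close>)+
  then show ?thesis
    unfolding forcing_def by (intro holomorphic_intros along_holomorphic[OF EF s]) (simp add: o_def)
qed

lemma forcing_periodic:
  assumes "state k Y X" "t \<in> strip \<sigma>"
  shows "forcing e k Y X (t + of_real T) = forcing e k Y X t"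
  using assms along_periodic[OF EF assms] by (simp add: forcing_def state_def admissible_def)

lemma forcing_lipschitz:
  assumes "norm e \<le> \<epsilon>\<^sub>0" and s: "state k Y X" "state k' Y' X'" and t: "t \<in> strip \<sigma>"
    and d: "norm (k t - k' t) \<le> d" "norm (Y t - Y' t) \<le> d" "norm (X t - X' t) \<le> d"
  shows "norm (forcing e k Y X t - forcing e k' Y' X' t) \<le> (\<rho> + \<epsilon>\<^sub>0 * (3 * L)) * d"
proof -
  have "norm (forcing e k Y X t - forcing e k' Y' X' t) \<le>
      norm (r (Y t) - r (Y' t)) + norm (e * (along EF k Y X t - along EF k' Y' X' t))"
    unfolding forcing_def
    using norm_triangle_ineq[of "r (Y t) - r (Y' t)" "e * (along EF k Y X t - along EF k' Y' X' t)"]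
    by (simp add: algebra_simps)
  also have "norm (r (Y t) - r (Y' t)) \<le> \<rho> * norm (Y t - Y' t)"
    using s t by (intro r_lip) (auto simp: state_def admissible_def)
  also have "\<rho> * norm (Y t - Y' t) \<le> \<rho> * d"
    using d \<rho> by (intro mult_left_mono)
  also have "norm (e * (along EF k Y X t - along EF k' Y' X' t)) \<le> \<epsilon>\<^sub>0 * (L * (d + d + d))"
    unfolding norm_mult using assms(1) L_nonneg \<epsilon>\<^sub>0
    by (intro mult_mono order_trans[OF along_lipschitz[OF EF s t]] mult_left_mono add_mono d) auto
  finally show ?thesis by (simp add: algebra_simps)
qed

lemma norm_zmp_le:
  assumes "g holomorphic_on strip \<sigma>" "\<And>t. t \<in> strip \<sigma> \<Longrightarrow> g (t + of_real T) = g t"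
    "\<And>t. t \<in> strip \<sigma> \<Longrightarrow> norm (g t) \<le> D" "t \<in> strip \<sigma>"
  shows "norm (zero_mean_primitive T g t) \<le> Z * D"
  unfolding Z_def by (rule norm_zero_mean_primitive_le[OF assms(1,2) \<sigma>(1) T_pos assms(3,4)])

lemma norm_zmp_diff_le:
  assumes "g holomorphic_on strip \<sigma>" "\<And>t. t \<in> strip \<sigma> \<Longrightarrow> g (t + of_real T) = g t"
    "h holomorphic_on strip \<sigma>" "\<And>t. t \<in> strip \<sigma> \<Longrightarrow> h (t + of_real T) = h t"
    "\<And>t. t \<in> strip \<sigma> \<Longrightarrow> norm (g t - h t) \<le> D" "t \<in> strip \<sigma>"
  shows "norm (zero_mean_primitive T g t - zero_mean_primitive T h t) \<le> Z * D"
  unfolding zero_mean_primitive_diff[OF assms(1,3) \<sigma>(1) assms(6), symmetric]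
  by (rule norm_zmp_le[OF _ _ assms(5,6)]) (use assms in \<open>auto intro!: holomorphic_intros\<close>)

lemma norm_mean_diff_le:
  assumes "g holomorphic_on strip \<sigma>" "h holomorphic_on strip \<sigma>"
    "\<And>t. t \<in> strip \<sigma> \<Longrightarrow> norm (g t - h t) \<le> D"
  shows "norm (mean T g - mean T h) \<le> D"
  unfolding mean_diff[OF assms(1,2) \<sigma>(1), symmetric]
  by (rule norm_mean_le[OF _ \<sigma>(1) assms(3)]) (use assms in \<open>auto intro!: holomorphic_intros\<close>)

lemma norm_mult_minus_divide_le:
  "norm (x * y - z / complex_of_real w) \<le> norm x * norm y + norm z / \<bar>w\<bar>"
  using norm_triangle_ineq4[of "x * y" "z / of_real w"] by (simp add: norm_mult norm_divide)

lemma next_Y_holomorphic: "state k Y X \<Longrightarrow> next_Y e k Y X holomorphic_on strip \<sigma>"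
  unfolding next_Y_def
  by (intro holomorphic_intros zero_mean_primitive_holomorphic along_holomorphic[OF EG]) (use nz in auto)

lemma next_Y_periodic:
  "state k Y X \<Longrightarrow> t \<in> strip \<sigma> \<Longrightarrow> next_Y e k Y X (t + of_real T) = next_Y e k Y X t"
  unfolding next_Y_def
  using zero_mean_primitive_periodic[OF along_holomorphic[OF EG] along_periodic[OF EG] \<sigma>(1)] by simp

lemma drive_holomorphic:
  "state k Y X \<Longrightarrow> drive e k Y X holomorphic_on strip \<sigma>"
  unfolding drive_def by (intro holomorphic_intros forcing_holomorphic next_Y_holomorphic)

lemma drive_periodic:
  "state k Y X \<Longrightarrow> t \<in> strip \<sigma> \<Longrightarrow> drive e k Y X (t + of_real T) = drive e k Y X t"
  by (simp add: drive_def forcing_periodic next_Y_periodic)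

lemma next_X_holomorphic: "state k Y X \<Longrightarrow> next_X e k Y X holomorphic_on strip \<sigma>"
  unfolding next_X_def by (intro zero_mean_primitive_holomorphic drive_holomorphic)

lemma next_X_periodic:
  "state k Y X \<Longrightarrow> t \<in> strip \<sigma> \<Longrightarrow> next_X e k Y X (t + of_real T) = next_X e k Y X t"
  unfolding next_X_def
  by (rule zero_mean_primitive_periodic[OF drive_holomorphic drive_periodic \<sigma>(1)])

context
  fixes e :: complex and k Y X k' Y' X' :: "complex \<Rightarrow> complex" and d :: real
  assumes e: "norm e \<le> \<epsilon>\<^sub>0" and s: "state k Y X" and s': "state k' Y' X'"
    and d: "\<And>t. t \<in> strip \<sigma> \<Longrightarrow> norm (k t - k' t) \<le> d"
      "\<And>t. t \<in> strip \<sigma> \<Longrightarrow> norm (Y t - Y' t) \<le> d" "\<And>t. t \<in> strip \<sigma> \<Longrightarrow> norm (X t - X' t) \<le> d"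
begin

lemma next_Y_lipschitz:
  assumes "t \<in> strip \<sigma>"
  shows "norm (next_Y e k Y X t - next_Y e k' Y' X' t) \<le> a * d"
proof -
  let ?J = "zero_mean_primitive T (along EG k Y X) t - zero_mean_primitive T (along EG k' Y' X') t"
  let ?M = "mean T (forcing e k Y X) - mean T (forcing e k' Y' X')"
  have lip: "norm (along EG k Y X t - along EG k' Y' X' t) \<le> 3 * L * d" if "t \<in> strip \<sigma>" for t
  proof -
    have "norm (along EG k Y X t - along EG k' Y' X' t) \<le> L * (d + d + d)"
      using L_nonneg d[OF that]
      by (intro order_trans[OF along_lipschitz[OF EG s s' that]] mult_left_mono add_mono) auto
    then show ?thesis by simp
  qed
  have J: "norm ?J \<le> Z * (3 * L * d)"
    by (rule norm_zmp_diff_le[OF along_holomorphic[OF EG s] along_periodic[OF EG s]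
          along_holomorphic[OF EG s'] along_periodic[OF EG s'] lip assms])
  have M: "norm ?M \<le> (\<rho> + \<epsilon>\<^sub>0 * (3 * L)) * d"
    by (intro norm_mean_diff_le forcing_holomorphic s s' forcing_lipschitz[OF e s s'] d)
  have "next_Y e k Y X t - next_Y e k' Y' X' t = e * ?J - ?M / of_real \<omega>\<^sub>1"
    by (simp add: next_Y_def algebra_simps diff_divide_distrib)
  then have "norm (next_Y e k Y X t - next_Y e k' Y' X' t) \<le> norm e * norm ?J + norm ?M / \<bar>\<omega>\<^sub>1\<bar>"
    by (simp only: norm_mult_minus_divide_le)
  also have "\<dots> \<le> \<epsilon>\<^sub>0 * (Z * (3 * L * d)) + (\<rho> + \<epsilon>\<^sub>0 * (3 * L)) * d / \<bar>\<omega>\<^sub>1\<bar>"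
    using \<epsilon>\<^sub>0 by (intro add_mono mult_mono divide_right_mono e J M) simp_all
  also have "\<dots> = a * d"
    unfolding a_eq using nz by (simp add: field_simps)
  finally show ?thesis .
qed

lemma next_X_lipschitz:
  assumes "t \<in> strip \<sigma>"
  shows "norm (next_X e k Y X t - next_X e k' Y' X' t) \<le> b * d"
proof -
  have "norm (next_X e k Y X t - next_X e k' Y' X' t) \<le> Z * ((\<rho> + \<epsilon>\<^sub>0 * (3 * L)) * d + \<bar>\<omega>\<^sub>1\<bar> * (a * d))"
    unfolding next_X_def
  proof (rule norm_zmp_diff_le[OF drive_holomorphic[OF s] drive_periodic[OF s] drive_holomorphic[OF s'] drive_periodic[OF s'] _ assms])
    fix t assume t: "t \<in> strip \<sigma>"
    have "norm (drive e k Y X t - drive e k' Y' X' t) \<le>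
        norm (forcing e k Y X t - forcing e k' Y' X' t) + norm (of_real \<omega>\<^sub>1 * (next_Y e k Y X t - next_Y e k' Y' X' t))"
      using norm_triangle_ineq[of "forcing e k Y X t - forcing e k' Y' X' t" "of_real \<omega>\<^sub>1 * (next_Y e k Y X t - next_Y e k' Y' X' t)"]
      by (simp add: drive_def algebra_simps)
    also have "\<dots> \<le> (\<rho> + \<epsilon>\<^sub>0 * (3 * L)) * d + \<bar>\<omega>\<^sub>1\<bar> * (a * d)"
      unfolding norm_mult norm_of_real
      by (intro add_mono mult_left_mono forcing_lipschitz[OF e s s' t] next_Y_lipschitz[OF t] d t) auto
    finally show "norm (drive e k Y X t - drive e k' Y' X' t) \<le> (\<rho> + \<epsilon>\<^sub>0 * (3 * L)) * d + \<bar>\<omega>\<^sub>1\<bar> * (a * d)" .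
  qed
  also have "\<dots> = b * d"
    unfolding b_eq by (simp add: algebra_simps)
  finally show ?thesis .
qed

end

lemma initial_state: "state (\<lambda>t. of_real k\<^sub>0) (\<lambda>t. 0) (\<lambda>t. 0)"
  using R by (simp add: state_def admissible_def)

lemma initial_forcing: "norm e \<le> \<epsilon>\<^sub>0 \<Longrightarrow> t \<in> strip \<sigma> \<Longrightarrow> norm (forcing e (\<lambda>t. of_real k\<^sub>0) (\<lambda>t. 0) (\<lambda>t. 0) t) \<le> \<epsilon>\<^sub>0 * B"
  using norm_along_le[OF EF initial_state] \<epsilon>\<^sub>0 by (auto simp: forcing_def r_0 norm_mult intro!: mult_mono)

lemma initial_next_Y:
  assumes e: "norm e \<le> \<epsilon>\<^sub>0" and "t \<in> strip \<sigma>"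
  shows "norm (next_Y e (\<lambda>t. of_real k\<^sub>0) (\<lambda>t. 0) (\<lambda>t. 0) t) \<le> y\<^sub>0"
proof -
  let ?J = "zero_mean_primitive T (along EG (\<lambda>t. of_real k\<^sub>0) (\<lambda>t. 0) (\<lambda>t. 0)) t"
  let ?M = "mean T (forcing e (\<lambda>t. of_real k\<^sub>0) (\<lambda>t. 0) (\<lambda>t. 0))"
  have J: "norm ?J \<le> Z * B"
    by (rule norm_zmp_le[OF along_holomorphic[OF EG initial_state] along_periodic[OF EG initial_state]
          norm_along_le[OF EG initial_state] assms(2)])
  have M: "norm ?M \<le> \<epsilon>\<^sub>0 * B"
    by (rule norm_mean_le[OF forcing_holomorphic[OF initial_state] \<sigma>(1) initial_forcing[OF e]])
  have "norm (e * ?J - ?M / of_real \<omega>\<^sub>1) \<le> norm e * norm ?J + norm ?M / \<bar>\<omega>\<^sub>1\<bar>"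
    by (rule norm_mult_minus_divide_le)
  also have "\<dots> \<le> \<epsilon>\<^sub>0 * (Z * B) + \<epsilon>\<^sub>0 * B / \<bar>\<omega>\<^sub>1\<bar>"
    using \<epsilon>\<^sub>0 by (intro add_mono mult_mono divide_right_mono e J M) simp_all
  finally show ?thesis by (simp add: next_Y_def y_eq mult.assoc)
qed

lemma initial_next_X:
  assumes e: "norm e \<le> \<epsilon>\<^sub>0" and "t \<in> strip \<sigma>"
  shows "norm (next_X e (\<lambda>t. of_real k\<^sub>0) (\<lambda>t. 0) (\<lambda>t. 0) t) \<le> x\<^sub>0"
  unfolding next_X_def x_eq
proof (rule norm_zmp_le[OF drive_holomorphic[OF initial_state] drive_periodic[OF initial_state] _ assms(2)])
  fix t assume t: "t \<in> strip \<sigma>"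
  show "norm (drive e (\<lambda>t. of_real k\<^sub>0) (\<lambda>t. 0) (\<lambda>t. 0) t) \<le> \<epsilon>\<^sub>0 * B + \<bar>\<omega>\<^sub>1\<bar> * y\<^sub>0"
    unfolding drive_def by (rule order_trans[OF norm_triangle_ineq])
       (auto simp: norm_mult intro!: add_mono mult_left_mono initial_forcing[OF e t] initial_next_Y[OF e t])
qed

lemma dist_initial:
  assumes "state k Y X" "t \<in> strip \<sigma>"
  shows "norm (k t - of_real k\<^sub>0) \<le> R" "norm (Y t - 0) \<le> R" "norm (X t - 0) \<le> R"
  using assms by (auto simp: state_def admissible_def)

lemma next_state:
  assumes e: "norm e \<le> \<epsilon>\<^sub>0" and s: "state k Y X"
  shows "state k (next_Y e k Y X) (next_X e k Y X)"
proof -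
  have "norm (next_Y e k Y X t) \<le> R" if t: "t \<in> strip \<sigma>" for t
  proof -
    have "norm (next_Y e k Y X t - next_Y e (\<lambda>t. of_real k\<^sub>0) (\<lambda>t. 0) (\<lambda>t. 0) t) \<le> a * R"
      by (rule next_Y_lipschitz[OF e s initial_state _ _ _ t]) (use dist_initial[OF s] in auto)
    also have "a * R \<le> 1 / 2 * R" using ab_le R by (intro mult_right_mono) auto
    finally show ?thesis
      using initial_next_Y[OF e t] start_le(1)
        norm_triangle_sub[of "next_Y e k Y X t" "next_Y e (\<lambda>t. of_real k\<^sub>0) (\<lambda>t. 0) (\<lambda>t. 0) t"] by simp
  qed
  moreover have "norm (next_X e k Y X t) \<le> R" if t: "t \<in> strip \<sigma>" for t
  proof -
    have "norm (next_X e k Y X t - next_X e (\<lambda>t. of_real k\<^sub>0) (\<lambda>t. 0) (\<lambda>t. 0) t) \<le> b * R"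
      by (rule next_X_lipschitz[OF e s initial_state _ _ _ t]) (use dist_initial[OF s] in auto)
    also have "b * R \<le> 1 / 2 * R" using ab_le R by (intro mult_right_mono) auto
    finally show ?thesis
      using initial_next_X[OF e t] start_le(2)
        norm_triangle_sub[of "next_X e k Y X t" "next_X e (\<lambda>t. of_real k\<^sub>0) (\<lambda>t. 0) (\<lambda>t. 0) t"] by simp
  qed
  ultimately show ?thesis
    using s next_Y_holomorphic[OF s] next_Y_periodic[OF s] next_X_holomorphic[OF s] next_X_periodic[OF s]
    by (simp add: state_def admissible_def)
qed

text \<open>The value of \<open>G\<close> along the unperturbed motion of phase \<open>k\<^sub>0 + s\<close>, at the reference parameter.\<close>

definition base :: "complex \<Rightarrow> complex \<Rightarrow> complex"
  where "base s t = EG (of_real \<Omega> * t + of_real k\<^sub>0 + s) (of_real A\<^sub>0) (of_real C\<^sub>1) t"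

lemma near_base:
  assumes "t \<in> strip \<sigma>"
  shows "near_torus A\<^sub>0 C\<^sub>1 (\<delta> / 4) (of_real \<Omega> * t + of_real k\<^sub>0) (of_real A\<^sub>0) (of_real C\<^sub>1) t"
  using near_quarter[OF assms, of "of_real k\<^sub>0" 0 0] R \<delta>_pos by (simp add: near_torus_def)

lemma base_holomorphic:
  assumes "norm s \<le> 2 * R"
  shows "base s holomorphic_on strip \<sigma>"
  unfolding base_def
proof (rule complex_extensionD(1)[OF EG open_strip])
  fix t assume t: "t \<in> strip \<sigma>"
  have "\<bar>Im s\<bar> \<le> 2 * R" using abs_Im_le_cmod[of s] assms by simp
  then show "near_torus A\<^sub>0 C\<^sub>1 \<delta> (of_real \<Omega> * t + of_real k\<^sub>0 + s) (of_real A\<^sub>0) (of_real C\<^sub>1) t"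
    using near_base[OF t] R \<delta>_pos unfolding near_torus_def plus_complex.sel by auto
qed (auto intro!: holomorphic_intros)

lemma mean_base_approx: "norm s \<le> 2 * R \<Longrightarrow> norm (mean T (base s) - of_real \<mu> * s) \<le> \<bar>\<mu>\<bar> / 8 * norm s"
  using melnikov_approx[of s] by (simp add: base_def[abs_def] T_def)

lemma mean_base_0: "mean T (base 0) = 0"
  using melnikov_0 by (simp add: base_def[abs_def] T_def)

text \<open>Changing the phase alone, by \<open>s\<close>, changes the mean of \<open>G\<close> by nearly the same amount as along the
unperturbed motion (second difference), that is by nearly \<open>\<mu> s\<close>; the Newton step cancels \<open>\<mu> s\<close>.
The change through the new action and angle is governed by \<open>a + b\<close>.\<close>

lemma next_k_lipschitz:
  assumes e: "norm e \<le> \<epsilon>\<^sub>0" and s: "state k Y X" and s': "state k' Y' X'"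
    and d: "\<And>t. t \<in> strip \<sigma> \<Longrightarrow> norm (k t - k' t) \<le> d"
      "\<And>t. t \<in> strip \<sigma> \<Longrightarrow> norm (Y t - Y' t) \<le> d" "\<And>t. t \<in> strip \<sigma> \<Longrightarrow> norm (X t - X' t) \<le> d"
    and const: "\<And>t. t \<in> strip \<sigma> \<Longrightarrow> k t = k 0" "\<And>t. t \<in> strip \<sigma> \<Longrightarrow> k' t = k' 0"
    and t: "t \<in> strip \<sigma>"
  shows "norm (next_k e k Y X t - next_k e k' Y' X' t) \<le> d / 2"
proof -
  define Y1 X1 Y2 X2 where "Y1 = next_Y e k Y X" and "X1 = next_X e k Y X"
    and "Y2 = next_Y e k' Y' X'" and "X2 = next_X e k' Y' X'"
  define s where "s = k 0 - k' 0"
  have st1: "state k Y1 X1" and st2: "state k' Y2 X2"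
    using next_state[OF e] assms(2,3) by (simp_all add: Y1_def X1_def Y2_def X2_def)
  then have st12: "state k' Y1 X1" by (simp add: state_def)
  have 0: "(0::complex) \<in> strip \<sigma>" using \<sigma>(1) by (simp add: strip_def)
  have "norm s \<le> d" using d(1)[OF 0] by (simp add: s_def)
  have s_2R: "norm s \<le> 2 * R"
    using norm_triangle_ineq4[of "k 0 - of_real k\<^sub>0" "k' 0 - of_real k\<^sub>0"] dist_initial(1)[OF st1 0] dist_initial(1)[OF st2 0]
    by (simp add: s_def)
  have hol: "along EG k Y1 X1 holomorphic_on strip \<sigma>" "along EG k' Y1 X1 holomorphic_on strip \<sigma>"
    "along EG k' Y2 X2 holomorphic_on strip \<sigma>" "base s holomorphic_on strip \<sigma>" "base 0 holomorphic_on strip \<sigma>"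
    using along_holomorphic[OF EG] st1 st12 st2 base_holomorphic s_2R R by auto
  have "norm (mean T (\<lambda>t. along EG k Y1 X1 t - along EG k' Y1 X1 t) - mean T (\<lambda>t. base s t - base 0 t)) \<le> \<bar>\<mu>\<bar> / 8 * norm s"
  proof (rule norm_mean_diff_le)
    fix t assume t: "t \<in> strip \<sigma>"
    have k_eq: "k t = k' t + s" using const[OF t] by (simp add: s_def)
    note bounds = dist_initial[OF st12 t]
    have "norm ((along EG k Y1 X1 t - along EG k' Y1 X1 t) - (base s t - base 0 t)) \<le>
        64 * B / \<delta>\<^sup>2 * (norm ((of_real \<Omega> * t + k' t + X1 t) - (of_real \<Omega> * t + of_real k\<^sub>0)) +
          norm ((of_real A\<^sub>0 + Y1 t) - of_real A\<^sub>0) + norm (complex_of_real C - of_real C\<^sub>1) + norm (t - t)) * norm s"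
      using complex_extension_second_difference[OF EG \<delta>_pos state_near[OF st12 t] near_base[OF t], of s] s_2R R
      by (simp add: along_def base_def k_eq add_ac)
    also have "\<dots> \<le> 64 * B / \<delta>\<^sup>2 * (4 * R) * norm s"
    proof (intro mult_right_mono mult_left_mono)
      have "norm ((of_real \<Omega> * t + k' t + X1 t) - (of_real \<Omega> * t + of_real k\<^sub>0)) \<le> 2 * R"
        using bounds norm_triangle_ineq[of "k' t - of_real k\<^sub>0" "X1 t"] by (simp add: algebra_simps)
      moreover have "norm (complex_of_real C - of_real C\<^sub>1) \<le> R"
        using C_near by (simp flip: of_real_diff)
      ultimately show "norm ((of_real \<Omega> * t + k' t + X1 t) - (of_real \<Omega> * t + of_real k\<^sub>0)) +
          norm ((of_real A\<^sub>0 + Y1 t) - of_real A\<^sub>0) + norm (complex_of_real C - of_real C\<^sub>1) + norm (t - t) \<le> 4 * R"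
        using bounds(2) by simp
    qed (use B in auto)
    also have "\<dots> \<le> \<bar>\<mu>\<bar> / 8 * norm s"
      by (intro mult_right_mono R_small) auto
    finally show "norm ((along EG k Y1 X1 t - along EG k' Y1 X1 t) - (base s t - base 0 t)) \<le> \<bar>\<mu>\<bar> / 8 * norm s" .
  qed (intro holomorphic_intros hol)+
  then have 1: "norm ((mean T (along EG k Y1 X1) - mean T (along EG k' Y1 X1)) - mean T (base s)) \<le> \<bar>\<mu>\<bar> / 8 * norm s"
    by (simp add: mean_diff[OF _ _ \<sigma>(1)] hol mean_base_0)
  note 2 = mean_base_approx[OF s_2R]
  have 3: "norm (mean T (along EG k' Y1 X1) - mean T (along EG k' Y2 X2)) \<le> \<bar>\<mu>\<bar> / 4 * d"
  proof -
    have "norm (mean T (along EG k' Y1 X1) - mean T (along EG k' Y2 X2)) \<le> L * (0 + a * d + b * d)"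
    proof (intro norm_mean_diff_le hol)
      fix t assume t: "t \<in> strip \<sigma>"
      have "norm (Y1 t - Y2 t) \<le> a * d" "norm (X1 t - X2 t) \<le> b * d"
        unfolding Y1_def Y2_def X1_def X2_def
        by (rule next_Y_lipschitz[OF e assms(2,3) d t] next_X_lipschitz[OF e assms(2,3) d t]; assumption)+
      then show "norm (along EG k' Y1 X1 t - along EG k' Y2 X2 t) \<le> L * (0 + a * d + b * d)"
        using L_nonneg
        by (intro order_trans[OF along_lipschitz[OF EG st12 st2 t]] mult_left_mono add_mono) auto
    qed
    also have "\<dots> = (L * (a + b)) * d" by (simp add: algebra_simps)
    also have "\<dots> \<le> \<bar>\<mu>\<bar> / 4 * d"
      using ab_le(3) order_trans[OF norm_ge_zero \<open>norm s \<le> d\<close>] by (intro mult_right_mono) simp_all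
    finally show ?thesis .
  qed
  define M where "M = mean T (along EG k Y1 X1) - mean T (along EG k' Y2 X2)"
  have split: "M - of_real \<mu> * s = ((mean T (along EG k Y1 X1) - mean T (along EG k' Y1 X1)) - mean T (base s)) +
      (mean T (base s) - of_real \<mu> * s) + (mean T (along EG k' Y1 X1) - mean T (along EG k' Y2 X2))"
    by (simp add: M_def)
  have "norm (M - of_real \<mu> * s) \<le> \<bar>\<mu>\<bar> / 8 * norm s + \<bar>\<mu>\<bar> / 8 * norm s + \<bar>\<mu>\<bar> / 4 * d"
    unfolding split by (intro order_trans[OF norm_triangle_ineq] add_mono 1 2 3)
  also have "\<dots> \<le> \<bar>\<mu>\<bar> / 8 * d + \<bar>\<mu>\<bar> / 8 * d + \<bar>\<mu>\<bar> / 4 * d"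
    by (intro add_mono mult_left_mono \<open>norm s \<le> d\<close>) auto
  finally have M: "norm (M - of_real \<mu> * s) \<le> \<bar>\<mu>\<bar> * (d / 2)" by (simp add: algebra_simps)
  have "next_k e k Y X t - next_k e k' Y' X' t = (k t - k' t) - M / of_real \<mu>"
    unfolding next_k_def M_def Y1_def X1_def Y2_def X2_def by (simp add: diff_divide_distrib)
  also have "\<dots> = - ((M - of_real \<mu> * s) / of_real \<mu>)"
    using nz(2) const[OF t] by (simp add: s_def diff_divide_distrib)
  finally have "norm (next_k e k Y X t - next_k e k' Y' X' t) = norm (M - of_real \<mu> * s) / \<bar>\<mu>\<bar>"
    by (simp add: norm_divide)
  also have "\<dots> \<le> \<bar>\<mu>\<bar> * (d / 2) / \<bar>\<mu>\<bar>" by (intro divide_right_mono M) auto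
  also have "\<dots> = d / 2" using nz(2) by simp
  finally show ?thesis .
qed

lemma initial_next_k:
  assumes e: "norm e \<le> \<epsilon>\<^sub>0"
  shows "norm (next_k e (\<lambda>t. of_real k\<^sub>0) (\<lambda>t. 0) (\<lambda>t. 0) t - of_real k\<^sub>0) \<le> R / 2"
proof -
  define Y1 X1 where "Y1 = next_Y e (\<lambda>t. of_real k\<^sub>0) (\<lambda>t. 0) (\<lambda>t. 0)" and "X1 = next_X e (\<lambda>t. of_real k\<^sub>0) (\<lambda>t. 0) (\<lambda>t. 0)"
  define M where "M = mean T (along EG (\<lambda>t. of_real k\<^sub>0) Y1 X1)"
  have st: "state (\<lambda>t. of_real k\<^sub>0) Y1 X1"
    unfolding Y1_def X1_def by (rule next_state[OF e initial_state])
  have "norm (M - mean T (base 0)) \<le> \<bar>\<mu>\<bar> * (R / 2)"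
    unfolding M_def
  proof (rule norm_mean_diff_le[OF along_holomorphic[OF EG st] base_holomorphic])
    fix t assume t: "t \<in> strip \<sigma>"
    have "norm (along EG (\<lambda>t. of_real k\<^sub>0) Y1 X1 t - base 0 t) \<le>
        L * (norm ((of_real \<Omega> * t + of_real k\<^sub>0 + X1 t) - (of_real \<Omega> * t + of_real k\<^sub>0)) +
          norm ((of_real A\<^sub>0 + Y1 t) - of_real A\<^sub>0) + norm (complex_of_real C - of_real C\<^sub>1) + norm (t - t))"
      using complex_extension_lipschitz[OF EG \<delta>_pos near_weaken[OF state_near[OF st t]] near_weaken[OF near_base[OF t]]] \<delta>_pos
      by (simp add: along_def base_def L_def)
    also have "\<dots> \<le> L * (x\<^sub>0 + y\<^sub>0 + \<bar>C - C\<^sub>1\<bar> + 0)"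
    proof (intro mult_left_mono add_mono L_nonneg)
      show "norm (complex_of_real C - of_real C\<^sub>1) \<le> \<bar>C - C\<^sub>1\<bar>" by (simp flip: of_real_diff)
    qed (use initial_next_X[OF e t] initial_next_Y[OF e t] in \<open>simp_all add: X1_def Y1_def\<close>)
    also have "\<dots> \<le> \<bar>\<mu>\<bar> * (R / 2)" using start_le(3) by simp
    finally show "norm (along EG (\<lambda>t. of_real k\<^sub>0) Y1 X1 t - base 0 t) \<le> \<bar>\<mu>\<bar> * (R / 2)" .
  qed (use R in simp)
  then have M: "norm M \<le> \<bar>\<mu>\<bar> * (R / 2)" by (simp add: mean_base_0)
  have "next_k e (\<lambda>t. of_real k\<^sub>0) (\<lambda>t. 0) (\<lambda>t. 0) t - of_real k\<^sub>0 = - (M / of_real \<mu>)"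
    by (simp add: next_k_def M_def Y1_def X1_def)
  then have "norm (next_k e (\<lambda>t. of_real k\<^sub>0) (\<lambda>t. 0) (\<lambda>t. 0) t - of_real k\<^sub>0) = norm M / \<bar>\<mu>\<bar>"
    by (simp add: norm_divide)
  also have "\<dots> \<le> \<bar>\<mu>\<bar> * (R / 2) / \<bar>\<mu>\<bar>" by (intro divide_right_mono M) auto
  also have "\<dots> = R / 2" using nz(2) by simp
  finally show ?thesis .
qed

abbreviation family :: "(complex \<Rightarrow> complex \<Rightarrow> complex) \<Rightarrow> bool"
  where "family \<equiv> periodic_family T (ball 0 \<epsilon>\<^sub>0) \<sigma>"

definition states :: "(complex \<Rightarrow> complex \<Rightarrow> complex) \<Rightarrow> (complex \<Rightarrow> complex \<Rightarrow> complex) \<Rightarrow> (complex \<Rightarrow> complex \<Rightarrow> complex) \<Rightarrow> bool"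
  where "states k Y X \<longleftrightarrow> family k \<and> family Y \<and> family X \<and> (\<forall>e\<in>ball 0 \<epsilon>\<^sub>0. state (k e) (Y e) (X e))"

lemma statesD:
  assumes "states k Y X"
  shows "family k" "family Y" "family X" "e \<in> ball 0 \<epsilon>\<^sub>0 \<Longrightarrow> state (k e) (Y e) (X e)"
  using assms by (auto simp: states_def)

lemma along_of_real:
  assumes E: "complex_extension H A\<^sub>0 C\<^sub>1 \<delta> B E" and s: "state k Y X"
    and real: "k (of_real t) = complex_of_real x" "Y (of_real t) = complex_of_real y" "X (of_real t) = complex_of_real z"
  shows "along E k Y X (of_real t) = of_real (H (\<Omega> * t + x + z) (A\<^sub>0 + y) C t)"
proof -
  have "norm (Y (of_real t)) \<le> R"
    using s of_real_in_strip[OF \<sigma>(1)] by (simp add: state_def admissible_def)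
  then have "\<bar>(A\<^sub>0 + y) - A\<^sub>0\<bar> < \<delta>" "\<bar>C - C\<^sub>1\<bar> < \<delta>"
    using R C_near by (simp_all add: real)
  from complex_extensionD(5)[OF E this, of "\<Omega> * t + x + z" t] show ?thesis
    by (simp add: along_def real)
qed

lemma family_along:
  assumes E: "complex_extension H A\<^sub>0 C\<^sub>1 \<delta> B E" and s: "states k Y X"
  shows "family (\<lambda>e. along E (k e) (Y e) (X e))"
  unfolding periodic_family_def
proof (intro conjI ballI allI impI)
  note fam = statesD(1-3)[OF s] and st = statesD(4)[OF s]
  show "sep_holomorphic (ball 0 \<epsilon>\<^sub>0) (strip \<sigma>) (\<lambda>e. along E (k e) (Y e) (X e))"
  proof (rule sep_holomorphicI_bounded[OF open_ball open_strip])
    show "(\<lambda>e. along E (k e) (Y e) (X e) t) holomorphic_on ball 0 \<epsilon>\<^sub>0" if "t \<in> strip \<sigma>" for t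
      unfolding along_def
      by (rule complex_extensionD(1)[OF E open_ball])
         (use that fam[THEN periodic_familyD(5)] state_near_full[OF st that] in \<open>auto intro!: holomorphic_intros\<close>)
  qed (use along_holomorphic[OF E st] norm_along_le[OF E st] in auto)
  show "along E (k e) (Y e) (X e) (t + complex_of_real T) = along E (k e) (Y e) (X e) t"
    if "e \<in> ball 0 \<epsilon>\<^sub>0" "t \<in> strip \<sigma>" for e t
    by (rule along_periodic[OF E st[OF that(1)] that(2)])
  show "along E (k (complex_of_real e)) (Y (complex_of_real e)) (X (complex_of_real e)) (complex_of_real t) \<in> \<real>"
    if e: "complex_of_real e \<in> ball 0 \<epsilon>\<^sub>0" for e t
  proof -
    obtain x y z where "k (of_real e) (of_real t) = complex_of_real x"
      "Y (of_real e) (of_real t) = complex_of_real y" "X (of_real e) (of_real t) = complex_of_real z"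
      using fam[THEN periodic_familyD(3)] e by (metis Reals_cases)
    from along_of_real[OF E st[OF e] this] show ?thesis by simp
  qed
qed

lemma norm_r_le: "norm y \<le> R \<Longrightarrow> norm (r y) \<le> \<rho> * R"
  using r_lip[of y 0] R \<rho> r_0 by (auto intro: order_trans mult_left_mono)

lemma family_r:
  assumes "family Y" "\<And>e t. e \<in> ball 0 \<epsilon>\<^sub>0 \<Longrightarrow> t \<in> strip \<sigma> \<Longrightarrow> norm (Y e t) \<le> R"
  shows "family (\<lambda>e t. r (Y e t))"
  unfolding periodic_family_def
proof (intro conjI ballI allI impI)
  have comp: "(\<lambda>x. r (g x)) holomorphic_on V" if "g holomorphic_on V" "\<And>x. x \<in> V \<Longrightarrow> norm (g x) \<le> R" for g V
    using holomorphic_on_compose_gen[OF that(1) r_hol] that(2) R by (force simp: o_def image_subset_iff)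
  show "sep_holomorphic (ball 0 \<epsilon>\<^sub>0) (strip \<sigma>) (\<lambda>e t. r (Y e t))"
    by (rule sep_holomorphicI_bounded[of _ _ _ "\<rho> * R", OF open_ball open_strip])
       (use periodic_familyD[OF assms(1)] assms(2) norm_r_le in \<open>auto intro!: comp\<close>)
  show "r (Y e (t + complex_of_real T)) = r (Y e t)" if "e \<in> ball 0 \<epsilon>\<^sub>0" "t \<in> strip \<sigma>" for e t
    using periodic_familyD(2)[OF assms(1) that] by simp
  show "r (Y (complex_of_real e) (complex_of_real t)) \<in> \<real>" if e: "complex_of_real e \<in> ball 0 \<epsilon>\<^sub>0" for e t
  proof -
    obtain y where y: "Y (of_real e) (of_real t) = complex_of_real y"
      using periodic_familyD(3)[OF assms(1) e] by (metis Reals_cases)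
    then show ?thesis
      using assms(2)[OF e of_real_in_strip[OF \<sigma>(1)], of t] r_real by simp
  qed
qed

lemma family_forcing:
  assumes s: "states k Y X"
  shows "family (\<lambda>e. forcing e (k e) (Y e) (X e))"
  unfolding forcing_def
  by (intro periodic_family_add periodic_family_mult periodic_family_parameter family_r family_along[OF EF s] statesD(2)[OF s])
     (use dist_initial(2)[OF statesD(4)[OF s]] in auto)

lemma family_next_Y:
  assumes s: "states k Y X"
  shows "family (\<lambda>e. next_Y e (k e) (Y e) (X e))"
  unfolding next_Y_def
  by (intro periodic_family_diff periodic_family_mult periodic_family_parameter periodic_family_divide_const
      periodic_family_mean[OF family_forcing[OF s] open_ball convex_ball \<sigma>(1)]
      periodic_family_zero_mean_primitive[OF family_along[OF EG s] open_ball convex_ball \<sigma>(1) T_pos])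
     (use norm_along_le[OF EG statesD(4)[OF s]] in auto)

lemma norm_parameter_le: "e \<in> ball 0 \<epsilon>\<^sub>0 \<Longrightarrow> norm e \<le> \<epsilon>\<^sub>0"
  by simp

lemma norm_forcing_le:
  assumes "norm e \<le> \<epsilon>\<^sub>0" "state k Y X" "t \<in> strip \<sigma>"
  shows "norm (forcing e k Y X t) \<le> \<rho> * R + \<epsilon>\<^sub>0 * B"
proof -
  have "norm (e * along EF k Y X t) \<le> \<epsilon>\<^sub>0 * B"
    unfolding norm_mult using assms norm_along_le[OF EF assms(2,3)] \<epsilon>\<^sub>0 by (intro mult_mono) auto
  then show ?thesis
    unfolding forcing_def using norm_r_le[of "Y t"] dist_initial(2)[OF assms(2,3)]
    by (intro order_trans[OF norm_triangle_ineq] add_mono) auto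
qed

lemma family_next_X:
  assumes s: "states k Y X"
  shows "family (\<lambda>e. next_X e (k e) (Y e) (X e))"
  unfolding next_X_def
proof (rule periodic_family_zero_mean_primitive[OF _ open_ball convex_ball \<sigma>(1) T_pos])
  show "family (\<lambda>e. drive e (k e) (Y e) (X e))"
    unfolding drive_def by (intro periodic_family_add periodic_family_mult periodic_family_const family_forcing[OF s] family_next_Y[OF s])
  fix e t :: complex assume e: "e \<in> ball 0 \<epsilon>\<^sub>0" and t: "t \<in> strip \<sigma>"
  have e': "norm e \<le> \<epsilon>\<^sub>0" using e by simp
  note st = statesD(4)[OF s e]
  have "norm (of_real \<omega>\<^sub>1 * next_Y e (k e) (Y e) (X e) t) \<le> \<bar>\<omega>\<^sub>1\<bar> * R"
    using dist_initial(2)[OF next_state[OF e' st] t] unfolding norm_mult by (simp add: mult_left_mono)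
  then show "norm (drive e (k e) (Y e) (X e) t) \<le> \<rho> * R + \<epsilon>\<^sub>0 * B + \<bar>\<omega>\<^sub>1\<bar> * R"
    unfolding drive_def by (intro order_trans[OF norm_triangle_ineq] add_mono norm_forcing_le e' st t)
qed

lemma family_next_k:
  assumes s: "states k Y X"
  shows "family (\<lambda>e. next_k e (k e) (Y e) (X e))"
proof -
  have "states k (\<lambda>e. next_Y e (k e) (Y e) (X e)) (\<lambda>e. next_X e (k e) (Y e) (X e))"
    using s family_next_Y[OF s] family_next_X[OF s] next_state[OF norm_parameter_le] by (simp add: states_def)
  then show ?thesis
    unfolding next_k_def
    by (intro periodic_family_diff periodic_family_divide_const statesD(1)[OF s]
        periodic_family_mean[OF family_along[OF EG] open_ball convex_ball \<sigma>(1)])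
qed

text \<open>The three components are indexed by \<open>0\<close> (phase), \<open>1\<close> (action) and \<open>2\<close> (angle), so that a single
sup norm over \<open>arguments\<close> measures all of them.\<close>

definition iterate :: "(nat \<times> complex \<times> complex \<Rightarrow> complex) \<Rightarrow> nat \<times> complex \<times> complex \<Rightarrow> complex"
  where "iterate u = (\<lambda>(i, e, t).
    (if i = 0 then next_k else if i = 1 then next_Y else next_X)
      e (\<lambda>t. u (0, e, t)) (\<lambda>t. u (1, e, t)) (\<lambda>t. u (2, e, t)) t)"

definition initial :: "nat \<times> complex \<times> complex \<Rightarrow> complex"
  where "initial = (\<lambda>(i, e, t). if i = 0 then of_real k\<^sub>0 else 0)"

text \<open>The class in which the iteration takes place. That action and angle corrections vanish at \<open>e = 0\<close>
is what makes the resulting family start on the unperturbed torus.\<close>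

definition regular :: "(nat \<times> complex \<times> complex \<Rightarrow> complex) \<Rightarrow> bool"
  where "regular u \<longleftrightarrow> (\<forall>i\<in>{0,1,2}. family (\<lambda>e t. u (i, e, t))) \<and>
    (\<forall>e\<in>ball 0 \<epsilon>\<^sub>0. \<forall>t\<in>strip \<sigma>. u (0, e, t) = u (0, e, 0)) \<and>
    (\<forall>t\<in>strip \<sigma>. u (1, 0, t) = 0 \<and> u (2, 0, t) = 0)"

definition arguments :: "(nat \<times> complex \<times> complex) set"
  where "arguments = {0, 1, 2} \<times> ball 0 \<epsilon>\<^sub>0 \<times> strip \<sigma>"

lemma regular_states:
  assumes u: "regular u" and R': "\<And>x. x \<in> arguments \<Longrightarrow> norm (u x - initial x) \<le> R"
  shows "states (\<lambda>e t. u (0, e, t)) (\<lambda>e t. u (1, e, t)) (\<lambda>e t. u (2, e, t))"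
proof -
  have fam: "family (\<lambda>e t. u (i, e, t))" if "i \<in> {0,1,2}" for i
    using u that by (auto simp: regular_def)
  have adm: "admissible (\<lambda>t. u (i, e, t)) (if i = 0 then of_real k\<^sub>0 else 0)" if "i \<in> {0,1,2}" "e \<in> ball 0 \<epsilon>\<^sub>0" for i e
    unfolding admissible_def
    using periodic_familyD(2,4)[OF fam[OF that(1)]] that R'[of "(i, e, t)" for t] by (auto simp: arguments_def initial_def)
  show ?thesis
    using fam[of 0] fam[of 1] fam[of 2] adm[of 0] adm[of 1] adm[of 2] by (simp add: states_def state_def)
qed

text \<open>At \<open>e = 0\<close> and \<open>Y = 0\<close> there is no forcing, since \<open>r 0 = 0\<close>.\<close>

lemma next_vanish_at_zero:
  assumes s: "state k Y X" and "\<And>t. t \<in> strip \<sigma> \<Longrightarrow> Y t = 0" and t: "t \<in> strip \<sigma>"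
  shows "next_Y 0 k Y X t = 0" "next_X 0 k Y X t = 0"
proof -
  have f0: "forcing 0 k Y X t = 0" if "t \<in> strip \<sigma>" for t
    using assms(2)[OF that] by (simp add: forcing_def r_0)
  have "norm (mean T (forcing 0 k Y X)) \<le> 0"
    by (rule norm_mean_le[OF forcing_holomorphic[OF s] \<sigma>(1)]) (simp add: f0)
  then have Y0: "next_Y 0 k Y X t = 0" for t by (simp add: next_Y_def)
  then show "next_Y 0 k Y X t = 0" .
  have "norm (next_X 0 k Y X t) \<le> Z * 0"
    unfolding next_X_def
  proof (rule norm_zmp_le[OF drive_holomorphic[OF s] drive_periodic[OF s] _ t])
    fix t assume "t \<in> strip \<sigma>"
    from f0[OF this] Y0[of t]
    show "norm (drive 0 k Y X t) \<le> 0" by (simp add: drive_def)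
  qed
  then show "next_X 0 k Y X t = 0" by simp
qed

lemma regular_iterate:
  assumes u: "regular u" and R': "\<And>x. x \<in> arguments \<Longrightarrow> norm (u x - initial x) \<le> R"
  shows "regular (iterate u)"
proof -
  note s = regular_states[OF assms]
  have "family (\<lambda>e t. iterate u (i, e, t))" if "i \<in> {0,1,2}" for i
    using that family_next_k[OF s] family_next_Y[OF s] family_next_X[OF s] by (auto simp: iterate_def)
  moreover have "iterate u (0, e, t) = iterate u (0, e, 0)" if "e \<in> ball 0 \<epsilon>\<^sub>0" "t \<in> strip \<sigma>" for e t
    using u that by (simp add: iterate_def next_k_def regular_def)
  moreover have "iterate u (1, 0, t) = 0 \<and> iterate u (2, 0, t) = 0" if "t \<in> strip \<sigma>" for t
    using next_vanish_at_zero[OF statesD(4)[OF s, of 0] _ that] u \<epsilon>\<^sub>0 by (simp add: iterate_def regular_def)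
  ultimately show ?thesis by (simp add: regular_def)
qed

lemma regular_uniform_limit:
  assumes w: "\<And>n. regular (w n)" and lim: "uniform_limit arguments w u sequentially"
  shows "regular u"
proof -
  have pt: "(\<lambda>n. w n (i, e, t)) \<longlonglongrightarrow> u (i, e, t)" if "i \<in> {0,1,2}" "e \<in> ball 0 \<epsilon>\<^sub>0" "t \<in> strip \<sigma>" for i e t
    using tendsto_uniform_limitI[OF lim] that by (auto simp: arguments_def)
  have 0: "(0::complex) \<in> ball 0 \<epsilon>\<^sub>0" "(0::complex) \<in> strip \<sigma>" using \<epsilon>\<^sub>0 \<sigma>(1) by (auto simp: strip_def)
  have "family (\<lambda>e t. u (i, e, t))" if i: "i \<in> {0,1,2}" for i
  proof (rule periodic_family_uniform_limit[of _ _ _ "\<lambda>n e t. w n (i, e, t)"])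
    show "family (\<lambda>e t. w n (i, e, t))" for n using w[of n] i by (auto simp: regular_def)
    show "uniform_limit (ball 0 \<epsilon>\<^sub>0 \<times> strip \<sigma>) (\<lambda>n (e, t). w n (i, e, t)) (\<lambda>(e, t). u (i, e, t)) sequentially"
      unfolding uniform_limit_iff
    proof (intro allI impI)
      fix \<epsilon> :: real assume "\<epsilon> > 0"
      then show "\<forall>\<^sub>F n in sequentially. \<forall>x\<in>ball 0 \<epsilon>\<^sub>0 \<times> strip \<sigma>. dist (case x of (e, t) \<Rightarrow> w n (i, e, t)) (case x of (e, t) \<Rightarrow> u (i, e, t)) < \<epsilon>"
        by (rule eventually_mono[OF lim[unfolded uniform_limit_iff, rule_format]]) (use i in \<open>auto simp: arguments_def\<close>)
    qed
  qed (use \<sigma> in auto)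
  moreover have "u (0, e, t) = u (0, e, 0)" if "e \<in> ball 0 \<epsilon>\<^sub>0" "t \<in> strip \<sigma>" for e t
  proof (rule LIMSEQ_unique)
    show "(\<lambda>n. w n (0, e, t)) \<longlonglongrightarrow> u (0, e, t)" using that by (intro pt) auto
    have "w n (0, e, t) = w n (0, e, 0)" for n using w[of n] that by (simp add: regular_def)
    then show "(\<lambda>n. w n (0, e, t)) \<longlonglongrightarrow> u (0, e, 0)" using that 0 pt[of 0 e 0] by simp
  qed
  moreover have "u (i, 0, t) = 0" if "i \<in> {1,2}" "t \<in> strip \<sigma>" for i t
  proof (rule LIMSEQ_unique)
    show "(\<lambda>n. w n (i, 0, t)) \<longlonglongrightarrow> u (i, 0, t)" using that 0 by (intro pt) auto
    have "w n (i, 0, t) = 0" for n using w[of n] that by (auto simp: regular_def)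
    then show "(\<lambda>n. w n (i, 0, t)) \<longlonglongrightarrow> 0" by simp
  qed
  ultimately show ?thesis by (simp add: regular_def)
qed

lemma fixpoint_exists:
  obtains u where "regular u" "\<And>x. x \<in> arguments \<Longrightarrow> norm (u x - initial x) \<le> R"
    "\<And>x. x \<in> arguments \<Longrightarrow> iterate u x = u x"
proof (rule contraction_fixpoint_in_closed_class[of regular arguments initial R iterate])
  show "regular initial"
    using periodic_family_const[of T "ball 0 \<epsilon>\<^sub>0" \<sigma> k\<^sub>0] periodic_family_const[of T "ball 0 \<epsilon>\<^sub>0" \<sigma> 0]
    by (simp add: regular_def initial_def)
next
  fix x assume "x \<in> arguments"
  then obtain i e t where x: "x = (i, e, t)" "i \<in> {0,1,2}" "norm e \<le> \<epsilon>\<^sub>0" "t \<in> strip \<sigma>"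
    by (auto simp: arguments_def)
  then show "norm (iterate initial x - initial x) \<le> R / 2"
    using initial_next_k[OF x(3), of t] initial_next_Y[OF x(3,4)] initial_next_X[OF x(3,4)] start_le(1,2)
    by (auto simp: iterate_def initial_def)
next
  fix u w d x
  assume u: "regular u" and w: "regular w"
    and uR: "\<And>x. x \<in> arguments \<Longrightarrow> norm (u x - initial x) \<le> R"
    and wR: "\<And>x. x \<in> arguments \<Longrightarrow> norm (w x - initial x) \<le> R"
    and d: "\<And>x. x \<in> arguments \<Longrightarrow> norm (u x - w x) \<le> d" and "x \<in> arguments"
  then obtain i e t where x: "x = (i, e, t)" "i \<in> {0,1,2}" "e \<in> ball 0 \<epsilon>\<^sub>0" "t \<in> strip \<sigma>"
    by (auto simp: arguments_def)
  have e: "norm e \<le> \<epsilon>\<^sub>0" using x by simp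
  have su: "state (\<lambda>t. u (0, e, t)) (\<lambda>t. u (1, e, t)) (\<lambda>t. u (2, e, t))"
    by (rule statesD(4)[OF regular_states[OF u] x(3)]) (rule uR)
  have sw: "state (\<lambda>t. w (0, e, t)) (\<lambda>t. w (1, e, t)) (\<lambda>t. w (2, e, t))"
    by (rule statesD(4)[OF regular_states[OF w] x(3)]) (rule wR)
  have d': "norm (u (j, e, t) - w (j, e, t)) \<le> d" if "t \<in> strip \<sigma>" "j \<in> {0,1,2}" for j t
    using d that x(3) by (simp add: arguments_def)
  have "d \<ge> 0" using order_trans[OF norm_ge_zero d'[OF x(4), of 0]] by simp
  have dd: "norm (u (0, e, t) - w (0, e, t)) \<le> d" "norm (u (1, e, t) - w (1, e, t)) \<le> d"
    "norm (u (2, e, t) - w (2, e, t)) \<le> d" if "t \<in> strip \<sigma>" for t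
    using d'[OF that] by blast+
  have const: "u (0, e, t) = u (0, e, 0)" "w (0, e, t) = w (0, e, 0)" if "t \<in> strip \<sigma>" for t
    using u w that x(3) by (simp_all add: regular_def)
  have k: "norm (iterate u (0, e, t) - iterate w (0, e, t)) \<le> d / 2"
    using next_k_lipschitz[OF e su sw dd const x(4)] by (simp add: iterate_def)
  have Y: "norm (iterate u (1, e, t) - iterate w (1, e, t)) \<le> a * d"
    using next_Y_lipschitz[OF e su sw dd x(4)] by (simp add: iterate_def)
  have X: "norm (iterate u (2, e, t) - iterate w (2, e, t)) \<le> b * d"
    using next_X_lipschitz[OF e su sw dd x(4)] by (simp add: iterate_def)
  have "a * d \<le> 1 / 2 * d" "b * d \<le> 1 / 2 * d"
    by (rule mult_right_mono[OF ab_le(1) \<open>d \<ge> 0\<close>], rule mult_right_mono[OF ab_le(2) \<open>d \<ge> 0\<close>])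
  then show "norm (iterate u x - iterate w x) \<le> d / 2"
    using k Y X x(1,2) by auto
qed (use regular_uniform_limit regular_iterate R in auto)

end

section \<open>Periodic solutions from fixed points\<close>

lemma Re_has_real_derivative:
  assumes "(f has_field_derivative D) (at (complex_of_real t))"
  shows "((\<lambda>t. Re (f (complex_of_real t))) has_real_derivative Re D) (at t)"
proof -
  have "((\<lambda>t. f (complex_of_real t)) has_vector_derivative D) (at t)"
    by (rule has_vector_derivative_real_field[OF assms])
  from bounded_linear.has_vector_derivative[OF bounded_linear_Re this] show ?thesis
    by (simp add: has_real_derivative_iff_has_vector_derivative)
qed

context resonant_torus
begin

lemma mean_cong: "(\<And>t. t \<in> strip \<sigma> \<Longrightarrow> g t = h t) \<Longrightarrow> mean T g = mean T h"
  unfolding mean_def by (intro integral_cong) (use of_real_in_strip[OF \<sigma>(1)] in \<open>simp del: of_real_mult\<close>)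

lemma mean_next_Y:
  assumes "state k Y X"
  shows "mean T (next_Y e k Y X) = - mean T (forcing e k Y X) / of_real \<omega>\<^sub>1"
proof -
  have J: "zero_mean_primitive T (along EG k Y X) holomorphic_on strip \<sigma>"
    by (intro zero_mean_primitive_holomorphic along_holomorphic[OF EG assms])
  have "mean T (next_Y e k Y X) = mean T (\<lambda>t. e * zero_mean_primitive T (along EG k Y X) t) -
      mean T (\<lambda>t. mean T (forcing e k Y X) / of_real \<omega>\<^sub>1)"
    unfolding next_Y_def by (intro mean_diff[OF _ _ \<sigma>(1)] holomorphic_intros J) (use nz in auto)
  then show ?thesis
    by (simp add: mean_cmult mean_const mean_zero_mean_primitive[OF along_holomorphic[OF EG assms] \<sigma>(1)])
qed

text \<open>This is how the mean of the new action was chosen, zero-mean primitives contributing nothing.\<close>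

lemma mean_drive:
  assumes s: "state k Y X"
  shows "mean T (drive e k Y X) = 0"
  unfolding drive_def
  using mean_add[OF forcing_holomorphic[OF s] holomorphic_on_mult[OF holomorphic_on_const next_Y_holomorphic[OF s]] \<sigma>(1)]
    mean_next_Y[OF s] nz
  by (simp add: mean_cmult)

text \<open>A fixed phase means that the mean of \<open>G\<close> vanishes. The two means subtracted in the construction
of the primitives are thus zero and the differential equations hold.\<close>

lemma fixpoint_equations:
  assumes s: "state k Y X" and fix_k: "next_k e k Y X 0 = k 0"
    and fix_Y: "\<And>t. t \<in> strip \<sigma> \<Longrightarrow> next_Y e k Y X t = Y t"
    and fix_X: "\<And>t. t \<in> strip \<sigma> \<Longrightarrow> next_X e k Y X t = X t" and t: "t \<in> strip \<sigma>"
  shows "(Y has_field_derivative e * along EG k Y X t) (at t)"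
    and "(X has_field_derivative forcing e k Y X t + of_real \<omega>\<^sub>1 * Y t) (at t)"
proof -
  have "mean T (along EG k Y X) = mean T (along EG k (next_Y e k Y X) (next_X e k Y X))"
    by (rule mean_cong) (simp add: along_def fix_Y fix_X)
  also have "\<dots> = 0" using fix_k nz by (simp add: next_k_def)
  finally have mean0: "mean T (along EG k Y X) = 0" .
  have "(next_Y e k Y X has_field_derivative e * (along EG k Y X t - mean T (along EG k Y X)) - 0) (at t)"
    unfolding next_Y_def
    by (intro DERIV_diff DERIV_cmult zero_mean_primitive_has_derivative[OF along_holomorphic[OF EG s] t] DERIV_const)
  then have "(next_Y e k Y X has_field_derivative e * along EG k Y X t) (at t)" by (simp add: mean0)
  then show "(Y has_field_derivative e * along EG k Y X t) (at t)"
    by (rule has_field_derivative_transform_within_open[OF _ open_strip t fix_Y])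
  have "(next_X e k Y X has_field_derivative drive e k Y X t - 0) (at t)"
    unfolding next_X_def
    using zero_mean_primitive_has_derivative[OF drive_holomorphic[OF s] t, of T] by (simp only: mean_drive[OF s])
  then have "(next_X e k Y X has_field_derivative forcing e k Y X t + of_real \<omega>\<^sub>1 * Y t) (at t)"
    by (simp add: drive_def fix_Y[OF t])
  then show "(X has_field_derivative forcing e k Y X t + of_real \<omega>\<^sub>1 * Y t) (at t)"
    by (rule has_field_derivative_transform_within_open[OF _ open_strip t fix_X])
qed

text \<open>Values at real arguments are real, so the real parts of the fixed point solve the real system;
analyticity in \<open>(e, t)\<close> comes from separate holomorphy.\<close>

lemma periodic_solutions_exist:
  obtains \<alpha> A :: "real \<Rightarrow> real \<Rightarrow> real" and \<kappa> :: real where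
    "real_analytic_on (\<lambda>(e, t). \<alpha> e t) ({-\<epsilon>\<^sub>0<..<\<epsilon>\<^sub>0} \<times> UNIV)"
    "real_analytic_on (\<lambda>(e, t). A e t) ({-\<epsilon>\<^sub>0<..<\<epsilon>\<^sub>0} \<times> UNIV)"
    "\<And>t. \<alpha> 0 t = \<Omega> * t + \<kappa>" "\<And>t. A 0 t = A\<^sub>0"
    "\<And>e t. \<bar>e\<bar> < \<epsilon>\<^sub>0 \<Longrightarrow> \<bar>A e t - A\<^sub>0\<bar> \<le> R"
    "\<And>e t. \<bar>e\<bar> < \<epsilon>\<^sub>0 \<Longrightarrow> (\<alpha> e has_real_derivative
      \<Omega> + \<omega>\<^sub>1 * (A e t - A\<^sub>0) + Re (r (of_real (A e t - A\<^sub>0))) + e * F (\<alpha> e t) (A e t) C t) (at t)"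
    "\<And>e t. \<bar>e\<bar> < \<epsilon>\<^sub>0 \<Longrightarrow> (A e has_real_derivative e * G (\<alpha> e t) (A e t) C t) (at t)"
    "\<And>e t. \<bar>e\<bar> < \<epsilon>\<^sub>0 \<Longrightarrow> \<alpha> e (t + T) = \<alpha> e t + \<Omega> * T"
    "\<And>e t. \<bar>e\<bar> < \<epsilon>\<^sub>0 \<Longrightarrow> A e (t + T) = A e t"
proof -
  obtain u where u: "regular u" and uR: "\<And>x. x \<in> arguments \<Longrightarrow> norm (u x - initial x) \<le> R"
    and fixed: "\<And>x. x \<in> arguments \<Longrightarrow> iterate u x = u x"
    using fixpoint_exists by blast
  define k Y X where "k = (\<lambda>e t. u (0, e, t))" and "Y = (\<lambda>e t. u (1, e, t))" and "X = (\<lambda>e t. u (2, e, t))"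
  have s: "states k Y X"
    using regular_states[OF u uR] by (simp add: k_def Y_def X_def)
  note fam = statesD(1-3)[OF s]
  have fix_eqs: "next_k e (k e) (Y e) (X e) t = k e t" "next_Y e (k e) (Y e) (X e) t = Y e t"
    "next_X e (k e) (Y e) (X e) t = X e t" if "e \<in> ball 0 \<epsilon>\<^sub>0" "t \<in> strip \<sigma>" for e t
    using fixed[of "(0, e, t)"] fixed[of "(1, e, t)"] fixed[of "(2, e, t)"] that
    by (simp_all add: arguments_def iterate_def k_def Y_def X_def)
  have k_const: "k e t = k e 0" if "e \<in> ball 0 \<epsilon>\<^sub>0" "t \<in> strip \<sigma>" for e t
    using u that by (simp add: regular_def k_def)
  have zero: "Y 0 t = 0" "X 0 t = 0" if "t \<in> strip \<sigma>" for t
    using u that by (simp_all add: regular_def Y_def X_def)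
  define v where "v = (\<lambda>e t. complex_of_real \<Omega> * t + k e t + X e t)"
  define w where "w = (\<lambda>e t. complex_of_real A\<^sub>0 + Y e t)"
  define \<alpha> where "\<alpha> = (\<lambda>e t. Re (v (complex_of_real e) (complex_of_real t)))"
  define A where "A = (\<lambda>e t. Re (w (complex_of_real e) (complex_of_real t)))"
  have "sep_holomorphic (ball 0 \<epsilon>\<^sub>0) (strip \<sigma>) v"
    unfolding v_def by (intro sep_holomorphic_add sep_holomorphic_snd periodic_familyD(1)[OF fam(1)] periodic_familyD(1)[OF fam(3)])
      (auto intro!: holomorphic_intros)
  from sep_holomorphic_imp_real_analytic[OF this open_ball open_strip, of "{-\<epsilon>\<^sub>0<..<\<epsilon>\<^sub>0} \<times> UNIV"]
  have an_\<alpha>: "real_analytic_on (\<lambda>(e, t). \<alpha> e t) ({-\<epsilon>\<^sub>0<..<\<epsilon>\<^sub>0} \<times> UNIV)"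
    using of_real_in_strip[OF \<sigma>(1)] unfolding \<alpha>_def by (auto simp: abs_if)
  have "sep_holomorphic (ball 0 \<epsilon>\<^sub>0) (strip \<sigma>) w"
    unfolding w_def by (intro sep_holomorphic_add sep_holomorphic_fst periodic_familyD(1)[OF fam(2)] holomorphic_on_const)
  from sep_holomorphic_imp_real_analytic[OF this open_ball open_strip, of "{-\<epsilon>\<^sub>0<..<\<epsilon>\<^sub>0} \<times> UNIV"]
  have an_A: "real_analytic_on (\<lambda>(e, t). A e t) ({-\<epsilon>\<^sub>0<..<\<epsilon>\<^sub>0} \<times> UNIV)"
    using of_real_in_strip[OF \<sigma>(1)] unfolding A_def by (auto simp: abs_if)
  have main: "\<bar>A e t - A\<^sub>0\<bar> \<le> R \<and>
      (\<alpha> e has_real_derivative \<Omega> + \<omega>\<^sub>1 * (A e t - A\<^sub>0) + Re (r (of_real (A e t - A\<^sub>0))) + e * F (\<alpha> e t) (A e t) C t) (at t) \<and>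
      (A e has_real_derivative e * G (\<alpha> e t) (A e t) C t) (at t) \<and>
      \<alpha> e (t + T) = \<alpha> e t + \<Omega> * T \<and> A e (t + T) = A e t"
    if "\<bar>e\<bar> < \<epsilon>\<^sub>0" for e t
  proof -
    define e' t' where "e' = complex_of_real e" and "t' = complex_of_real t"
    have e': "e' \<in> ball 0 \<epsilon>\<^sub>0" and t': "t' \<in> strip \<sigma>"
      using that of_real_in_strip[OF \<sigma>(1)] by (simp_all add: e'_def t'_def)
    have 0: "(0::complex) \<in> strip \<sigma>" using \<sigma>(1) by (simp add: strip_def)
    note st = statesD(4)[OF s e']
    obtain x y z where xyz: "k e' t' = complex_of_real x" "Y e' t' = complex_of_real y" "X e' t' = complex_of_real z"
      using fam[THEN periodic_familyD(3)] e' unfolding e'_def t'_def by (metis Reals_cases)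
    have \<alpha>: "\<alpha> e t = \<Omega> * t + x + z" and A: "A e t = A\<^sub>0 + y"
      using xyz by (simp_all add: \<alpha>_def A_def v_def w_def e'_def t'_def)
    note eqs = fixpoint_equations[OF st fix_eqs(1)[OF e' 0] fix_eqs(2)[OF e'] fix_eqs(3)[OF e'] t']
    have along: "along EF (k e') (Y e') (X e') t' = of_real (F (\<alpha> e t) (A e t) C t)"
      "along EG (k e') (Y e') (X e') t' = of_real (G (\<alpha> e t) (A e t) C t)"
      unfolding \<alpha> A t'_def
      by (rule along_of_real[OF EF st xyz[unfolded t'_def]] along_of_real[OF EG st xyz[unfolded t'_def]])+
    have y_le: "\<bar>A e t - A\<^sub>0\<bar> \<le> R"
      using dist_initial(2)[OF st t'] by (simp add: A xyz)
    have "(w e' has_field_derivative 0 + e' * along EG (k e') (Y e') (X e') t') (at t')"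
      unfolding w_def by (intro DERIV_add DERIV_const eqs(1))
    from Re_has_real_derivative[OF this[unfolded t'_def]]
    have dA: "(A e has_real_derivative e * G (\<alpha> e t) (A e t) C t) (at t)"
      unfolding t'_def[symmetric] along by (simp add: A_def e'_def)
    have "((\<lambda>t. complex_of_real \<Omega> * t + k e' 0 + X e' t) has_field_derivative
        complex_of_real \<Omega> * 1 + 0 + (forcing e' (k e') (Y e') (X e') t' + of_real \<omega>\<^sub>1 * Y e' t')) (at t')"
      by (intro DERIV_add DERIV_cmult DERIV_ident DERIV_const eqs(2))
    then have "(v e' has_field_derivative
        complex_of_real \<Omega> * 1 + 0 + (forcing e' (k e') (Y e') (X e') t' + of_real \<omega>\<^sub>1 * Y e' t')) (at t')"
      by (rule has_field_derivative_transform_within_open[OF _ open_strip t']) (simp add: v_def k_const[OF e'])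
    from Re_has_real_derivative[OF this[unfolded t'_def]]
    have "(\<alpha> e has_real_derivative Re (complex_of_real \<Omega> * 1 + 0 + (forcing e' (k e') (Y e') (X e') t' + of_real \<omega>\<^sub>1 * Y e' t'))) (at t)"
      unfolding t'_def[symmetric] by (simp add: \<alpha>_def e'_def)
    also have "Re (complex_of_real \<Omega> * 1 + 0 + (forcing e' (k e') (Y e') (X e') t' + of_real \<omega>\<^sub>1 * Y e' t')) =
        \<Omega> + \<omega>\<^sub>1 * (A e t - A\<^sub>0) + Re (r (of_real (A e t - A\<^sub>0))) + e * F (\<alpha> e t) (A e t) C t"
      unfolding forcing_def along xyz by (simp add: A e'_def)
    finally have d\<alpha>: "(\<alpha> e has_real_derivative \<Omega> + \<omega>\<^sub>1 * (A e t - A\<^sub>0) + Re (r (of_real (A e t - A\<^sub>0))) + e * F (\<alpha> e t) (A e t) C t) (at t)" .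
    have "\<alpha> e (t + T) = \<alpha> e t + \<Omega> * T" "A e (t + T) = A e t"
      unfolding \<alpha>_def A_def v_def w_def of_real_add e'_def[symmetric] t'_def[symmetric]
        fam[THEN periodic_familyD(2), OF e' t']
      by (simp_all add: algebra_simps)
    then show ?thesis using y_le d\<alpha> dA by blast
  qed
  have 0: "0 \<in> ball (0::complex) \<epsilon>\<^sub>0" using \<epsilon>\<^sub>0 by simp
  have strip: "complex_of_real t \<in> strip \<sigma>" for t by (rule of_real_in_strip[OF \<sigma>(1)])
  show ?thesis
  proof (rule that[OF an_\<alpha> an_A])
    show "\<alpha> 0 t = \<Omega> * t + Re (k 0 0)" for t
      using k_const[OF 0 strip, of t] zero(2)[OF strip, of t] by (simp add: \<alpha>_def v_def)
    show "A 0 t = A\<^sub>0" for t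
      using zero(1)[OF strip, of t] by (simp add: A_def w_def)
  qed (use main in blast)+
qed

end

section \<open>Consequences of the hypotheses\<close>

lemma real_deriv_of_holomorphic_extension:
  fixes f :: "real \<Rightarrow> real"
  assumes g: "g holomorphic_on ball (of_real x) \<rho>" and "\<rho> > 0"
    and eq: "\<And>y. \<bar>y - x\<bar> < \<rho> \<Longrightarrow> g (of_real y) = of_real (f y)"
  shows "(f has_real_derivative Re (deriv g (of_real x))) (at x)" "Im (deriv g (of_real x)) = 0"
proof -
  have D: "(g has_field_derivative deriv g (of_real x)) (at (of_real x))"
    using \<open>\<rho> > 0\<close> by (intro holomorphic_derivI[OF g open_ball]) simp
  have ball: "open (ball x \<rho>)" "x \<in> ball x \<rho>" using \<open>\<rho> > 0\<close> by auto
  show "(f has_real_derivative Re (deriv g (of_real x))) (at x)"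
    by (rule has_field_derivative_transform_within_open[OF Re_has_real_derivative[OF D] ball])
       (use eq in \<open>simp add: dist_real_def abs_minus_commute\<close>)
  have "((\<lambda>z. - \<i> * g z) has_field_derivative - \<i> * deriv g (of_real x)) (at (of_real x))"
    by (intro DERIV_cmult D)
  then have "((\<lambda>y. Re (- \<i> * g (of_real y))) has_real_derivative Re (- \<i> * deriv g (of_real x))) (at x)"
    by (rule Re_has_real_derivative)
  then have "((\<lambda>y. 0) has_real_derivative Re (- \<i> * deriv g (of_real x))) (at x)"
    by (rule has_field_derivative_transform_within_open[OF _ ball])
       (use eq in \<open>simp add: dist_real_def abs_minus_commute\<close>)
  then show "Im (deriv g (of_real x)) = 0"
    using DERIV_unique[OF _ DERIV_const] by fastforce
qed

text \<open>For a constant function every point is both a minimum and a maximum, and the second derivative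
vanishes there; so the nondegeneracy of the extrema excludes constants.\<close>

lemma nonconstant_periodic_has_nonzero_deriv:
  fixes f :: "real \<Rightarrow> real"
  assumes an: "real_analytic_on f UNIV" and per: "\<forall>t. f (t + 2 * pi) = f t"
    and extrema: "\<forall>t\<^sub>m\<in>{0..<2 * pi}. \<forall>t\<^sub>M\<in>{0..<2 * pi}.
           (\<forall>t\<in>{0..<2 * pi}. f t\<^sub>m \<le> f t \<and> f t \<le> f t\<^sub>M) \<longrightarrow>
           deriv (deriv f) t\<^sub>m * deriv (deriv f) t\<^sub>M \<noteq> 0"
  obtains t where "0 < t" "t < 2 * pi" "deriv f t \<noteq> 0"
proof -
  have "\<exists>t. 0 < t \<and> t < 2 * pi \<and> deriv f t \<noteq> 0"
  proof (rule ccontr)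
    assume "\<not> ?thesis"
    then have d0: "deriv f t = 0" if "0 < t" "t < 2 * pi" for t using that by blast
    have "\<exists>D. (f has_real_derivative D) (at x)" for x
      using real_analytic_on_imp_holomorphic_extension[OF an open_UNIV UNIV_I[of x]] real_deriv_of_holomorphic_extension(1)
      by metis
    then have df: "(f has_real_derivative deriv f x) (at x)" for x
      using DERIV_imp_deriv by metis
    have "f t = f 0" if "0 \<le> t" "t \<le> 2 * pi" for t
    proof (rule DERIV_isconst2[of 0 "2 * pi"])
      show "continuous_on {0..2 * pi} f"
        using df DERIV_isCont by (intro continuous_at_imp_continuous_on) blast
      show "(f has_real_derivative 0) (at x)" if "0 < x" "x < 2 * pi" for x
        using df[of x] d0[OF that] by simp
    qed (use that in auto)
    moreover have "f t = f (t - of_int \<lfloor>t / (2 * pi)\<rfloor> * (2 * pi))" for t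
      using periodic_of_int_mult[of f "2 * pi" "t - of_int \<lfloor>t / (2 * pi)\<rfloor> * (2 * pi)" "\<lfloor>t / (2 * pi)\<rfloor>"] per by simp
    moreover have "0 \<le> t - of_int \<lfloor>t / (2 * pi)\<rfloor> * (2 * pi)" "t - of_int \<lfloor>t / (2 * pi)\<rfloor> * (2 * pi) \<le> 2 * pi" for t
      using floor_divide_lower[of "2 * pi" t] floor_divide_upper[of "2 * pi" t] by (simp_all add: algebra_simps)
    ultimately have const: "f t = f 0" for t by metis
    then have f: "f = (\<lambda>t. f 0)" by (rule ext)
    have "deriv f = (\<lambda>t. 0)" by (subst f) simp
    then have "deriv (deriv f) = (\<lambda>t. 0)" by simp
    moreover have "deriv (deriv f) 0 * deriv (deriv f) 0 \<noteq> 0"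
    proof (rule extrema[rule_format])
      show "f 0 \<le> f t \<and> f t \<le> f 0" for t using const[of t] by simp
    qed simp_all
    ultimately show False by simp
  qed
  then show ?thesis using that by blast
qed

lemma lipschitz_of_deriv_0:
  assumes hol: "f holomorphic_on ball 0 r" and "r > 0" "deriv f 0 = 0" "\<rho> > 0"
  obtains R where "R > 0" "R < r"
    "\<And>y y'. norm y \<le> R \<Longrightarrow> norm y' \<le> R \<Longrightarrow> norm (f y - f y') \<le> \<rho> * norm (y - y')"
proof -
  have "isCont (deriv f) 0"
    using holomorphic_deriv[OF hol open_ball] \<open>r > 0\<close>
    by (meson centre_in_ball continuous_on_eq_continuous_at holomorphic_on_imp_continuous_on open_ball)
  then obtain d where d: "d > 0" "\<And>x. dist x 0 < d \<Longrightarrow> dist (deriv f x) (deriv f 0) < \<rho>"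
    unfolding continuous_at_eps_delta using \<open>\<rho> > 0\<close> by blast
  define R where "R = min d r / 2"
  have R: "R > 0" "R < r" "R < d" using d(1) \<open>r > 0\<close> unfolding R_def by linarith+
  have lip: "norm (f y - f y') \<le> \<rho> * norm (y - y')" if "norm y \<le> R" "norm y' \<le> R" for y y'
  proof (rule field_differentiable_bound[of "cball 0 R" f "deriv f"])
    fix z :: complex assume "z \<in> cball 0 R"
    then have "z \<in> ball 0 r" using R by simp
    then show "(f has_field_derivative deriv f z) (at z within cball 0 R)"
      by (rule has_field_derivative_at_within[OF holomorphic_derivI[OF hol open_ball]])
    show "norm (deriv f z) \<le> \<rho>"
      using d(2)[of z] \<open>z \<in> cball 0 R\<close> R \<open>deriv f 0 = 0\<close> by simp
  qed (use that in auto)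
  show ?thesis by (rule that[OF R(1,2) lip])
qed

text \<open>The part of \<open>\<omega>\<close> of order two at \<open>A\<^sub>0\<close>, as a holomorphic function.\<close>

lemma remainder_exists:
  fixes \<omega> :: "real \<Rightarrow> real"
  assumes an: "real_analytic_on \<omega> W" "open W" "A\<^sub>0 \<in> W"
  obtains d r where "d > 0" "r holomorphic_on ball 0 d" "r 0 = 0" "deriv r 0 = 0"
    "\<And>y. \<bar>y\<bar> < d \<Longrightarrow> A\<^sub>0 + y \<in> W \<and>
      r (of_real y) = of_real (\<omega> (A\<^sub>0 + y) - \<omega> A\<^sub>0 - deriv \<omega> A\<^sub>0 * y)"
proof -
  obtain d g where d: "d > 0" and g: "g holomorphic_on ball (of_real A\<^sub>0) d"
    and eq: "\<And>y. \<bar>y - A\<^sub>0\<bar> < d \<Longrightarrow> y \<in> W \<and> g (of_real y) = of_real (\<omega> y)"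
    using real_analytic_on_imp_holomorphic_extension[OF an] by metis
  note rd = real_deriv_of_holomorphic_extension[OF g d, of \<omega>]
  have D: "deriv g (of_real A\<^sub>0) = of_real (deriv \<omega> A\<^sub>0)"
    using rd eq DERIV_imp_deriv by (metis complex_eq_iff Im_complex_of_real Re_complex_of_real)
  define r where "r = (\<lambda>y. g (of_real A\<^sub>0 + y) - of_real (\<omega> A\<^sub>0) - of_real (deriv \<omega> A\<^sub>0) * y)"
  have "(\<lambda>y. complex_of_real A\<^sub>0 + y) holomorphic_on ball 0 d" by (intro holomorphic_intros)
  from holomorphic_on_compose_gen[OF this g]
  have shift: "(\<lambda>y. g (of_real A\<^sub>0 + y)) holomorphic_on ball 0 d"
    by (simp add: o_def image_subset_iff dist_norm)
  have hol: "r holomorphic_on ball 0 d"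
    unfolding r_def by (intro holomorphic_intros shift)
  have "(g has_field_derivative deriv g (of_real A\<^sub>0)) (at (0 + of_real A\<^sub>0))"
    using holomorphic_derivI[OF g open_ball, of "of_real A\<^sub>0"] d by simp
  then have "((\<lambda>y. g (of_real A\<^sub>0 + y)) has_field_derivative deriv g (of_real A\<^sub>0)) (at 0)"
    unfolding DERIV_shift by (simp only: add.commute)
  then have "(r has_field_derivative deriv g (of_real A\<^sub>0) - 0 - of_real (deriv \<omega> A\<^sub>0) * 1) (at 0)"
    unfolding r_def by (intro DERIV_diff DERIV_const DERIV_cmult DERIV_ident)
  then have dr: "deriv r 0 = 0"
    by (simp add: D DERIV_imp_deriv)
  have r0: "r 0 = 0"
    using eq[of A\<^sub>0] d by (simp add: r_def)
  have r_eq: "A\<^sub>0 + y \<in> W \<and> r (of_real y) = of_real (\<omega> (A\<^sub>0 + y) - \<omega> A\<^sub>0 - deriv \<omega> A\<^sub>0 * y)" if "\<bar>y\<bar> < d" for y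
    using eq[of "A\<^sub>0 + y"] that by (simp add: r_def)
  show ?thesis by (rule that[OF d hol r0 dr r_eq])
qed

text \<open>The integral of a periodic function over a period does not depend on where the period starts.\<close>

lemma has_integral_shifted_period:
  assumes g: "g holomorphic_on strip \<sigma>" and per: "\<And>t. t \<in> strip \<sigma> \<Longrightarrow> g (t + of_real T) = g t"
    and "\<sigma> > 0" "T > 0"
  shows "((\<lambda>s. g (of_real (s + t\<^sub>0))) has_integral of_real T * mean T g) {0..T}"
proof -
  have "((\<lambda>s. primitive0 g (of_real (s + t\<^sub>0))) has_vector_derivative g (of_real (s + t\<^sub>0))) (at s within {0..T})" for s
  proof -
    have "(primitive0 g has_field_derivative g (of_real s + of_real t\<^sub>0)) (at (of_real s + of_real t\<^sub>0))"
      by (rule primitive0_has_derivative[OF g]) (simp add: add_of_real_in_strip of_real_in_strip \<open>\<sigma> > 0\<close>)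
    then have "((\<lambda>x. primitive0 g (x + of_real t\<^sub>0)) has_field_derivative g (of_real s + of_real t\<^sub>0)) (at (of_real s))"
      by (simp add: DERIV_shift)
    from has_vector_derivative_real_field[OF this] show ?thesis
      by (simp add: has_vector_derivative_at_within)
  qed
  then have "((\<lambda>s. g (of_real (s + t\<^sub>0))) has_integral
      (primitive0 g (of_real (T + t\<^sub>0)) - primitive0 g (of_real (0 + t\<^sub>0)))) {0..T}"
    using \<open>T > 0\<close> by (intro fundamental_theorem_of_calculus) auto
  also have "primitive0 g (of_real (T + t\<^sub>0)) - primitive0 g (of_real (0 + t\<^sub>0)) = of_real T * mean T g"
    using osc_primitive_periodic[OF g per \<open>\<sigma> > 0\<close> of_real_in_strip[OF \<open>\<sigma> > 0\<close>], of t\<^sub>0]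
    by (simp add: osc_primitive_def algebra_simps)
  finally show ?thesis .
qed

section \<open>The Melnikov function and its derivative in the phase\<close>

text \<open>In terms of the phase \<open>k = - \<Omega> t\<^sub>0\<close> instead of the time shift \<open>t\<^sub>0\<close>: the shift is moved from the
explicit time to the angle, so that the time in the system stays fixed.\<close>

definition complex_Melnikov ::
    "(complex \<Rightarrow> complex \<Rightarrow> complex \<Rightarrow> complex \<Rightarrow> complex) \<Rightarrow> real \<Rightarrow> real \<Rightarrow> real \<Rightarrow> complex \<Rightarrow> complex \<Rightarrow> complex"
  where "complex_Melnikov E \<Omega> A\<^sub>0 T k C = mean T (\<lambda>t. E (of_real \<Omega> * t + k) (of_real A\<^sub>0) C t)"

context
  fixes G :: "real \<Rightarrow> real \<Rightarrow> real \<Rightarrow> real \<Rightarrow> real" and E :: "complex \<Rightarrow> complex \<Rightarrow> complex \<Rightarrow> complex \<Rightarrow> complex"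
    and A\<^sub>0 C\<^sub>1 \<delta> B \<Omega> :: real and p q :: int
  assumes E: "complex_extension G A\<^sub>0 C\<^sub>1 \<delta> B E" and \<delta>: "\<delta> > 0"
    and resonance: "\<Omega> = of_int p / of_int q" "q \<ge> 1"
begin

private definition "S = strip (\<delta> / (8 * (\<bar>\<Omega>\<bar> + 1)))"
private definition "T = 2 * pi * of_int q"
private abbreviation "M \<equiv> complex_Melnikov E \<Omega> A\<^sub>0 (2 * pi * of_int q)"

private lemma width: "\<delta> / (8 * (\<bar>\<Omega>\<bar> + 1)) > 0"
  using \<delta> by (simp add: add_nonneg_pos)

private lemma near:
  assumes "t \<in> S" "8 * \<bar>Im k\<bar> \<le> \<delta>" "norm (C - of_real C\<^sub>1) < \<delta>'" "\<delta> / 4 \<le> \<delta>'"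
  shows "near_torus A\<^sub>0 C\<^sub>1 \<delta>' (of_real \<Omega> * t + k) (of_real A\<^sub>0) C t"
proof -
  have "8 * (\<bar>\<Omega>\<bar> + 1) * \<bar>Im t\<bar> < \<delta>"
    using assms(1) by (simp add: S_def strip_def field_simps pos_less_divide_eq add_nonneg_pos)
  then have "8 * (\<bar>\<Omega>\<bar> * \<bar>Im t\<bar>) + 8 * \<bar>Im t\<bar> < \<delta>" by (simp add: algebra_simps)
  moreover have "0 \<le> \<bar>\<Omega>\<bar> * \<bar>Im t\<bar>" by simp
  moreover have "\<bar>Im (of_real \<Omega> * t)\<bar> = \<bar>\<Omega>\<bar> * \<bar>Im t\<bar>" by (simp add: abs_mult)
  ultimately have "8 * \<bar>Im (of_real \<Omega> * t)\<bar> < \<delta>" "8 * \<bar>Im t\<bar> < \<delta>" by linarith+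
  then have "\<bar>Im (of_real \<Omega> * t + k)\<bar> < \<delta>'" "\<bar>Im t\<bar> < \<delta>'"
    using assms(2,4) \<delta> unfolding plus_complex.sel by linarith+
  then show ?thesis using assms(3,4) \<delta> by (simp add: near_torus_def)
qed

private lemma integrand_holomorphic:
  assumes "8 * \<bar>Im k\<bar> \<le> \<delta>" "norm (C - of_real C\<^sub>1) < \<delta>"
  shows "(\<lambda>t. E (of_real \<Omega> * t + k) (of_real A\<^sub>0) C t) holomorphic_on S"
  unfolding S_def
  by (rule complex_extensionD(1)[OF E open_strip])
     (use assms \<delta> in \<open>auto intro!: near[unfolded S_def] holomorphic_intros\<close>)

private lemma melnikov_integral:
  assumes "\<bar>C - C\<^sub>1\<bar> < \<delta>"
  shows "M (of_real (- \<Omega> * t\<^sub>0)) (of_real C) =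
    of_real (1 / T * integral {0..T} (\<lambda>t. G (\<Omega> * t) A\<^sub>0 C (t + t\<^sub>0)))"
proof -
  have T: "T > 0" using resonance by (simp add: T_def)
  define g where "g = (\<lambda>t. E (of_real \<Omega> * t + of_real (- \<Omega> * t\<^sub>0)) (of_real A\<^sub>0) (of_real C) t)"
  have C: "norm (complex_of_real C - of_real C\<^sub>1) < \<delta>" using assms by (simp flip: of_real_diff)
  have g: "g holomorphic_on S"
    unfolding g_def by (rule integrand_holomorphic) (use \<delta> C in auto)
  have per: "g (t + of_real T) = g t" if "t \<in> S" for t
  proof -
    have "\<Omega> * T = of_int p * (2 * pi)" "T = of_int q * (2 * pi)"
      using resonance by (auto simp: T_def)
    then have 1: "complex_of_real \<Omega> * of_real T = of_int p * (2 * of_real pi)" and 2: "complex_of_real T = of_int q * (2 * of_real pi)"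
      by (metis of_real_mult of_real_of_int_eq of_real_numeral)+
    have "of_real \<Omega> * (t + of_real T) + of_real (- \<Omega> * t\<^sub>0) = of_real \<Omega> * t + of_real (- \<Omega> * t\<^sub>0) + of_real \<Omega> * of_real T"
      by (simp add: distrib_left)
    then have "g (t + of_real T) = E (of_real \<Omega> * t + of_real (- \<Omega> * t\<^sub>0) + of_int p * (2 * of_real pi)) (of_real A\<^sub>0) (of_real C)
        (t + of_int q * (2 * of_real pi))"
      unfolding g_def 1 by (simp only: 2)
    also have "\<dots> = g t"
      unfolding g_def by (rule complex_extension_periodic[OF E near]) (use that \<delta> C in auto)
    finally show ?thesis .
  qed
  have real: "g (of_real (s + t\<^sub>0)) = of_real (G (\<Omega> * s) A\<^sub>0 C (s + t\<^sub>0))" for s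
    using complex_extensionD(5)[OF E, of A\<^sub>0 C "\<Omega> * s" "s + t\<^sub>0"] assms \<delta> by (simp add: g_def algebra_simps)
  have "((\<lambda>s. g (of_real (s + t\<^sub>0))) has_integral of_real T * mean T g) {0..T}"
    by (rule has_integral_shifted_period[OF g[unfolded S_def] per[unfolded S_def] width T])
  then have int: "((\<lambda>s. complex_of_real (G (\<Omega> * s) A\<^sub>0 C (s + t\<^sub>0))) has_integral of_real T * mean T g) {0..T}"
    by (simp only: real)
  from has_integral_linear[OF int bounded_linear_Re]
  have "((\<lambda>s. G (\<Omega> * s) A\<^sub>0 C (s + t\<^sub>0)) has_integral Re (of_real T * mean T g)) {0..T}"
    by (simp add: o_def)
  then have *: "integral {0..T} (\<lambda>s. G (\<Omega> * s) A\<^sub>0 C (s + t\<^sub>0)) = T * Re (mean T g)"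
    by (simp add: integral_unique)
  from has_integral_linear[OF int bounded_linear_Im]
  have "((\<lambda>s. 0) has_integral Im (of_real T * mean T g)) {0..T}"
    by (simp add: o_def)
  then have "Im (mean T g) = 0"
    using has_integral_unique[OF _ has_integral_0] T by fastforce
  then show ?thesis
    unfolding complex_Melnikov_def T_def[symmetric] g_def[symmetric] * using T by (simp add: complex_eq_iff)
qed

lemma complex_Melnikov_eq:
  assumes "\<bar>C - C\<^sub>1\<bar> < \<delta>" "\<omega> A\<^sub>0 = \<Omega>"
  shows "M (of_real (- \<Omega> * t\<^sub>0)) (of_real C) =
    of_real (subharmonic_Melnikov \<omega> G A\<^sub>0 q t\<^sub>0 C)"
  using melnikov_integral[OF assms(1)] unfolding subharmonic_Melnikov_def T_def by (simp add: assms(2) Let_def)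

lemma complex_Melnikov_holomorphic_k:
  "(\<lambda>s. M (of_real k + s) (of_real C\<^sub>1)) holomorphic_on ball 0 (\<delta> / 8)"
proof -
  have im: "8 * \<bar>Im (of_real k + s)\<bar> \<le> \<delta>" if "s \<in> ball 0 (\<delta> / 8)" for s
    using that abs_Im_le_cmod[of s] by simp
  have "sep_holomorphic (ball 0 (\<delta> / 8)) (strip (\<delta> / (8 * (\<bar>\<Omega>\<bar> + 1))))
      (\<lambda>s t. E (of_real \<Omega> * t + (of_real k + s)) (of_real A\<^sub>0) (of_real C\<^sub>1) t)"
  proof (rule sep_holomorphicI_bounded[OF open_ball open_strip])
    fix t assume t: "t \<in> strip (\<delta> / (8 * (\<bar>\<Omega>\<bar> + 1)))"
    show "(\<lambda>s. E (of_real \<Omega> * t + (of_real k + s)) (of_real A\<^sub>0) (of_real C\<^sub>1) t) holomorphic_on ball 0 (\<delta> / 8)"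
      by (rule complex_extensionD(1)[OF E open_ball])
         (use t im \<delta> in \<open>auto intro!: near[unfolded S_def] holomorphic_intros simp del: plus_complex.sel\<close>)
  next
    fix s :: complex assume s: "s \<in> ball 0 (\<delta> / 8)"
    show "(\<lambda>t. E (of_real \<Omega> * t + (of_real k + s)) (of_real A\<^sub>0) (of_real C\<^sub>1) t) holomorphic_on strip (\<delta> / (8 * (\<bar>\<Omega>\<bar> + 1)))"
      by (rule integrand_holomorphic[unfolded S_def]) (use im[OF s] \<delta> in auto)
    fix t assume "t \<in> strip (\<delta> / (8 * (\<bar>\<Omega>\<bar> + 1)))"
    then show "norm (E (of_real \<Omega> * t + (of_real k + s)) (of_real A\<^sub>0) (of_real C\<^sub>1) t) \<le> B"
      by (intro complex_extensionD(2)[OF E] near[unfolded S_def]) (use im[OF s] \<delta> in auto)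
  qed
  from sep_holomorphic_mean[OF this open_ball convex_ball width] show ?thesis
    by (simp add: complex_Melnikov_def)
qed

lemma complex_Melnikov_holomorphic_C:
  "(\<lambda>C. M (of_real k) C) holomorphic_on ball (of_real C\<^sub>1) \<delta>"
proof -
  have "sep_holomorphic (ball (of_real C\<^sub>1) \<delta>) (strip (\<delta> / (8 * (\<bar>\<Omega>\<bar> + 1))))
      (\<lambda>C t. E (of_real \<Omega> * t + of_real k) (of_real A\<^sub>0) C t)"
  proof (rule sep_holomorphicI_bounded[OF open_ball open_strip])
    fix t assume t: "t \<in> strip (\<delta> / (8 * (\<bar>\<Omega>\<bar> + 1)))"
    show "(\<lambda>C. E (of_real \<Omega> * t + of_real k) (of_real A\<^sub>0) C t) holomorphic_on ball (of_real C\<^sub>1) \<delta>"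
      by (rule complex_extensionD(1)[OF E open_ball])
         (use t \<delta> in \<open>auto intro!: near[unfolded S_def] holomorphic_intros simp: dist_norm norm_minus_commute\<close>)
  next
    fix C assume C: "C \<in> ball (complex_of_real C\<^sub>1) \<delta>"
    show "(\<lambda>t. E (of_real \<Omega> * t + of_real k) (of_real A\<^sub>0) C t) holomorphic_on strip (\<delta> / (8 * (\<bar>\<Omega>\<bar> + 1)))"
      by (rule integrand_holomorphic[unfolded S_def]) (use C \<delta> in \<open>auto simp: dist_norm norm_minus_commute\<close>)
    fix t assume "t \<in> strip (\<delta> / (8 * (\<bar>\<Omega>\<bar> + 1)))"
    then show "norm (E (of_real \<Omega> * t + of_real k) (of_real A\<^sub>0) C t) \<le> B"
      by (intro complex_extensionD(2)[OF E] near[unfolded S_def]) (use C \<delta> in \<open>auto simp: dist_norm norm_minus_commute\<close>)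
  qed
  from sep_holomorphic_mean[OF this open_ball convex_ball width] show ?thesis
    by (simp add: complex_Melnikov_def)
qed

text \<open>The chain rule for the Melnikov function along a curve needs that the increment in the phase
depends little on the parameter; this is the quantitative form.\<close>

lemma complex_Melnikov_mixed_difference:
  assumes s: "norm s < \<delta> / 8" and C: "norm (C - of_real C\<^sub>1) < \<delta> / 4"
  shows "norm ((M (of_real k + s) C - M (of_real k) C) -
      (M (of_real k + s) (of_real C\<^sub>1) - M (of_real k) (of_real C\<^sub>1)))
    \<le> 64 * B / \<delta>\<^sup>2 * norm (C - of_real C\<^sub>1) * norm s"
proof -
  have im: "8 * \<bar>Im (of_real k + s)\<bar> \<le> \<delta>"
    using s abs_Im_le_cmod[of s] by simp
  let ?e = "\<lambda>k C t. E (of_real \<Omega> * t + k) (of_real A\<^sub>0) C t"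
  have hol: "?e (of_real k + s) C holomorphic_on S" "?e (of_real k) C holomorphic_on S"
    "?e (of_real k + s) (of_real C\<^sub>1) holomorphic_on S" "?e (of_real k) (of_real C\<^sub>1) holomorphic_on S"
    using im C \<delta> by (auto intro!: integrand_holomorphic simp del: plus_complex.sel)
  note hol' = hol[unfolded S_def]
  have "norm (mean T (\<lambda>t. (?e (of_real k + s) C t - ?e (of_real k) C t) -
      (?e (of_real k + s) (of_real C\<^sub>1) t - ?e (of_real k) (of_real C\<^sub>1) t))) \<le> 64 * B / \<delta>\<^sup>2 * norm (C - of_real C\<^sub>1) * norm s"
  proof (rule norm_mean_le[OF _ width])
    fix t assume t: "t \<in> strip (\<delta> / (8 * (\<bar>\<Omega>\<bar> + 1)))"
    show "norm ((?e (of_real k + s) C t - ?e (of_real k) C t) -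
      (?e (of_real k + s) (of_real C\<^sub>1) t - ?e (of_real k) (of_real C\<^sub>1) t)) \<le> 64 * B / \<delta>\<^sup>2 * norm (C - of_real C\<^sub>1) * norm s"
      using complex_extension_second_difference[OF E \<delta> near near s, of t "of_real k" C t "of_real k" "of_real C\<^sub>1"] t C \<delta>
      by (simp add: S_def add.assoc)
  qed (intro holomorphic_intros hol')
  then show ?thesis
    unfolding complex_Melnikov_def T_def[symmetric]
      mean_diff[OF holomorphic_on_diff[OF hol'(1,2)] holomorphic_on_diff[OF hol'(3,4)] width]
      mean_diff[OF hol'(1,2) width] mean_diff[OF hol'(3,4) width] .
qed

end

text \<open>Differentiating \<open>M (t, C\<^sub>0 t) = 0\<close> at \<open>t\<^sub>1\<close> gives \<open>- \<Omega> \<mu> + \<nu> C\<^sub>0' = 0\<close>, where \<open>\<mu>\<close> and \<open>\<nu>\<close> are the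
derivatives of the Melnikov function in the phase and in the parameter. As \<open>\<nu>\<close> and \<open>C\<^sub>0' t\<^sub>1\<close> do not
vanish, neither does \<open>\<mu>\<close>.\<close>

lemma Melnikov_phase_derivative_nonzero:
  fixes C\<^sub>0 :: "real \<Rightarrow> real"
  assumes E: "complex_extension G A\<^sub>0 (C\<^sub>0 t\<^sub>1) \<delta> B E" and \<delta>: "\<delta> > 0"
    and resonance: "\<Omega> = of_int p / of_int q" "q \<ge> 1" and "\<Omega> \<noteq> 0" and \<omega>: "\<omega> A\<^sub>0 = \<Omega>"
    and an: "real_analytic_on C\<^sub>0 UNIV" and t\<^sub>1: "0 < t\<^sub>1" "t\<^sub>1 < 2 * pi" and dC: "deriv C\<^sub>0 t\<^sub>1 \<noteq> 0"
    and zero: "\<And>t. 0 \<le> t \<Longrightarrow> t < 2 * pi \<Longrightarrow> subharmonic_Melnikov \<omega> G A\<^sub>0 q t (C\<^sub>0 t) = 0"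
    and dM: "deriv (\<lambda>C. subharmonic_Melnikov \<omega> G A\<^sub>0 q t\<^sub>1 C) (C\<^sub>0 t\<^sub>1) \<noteq> 0"
  obtains \<mu> :: real where "\<mu> \<noteq> 0"
    "((\<lambda>s. complex_Melnikov E \<Omega> A\<^sub>0 (2 * pi * of_int q) (of_real (- \<Omega> * t\<^sub>1) + s) (of_real (C\<^sub>0 t\<^sub>1)))
      has_field_derivative of_real \<mu>) (at 0)"
proof -
  define m where "m = complex_Melnikov E \<Omega> A\<^sub>0 (2 * pi * of_int q)"
  define k\<^sub>0 where "k\<^sub>0 = - \<Omega> * t\<^sub>1"
  define C\<^sub>1 where "C\<^sub>1 = C\<^sub>0 t\<^sub>1"
  note E' = E[folded C\<^sub>1_def]
  have m_real: "m (of_real (- \<Omega> * t)) (of_real C) = of_real (subharmonic_Melnikov \<omega> G A\<^sub>0 q t C)"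
    if "\<bar>C - C\<^sub>1\<bar> < \<delta>" for t C
    unfolding m_def by (rule complex_Melnikov_eq[where \<omega> = \<omega>, OF E' \<delta> resonance that \<omega>])
  obtain d g where d: "d > 0" and g: "g holomorphic_on ball (of_real t\<^sub>1) d"
    and g_eq: "\<And>y. \<bar>y - t\<^sub>1\<bar> < d \<Longrightarrow> g (of_real y) = of_real (C\<^sub>0 y)"
    using real_analytic_on_imp_holomorphic_extension[OF an open_UNIV UNIV_I[of t\<^sub>1]] by metis
  have g1: "g (of_real t\<^sub>1) = of_real C\<^sub>1" using g_eq[of t\<^sub>1] d by (simp add: C\<^sub>1_def)
  define c' where "c' = deriv g (of_real t\<^sub>1)"
  have "Re c' = deriv C\<^sub>0 t\<^sub>1"
    unfolding c'_def using real_deriv_of_holomorphic_extension(1)[OF g d g_eq] DERIV_imp_deriv by metis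
  then have "c' \<noteq> 0" using dC by auto
  have Dg: "((\<lambda>s. g (of_real t\<^sub>1 + s)) has_field_derivative c') (at 0)"
  proof -
    have "(g has_field_derivative c') (at (0 + of_real t\<^sub>1))"
      unfolding c'_def using holomorphic_derivI[OF g open_ball, of "of_real t\<^sub>1"] d by simp
    then show ?thesis unfolding DERIV_shift by (simp only: add.commute)
  qed
  define \<nu> where "\<nu> = deriv (m (of_real k\<^sub>0)) (of_real C\<^sub>1)"
  have hol_C: "m (of_real k\<^sub>0) holomorphic_on ball (of_real C\<^sub>1) \<delta>"
    unfolding m_def by (rule complex_Melnikov_holomorphic_C[OF E' \<delta> resonance])
  have "((\<lambda>C. subharmonic_Melnikov \<omega> G A\<^sub>0 q t\<^sub>1 C) has_real_derivative Re \<nu>) (at C\<^sub>1)"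
    unfolding \<nu>_def by (rule real_deriv_of_holomorphic_extension(1)[OF hol_C \<delta>])
      (use m_real[of _ t\<^sub>1] in \<open>simp add: k\<^sub>0_def\<close>)
  then have "Re \<nu> \<noteq> 0" using dM DERIV_imp_deriv by (metis C\<^sub>1_def)
  then have "\<nu> \<noteq> 0" by auto
  have D\<nu>: "(m (of_real k\<^sub>0) has_field_derivative \<nu>) (at (of_real C\<^sub>1))"
    unfolding \<nu>_def using \<delta> by (intro holomorphic_derivI[OF hol_C open_ball]) simp
  define \<mu>c where "\<mu>c = deriv (\<lambda>s. m (of_real k\<^sub>0 + s) (of_real C\<^sub>1)) 0"
  have hol_k: "(\<lambda>s. m (of_real k\<^sub>0 + s) (of_real C\<^sub>1)) holomorphic_on ball 0 (\<delta> / 8)"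
    unfolding m_def by (rule complex_Melnikov_holomorphic_k[OF E' \<delta> resonance])
  have D\<mu>: "((\<lambda>s. m (of_real k\<^sub>0 + s) (of_real C\<^sub>1)) has_field_derivative \<mu>c) (at 0)"
    unfolding \<mu>c_def using \<delta> by (intro holomorphic_derivI[OF hol_k open_ball]) simp
  have "Im \<mu>c = 0"
  proof -
    have "Im (deriv (\<lambda>s. m (of_real k\<^sub>0 + s) (of_real C\<^sub>1)) (of_real 0)) = 0"
    proof (rule real_deriv_of_holomorphic_extension(2))
      show "(\<lambda>s. m (of_real k\<^sub>0 + s) (of_real C\<^sub>1)) holomorphic_on ball (of_real 0) (\<delta> / 8)"
        using hol_k by simp
      fix y :: real
      have "complex_of_real k\<^sub>0 + of_real y = of_real (- \<Omega> * (t\<^sub>1 - y / \<Omega>))"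
        using \<open>\<Omega> \<noteq> 0\<close> by (simp add: k\<^sub>0_def algebra_simps flip: of_real_add)
      then show "m (of_real k\<^sub>0 + of_real y) (of_real C\<^sub>1) = of_real (subharmonic_Melnikov \<omega> G A\<^sub>0 q (t\<^sub>1 - y / \<Omega>) C\<^sub>1)"
        using m_real[of C\<^sub>1 "t\<^sub>1 - y / \<Omega>"] \<delta> by simp
    qed (use \<delta> in simp)
    then show ?thesis by (simp add: \<mu>c_def)
  qed
  \<comment> \<open>the mixed increment, whose derivative at the origin vanishes\<close>
  define t1 where "t1 = (\<lambda>s. (m (of_real k\<^sub>0 + - of_real \<Omega> * s) (g (of_real t\<^sub>1 + s)) - m (of_real k\<^sub>0) (g (of_real t\<^sub>1 + s))) -
    (m (of_real k\<^sub>0 + - of_real \<Omega> * s) (of_real C\<^sub>1) - m (of_real k\<^sub>0) (of_real C\<^sub>1)))"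
  have g_lim: "((\<lambda>s. g (of_real t\<^sub>1 + s)) \<longlongrightarrow> of_real C\<^sub>1) (at 0)"
    using DERIV_isCont[OF Dg] g1 by (simp add: isCont_def)
  have "(t1 has_field_derivative 0) (at 0)"
    unfolding has_field_derivative_iff
  proof (rule Lim_null_comparison)
    have "((\<lambda>s. norm (g (of_real t\<^sub>1 + s) - of_real C\<^sub>1)) \<longlongrightarrow> 0) (at 0)"
      using tendsto_norm[OF tendsto_diff[OF g_lim tendsto_const[of "of_real C\<^sub>1"]]] by simp
    then have ev1: "eventually (\<lambda>s. norm (g (of_real t\<^sub>1 + s) - of_real C\<^sub>1) < \<delta> / 4) (at 0)"
      using \<delta> by (intro order_tendstoD) auto
    have "((\<lambda>s::complex. norm (- of_real \<Omega> * s)) \<longlongrightarrow> 0) (at 0)"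
      by (auto intro!: tendsto_eq_intros)
    then have ev2: "eventually (\<lambda>s::complex. norm (- of_real \<Omega> * s) < \<delta> / 8) (at 0)"
      using \<delta> by (intro order_tendstoD) auto
    have ev3: "eventually (\<lambda>s::complex. s \<noteq> 0) (at 0)"
      by (simp add: eventually_at_filter)
    show "eventually (\<lambda>s. norm ((t1 s - t1 0) / (s - 0)) \<le> 64 * B / \<delta>\<^sup>2 * norm (g (of_real t\<^sub>1 + s) - of_real C\<^sub>1) * \<bar>\<Omega>\<bar>) (at 0)"
      using ev1 ev2 ev3
    proof eventually_elim
      case (elim s)
      have "t1 0 = 0" by (simp add: t1_def)
      have "norm (t1 s) \<le> 64 * B / \<delta>\<^sup>2 * norm (g (of_real t\<^sub>1 + s) - of_real C\<^sub>1) * norm (- of_real \<Omega> * s)"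
        unfolding t1_def m_def by (rule complex_Melnikov_mixed_difference[OF E' \<delta> resonance elim(2) elim(1)])
      then show ?case
        using elim(3) by (simp add: \<open>t1 0 = 0\<close> norm_divide norm_mult divide_le_eq)
    qed
    show "((\<lambda>s. 64 * B / \<delta>\<^sup>2 * norm (g (of_real t\<^sub>1 + s) - of_real C\<^sub>1) * \<bar>\<Omega>\<bar>) \<longlongrightarrow> 0) (at 0)"
      by (rule tendsto_eq_intros g_lim refl | simp)+
  qed
  moreover have "((\<lambda>s. m (of_real k\<^sub>0 + - of_real \<Omega> * s) (of_real C\<^sub>1)) has_field_derivative \<mu>c * (- of_real \<Omega>)) (at 0)"
  proof (rule DERIV_chain'[where f = "\<lambda>s. - of_real \<Omega> * s" and g = "\<lambda>s. m (of_real k\<^sub>0 + s) (of_real C\<^sub>1)"])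
    show "((\<lambda>s. - of_real \<Omega> * s) has_field_derivative - complex_of_real \<Omega>) (at 0)"
      by (rule DERIV_cmult_Id)
  qed (use D\<mu> in simp)
  moreover have "((\<lambda>s. m (of_real k\<^sub>0) (g (of_real t\<^sub>1 + s))) has_field_derivative \<nu> * c') (at 0)"
    by (rule DERIV_chain'[OF Dg]) (simp add: g1 D\<nu>)
  ultimately have "((\<lambda>s. t1 s + m (of_real k\<^sub>0 + - of_real \<Omega> * s) (of_real C\<^sub>1) + m (of_real k\<^sub>0) (g (of_real t\<^sub>1 + s)) - m (of_real k\<^sub>0) (of_real C\<^sub>1))
      has_field_derivative 0 + \<mu>c * (- of_real \<Omega>) + \<nu> * c' - 0) (at 0)"
    by (intro DERIV_add DERIV_diff DERIV_const)
  then have "((\<lambda>s. m (of_real k\<^sub>0 + - of_real \<Omega> * s) (g (of_real t\<^sub>1 + s))) has_field_derivative \<nu> * c' - \<mu>c * of_real \<Omega>) (at (of_real 0))"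
    by (simp add: t1_def algebra_simps)
  from has_vector_derivative_real_field[OF this]
  have D: "((\<lambda>h. m (of_real k\<^sub>0 + - of_real \<Omega> * of_real h) (g (of_real t\<^sub>1 + of_real h))) has_vector_derivative \<nu> * c' - \<mu>c * of_real \<Omega>) (at 0)" .
  have ev: "eventually (\<lambda>h. m (of_real k\<^sub>0 + - of_real \<Omega> * of_real h) (g (of_real t\<^sub>1 + of_real h)) = 0) (nhds 0)"
  proof -
    have "isCont C\<^sub>0 t\<^sub>1"
      using real_deriv_of_holomorphic_extension(1)[OF g d g_eq] DERIV_isCont by blast
    then have "((\<lambda>h. C\<^sub>0 (t\<^sub>1 + h)) \<longlongrightarrow> C\<^sub>0 (t\<^sub>1 + 0)) (nhds 0)"
      by (intro isCont_tendsto_compose[of _ C\<^sub>0] tendsto_intros) (simp_all add: filterlim_ident)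
    then have "((\<lambda>h. \<bar>C\<^sub>0 (t\<^sub>1 + h) - C\<^sub>1\<bar>) \<longlongrightarrow> \<bar>C\<^sub>0 (t\<^sub>1 + 0) - C\<^sub>1\<bar>) (nhds 0)"
      by (intro tendsto_intros)
    then have e1: "eventually (\<lambda>h. \<bar>C\<^sub>0 (t\<^sub>1 + h) - C\<^sub>1\<bar> < \<delta>) (nhds 0)"
      by (rule order_tendstoD) (use \<delta> in \<open>simp add: C\<^sub>1_def\<close>)
    have e2: "eventually (\<lambda>h. h \<in> ball 0 (min d (min t\<^sub>1 (2 * pi - t\<^sub>1)))) (nhds (0::real))"
      by (rule eventually_nhds_in_open) (use d t\<^sub>1 in auto)
    show ?thesis using e1 e2
    proof eventually_elim
      case (elim h)
      have h: "\<bar>h\<bar> < d" "0 < t\<^sub>1 + h" "t\<^sub>1 + h < 2 * pi" using elim(2) by auto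
      have "g (of_real (t\<^sub>1 + h)) = of_real (C\<^sub>0 (t\<^sub>1 + h))" using h by (intro g_eq) simp
      moreover have "complex_of_real k\<^sub>0 + - of_real \<Omega> * of_real h = of_real (- \<Omega> * (t\<^sub>1 + h))"
        by (simp add: k\<^sub>0_def algebra_simps)
      ultimately show ?case
        using m_real[OF elim(1), of "t\<^sub>1 + h"] zero[of "t\<^sub>1 + h"] h by simp
    qed
  qed
  obtain N where N: "open N" "(0::real) \<in> N"
    "\<And>h. h \<in> N \<Longrightarrow> m (of_real k\<^sub>0 + - of_real \<Omega> * of_real h) (g (of_real t\<^sub>1 + of_real h)) = 0"
    using ev unfolding eventually_nhds by metis
  have "((\<lambda>h::real. 0) has_vector_derivative \<nu> * c' - \<mu>c * of_real \<Omega>) (at 0)"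
    by (rule has_vector_derivative_transform_within_open[OF D N])
  then have "\<nu> * c' - \<mu>c * of_real \<Omega> = 0"
    using vector_derivative_unique_at has_vector_derivative_const by blast
  then have "\<mu>c \<noteq> 0" using \<open>\<nu> \<noteq> 0\<close> \<open>c' \<noteq> 0\<close> by auto
  have \<mu>_eq: "of_real (Re \<mu>c) = \<mu>c" using \<open>Im \<mu>c = 0\<close> by (simp add: complex_eq_iff)
  show ?thesis
  proof (rule that[of "Re \<mu>c"])
    show "Re \<mu>c \<noteq> 0" using \<open>\<mu>c \<noteq> 0\<close> \<mu>_eq by force
    show "((\<lambda>s. complex_Melnikov E \<Omega> A\<^sub>0 (2 * pi * of_int q) (of_real (- \<Omega> * t\<^sub>1) + s) (of_real (C\<^sub>0 t\<^sub>1)))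
        has_field_derivative of_real (Re \<mu>c)) (at 0)"
      using D\<mu> unfolding m_def k\<^sub>0_def C\<^sub>1_def \<mu>_eq .
  qed
qed

section \<open>Choice of constants and conclusion\<close>

text \<open>The order of the choices matters: \<open>\<rho>\<close> depends on the problem only, the radius \<open>R\<close> may then be
chosen depending on \<open>\<rho>\<close> (it has to be so small that the nonlinear part of \<open>\<omega>\<close> is
\<open>\<rho>\<close>-Lipschitz on it), and \<open>\<epsilon>\<^sub>0\<close> and \<open>c\<close> come last. As \<open>\<epsilon>\<^sub>0\<close> tends to \<open>0\<close>, the constants \<open>a\<close> and \<open>b\<close>
tend to multiples of \<open>\<rho>\<close>, and the bounds \<open>y\<close> and \<open>x\<close> tend to \<open>0\<close>.\<close>

lemma contraction_constants:
  fixes L Z B \<omega>\<^sub>1 \<mu> :: real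
  assumes "L \<ge> 0" "Z \<ge> 0" "B \<ge> 0" "\<omega>\<^sub>1 \<noteq> 0" "\<mu> \<noteq> 0"
  obtains \<rho> where "\<rho> > 0"
    "\<And>R. R > 0 \<Longrightarrow> \<exists>\<epsilon>\<^sub>0>0. \<exists>c>0. \<exists>a b y x. c \<le> R \<and>
      contraction_bounds L Z B \<omega>\<^sub>1 \<mu> \<rho> R \<epsilon>\<^sub>0 c a b y x"
proof -
  have cancel: "u * (v / (c * u)) = v / c" if "u > 0" for u v c :: real using that by simp
  have pos: "L + 1 > 0" "Z + 1 > 0" using assms by auto
  \<comment> \<open>the common upper bound aimed at for the Lipschitz constants of action and angle\<close>
  define \<kappa> where "\<kappa> = min (1 / 2) (\<bar>\<mu>\<bar> / (8 * (L + 1)))"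
  have \<kappa>: "\<kappa> > 0" using assms by (simp add: \<kappa>_def)
  have \<kappa>': "\<kappa> \<le> 1 / 2" unfolding \<kappa>_def by (rule min.cobounded1)
  have "L * \<kappa> \<le> (L + 1) * (\<bar>\<mu>\<bar> / (8 * (L + 1)))"
    using assms \<kappa> by (intro mult_mono) (auto simp: \<kappa>_def)
  then have L\<kappa>: "L * \<kappa> \<le> \<bar>\<mu>\<bar> / 8" unfolding cancel[OF pos(1)] .
  define \<rho> where "\<rho> = min (\<kappa> * \<bar>\<omega>\<^sub>1\<bar> / 2) (\<kappa> / (4 * (Z + 1)))"
  have \<rho>: "\<rho> > 0" using \<kappa> assms by (simp add: \<rho>_def)
  have \<rho>1: "\<rho> / \<bar>\<omega>\<^sub>1\<bar> < \<kappa>"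
  proof -
    have "\<rho> \<le> \<kappa> * \<bar>\<omega>\<^sub>1\<bar> / 2" unfolding \<rho>_def by (rule min.cobounded1)
    also have "\<dots> < \<kappa> * \<bar>\<omega>\<^sub>1\<bar>" using \<kappa> assms by simp
    finally show ?thesis using assms by (simp add: divide_less_eq)
  qed
  have \<rho>2: "Z * (\<rho> + \<bar>\<omega>\<^sub>1\<bar> * (\<rho> / \<bar>\<omega>\<^sub>1\<bar>)) < \<kappa>"
  proof -
    have "Z * \<rho> \<le> (Z + 1) * (\<kappa> / (4 * (Z + 1)))"
      using assms \<rho> by (intro mult_mono) (auto simp: \<rho>_def)
    then have "Z * \<rho> \<le> \<kappa> / 4" unfolding cancel[OF pos(2)] .
    then show ?thesis using \<kappa> assms by (simp add: algebra_simps)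
  qed
  show ?thesis
  proof (rule that[OF \<rho>])
    fix R :: real assume "R > 0"
    define R' where "R' = min (R / 2) (R * \<bar>\<mu>\<bar> / (8 * (L + 1)))"
    have R': "R' > 0" using assms \<open>R > 0\<close> by (simp add: R'_def)
    have R'': "R' \<le> R / 2" unfolding R'_def by (rule min.cobounded1)
    have "L * R' \<le> (L + 1) * (R * \<bar>\<mu>\<bar> / (8 * (L + 1)))"
      using assms R' by (intro mult_mono) (auto simp: R'_def)
    then have LR': "L * R' \<le> R * \<bar>\<mu>\<bar> / 8" unfolding cancel[OF pos(1)] .
    define a where "a = (\<lambda>\<epsilon>. \<epsilon> * Z * (3 * L) + (\<rho> + \<epsilon> * (3 * L)) / \<bar>\<omega>\<^sub>1\<bar>)"
    define b where "b = (\<lambda>\<epsilon>. Z * (\<rho> + \<epsilon> * (3 * L) + \<bar>\<omega>\<^sub>1\<bar> * a \<epsilon>))"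
    define y where "y = (\<lambda>\<epsilon>. \<epsilon> * Z * B + \<epsilon> * B / \<bar>\<omega>\<^sub>1\<bar>)"
    define x where "x = (\<lambda>\<epsilon>. Z * (\<epsilon> * B + \<bar>\<omega>\<^sub>1\<bar> * y \<epsilon>))"
    have la: "(a \<longlongrightarrow> \<rho> / \<bar>\<omega>\<^sub>1\<bar>) (at_right 0)"
      unfolding a_def using assms by (auto intro!: tendsto_eq_intros)
    have lb: "(b \<longlongrightarrow> Z * (\<rho> + \<bar>\<omega>\<^sub>1\<bar> * (\<rho> / \<bar>\<omega>\<^sub>1\<bar>))) (at_right 0)"
      unfolding b_def using la by (auto intro!: tendsto_eq_intros)
    have ly: "(y \<longlongrightarrow> 0) (at_right 0)"
      unfolding y_def using assms by (auto intro!: tendsto_eq_intros)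
    have lx: "(x \<longlongrightarrow> 0) (at_right 0)"
      unfolding x_def using ly by (auto intro!: tendsto_eq_intros)
    have "eventually (\<lambda>\<epsilon>. \<epsilon> > 0 \<and> a \<epsilon> < \<kappa> \<and> b \<epsilon> < \<kappa> \<and> y \<epsilon> < R' \<and> x \<epsilon> < R') (at_right (0::real))"
      using eventually_at_right_less[of "0::real"] order_tendstoD(2)[OF la \<rho>1] order_tendstoD(2)[OF lb \<rho>2]
        order_tendstoD(2)[OF ly R'] order_tendstoD(2)[OF lx R']
      by eventually_elim simp
    then obtain \<epsilon>\<^sub>0 where \<epsilon>\<^sub>0: "\<epsilon>\<^sub>0 > 0" "a \<epsilon>\<^sub>0 < \<kappa>" "b \<epsilon>\<^sub>0 < \<kappa>" "y \<epsilon>\<^sub>0 < R'" "x \<epsilon>\<^sub>0 < R'"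
      using eventually_happens'[OF trivial_limit_at_right_real] by blast
    have "L * (a \<epsilon>\<^sub>0 + b \<epsilon>\<^sub>0) \<le> L * (\<kappa> + \<kappa>)"
      using \<epsilon>\<^sub>0 assms by (intro mult_left_mono) auto
    then have 1: "L * (a \<epsilon>\<^sub>0 + b \<epsilon>\<^sub>0) \<le> \<bar>\<mu>\<bar> / 4" using L\<kappa> by (simp add: algebra_simps)
    have "L * (x \<epsilon>\<^sub>0 + y \<epsilon>\<^sub>0 + R') \<le> L * (R' + R' + R')"
      using \<epsilon>\<^sub>0 assms by (intro mult_left_mono) auto
    moreover have "R * \<bar>\<mu>\<bar> \<ge> 0" using \<open>R > 0\<close> by simp
    ultimately have 2: "L * (x \<epsilon>\<^sub>0 + y \<epsilon>\<^sub>0 + R') \<le> \<bar>\<mu>\<bar> * (R / 2)"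
      using LR' by (simp add: algebra_simps)
    have "contraction_bounds L Z B \<omega>\<^sub>1 \<mu> \<rho> R \<epsilon>\<^sub>0 R' (a \<epsilon>\<^sub>0) (b \<epsilon>\<^sub>0) (y \<epsilon>\<^sub>0) (x \<epsilon>\<^sub>0)"
      unfolding contraction_bounds_def
    proof (intro conjI 1 2)
      show "a \<epsilon>\<^sub>0 = \<epsilon>\<^sub>0 * Z * (3 * L) + (\<rho> + \<epsilon>\<^sub>0 * (3 * L)) / \<bar>\<omega>\<^sub>1\<bar>" by (simp add: a_def)
      show "b \<epsilon>\<^sub>0 = Z * (\<rho> + \<epsilon>\<^sub>0 * (3 * L) + \<bar>\<omega>\<^sub>1\<bar> * a \<epsilon>\<^sub>0)" by (simp add: b_def)
      show "y \<epsilon>\<^sub>0 = \<epsilon>\<^sub>0 * Z * B + \<epsilon>\<^sub>0 * B / \<bar>\<omega>\<^sub>1\<bar>" by (simp add: y_def)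
      show "x \<epsilon>\<^sub>0 = Z * (\<epsilon>\<^sub>0 * B + \<bar>\<omega>\<^sub>1\<bar> * y \<epsilon>\<^sub>0)" by (simp add: x_def)
    qed (use \<epsilon>\<^sub>0 \<kappa>' R'' in linarith)+
    then show "\<exists>\<epsilon>\<^sub>0>0. \<exists>c>0. \<exists>a b y x. c \<le> R \<and> contraction_bounds L Z B \<omega>\<^sub>1 \<mu> \<rho> R \<epsilon>\<^sub>0 c a b y x"
      using \<epsilon>\<^sub>0(1) R' R'' \<open>R > 0\<close> by (metis less_eq_real_def order.trans field_sum_of_halves add_increasing half_gt_zero)
  qed
qed

lemma contraction_bounds_mono:
  assumes "contraction_bounds L Z B \<omega>\<^sub>1 \<mu> \<rho> R \<epsilon>\<^sub>0 c a b y x" "c' \<le> c" "L \<ge> 0"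
  shows "contraction_bounds L Z B \<omega>\<^sub>1 \<mu> \<rho> R \<epsilon>\<^sub>0 c' a b y x"
proof -
  have "L * (x + y + c') \<le> L * (x + y + c)" using assms(2,3) by (intro mult_left_mono) auto
  then show ?thesis using assms(1) unfolding contraction_bounds_def by auto
qed

lemma real_analytic_on_affine: "real_analytic_on (\<lambda>e::real. a + b * e) S"
  unfolding real_analytic_on_real_iff
proof
  fix x :: real
  define c where "c = (\<lambda>n::nat. if n = 0 then a + b * x else if n = 1 then b else 0)"
  have "((\<lambda>n. c n * (y - x) ^ n) has_sum a + b * y) UNIV" for y
  proof -
    have "((\<lambda>n. c n * (y - x) ^ n) has_sum (\<Sum>n\<in>{0,1}. c n * (y - x) ^ n)) {0,1}"
      by (rule has_sum_finite) simp
    also have "(\<Sum>n\<in>{0,1}. c n * (y - x) ^ n) = a + b * y"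
      by (simp add: c_def algebra_simps)
    also have "((\<lambda>n. c n * (y - x) ^ n) has_sum a + b * y) {0,1} \<longleftrightarrow> ((\<lambda>n. c n * (y - x) ^ n) has_sum a + b * y) UNIV"
      by (rule has_sum_cong_neutral) (auto simp: c_def)
    finally show ?thesis .
  qed
  then show "\<exists>r>0. \<exists>c. \<forall>y\<in>ball x r. ((\<lambda>n. c n * (y - x) ^ n) has_sum a + b * y) UNIV"
    by (intro exI[of _ 1] conjI exI[of _ c]) auto
qed

text \<open>The analytic choice of the parameter is the constant one: the phase adapts to the parameter.\<close>

lemma subharmonic_solution_of_family:
  assumes an: "real_analytic_on (\<lambda>(e, t). \<alpha> e t) ({-\<epsilon>\<^sub>0<..<\<epsilon>\<^sub>0} \<times> UNIV)"
      "real_analytic_on (\<lambda>(e, t). A e t) ({-\<epsilon>\<^sub>0<..<\<epsilon>\<^sub>0} \<times> UNIV)"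
    and unperturbed: "\<And>t. \<alpha> 0 t = of_int p / of_int q * t + \<kappa>" "\<And>t. A 0 t = A\<^sub>0"
    and solves: "\<And>e. \<bar>e\<bar> < \<epsilon>\<^sub>0 \<Longrightarrow> solves_system W \<omega> F G e C (\<alpha> e) (A e)"
    and periodic: "\<And>e. \<bar>e\<bar> < \<epsilon>\<^sub>0 \<Longrightarrow> resonant_periodic p q (\<alpha> e) (A e)"
    and e: "\<bar>e\<bar> < \<epsilon>\<^sub>0"
  shows "subharmonic_solution W \<omega> F G A\<^sub>0 p q e C (\<alpha> e) (A e)"
  unfolding subharmonic_solution_def
proof (intro conjI solves[OF e] periodic[OF e] exI)
  show "open {-\<epsilon>\<^sub>0<..<\<epsilon>\<^sub>0}" "is_interval {-\<epsilon>\<^sub>0<..<\<epsilon>\<^sub>0}"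
    by (simp_all add: is_interval_oo)
  show "0 \<in> {-\<epsilon>\<^sub>0<..<\<epsilon>\<^sub>0}" "e \<in> {-\<epsilon>\<^sub>0<..<\<epsilon>\<^sub>0}" using e by (auto simp: abs_less_iff)
  show "real_analytic_on (\<lambda>e. C) {-\<epsilon>\<^sub>0<..<\<epsilon>\<^sub>0}"
    using real_analytic_on_affine[of C 0] by simp
  show "\<forall>e\<in>{-\<epsilon>\<^sub>0<..<\<epsilon>\<^sub>0}. solves_system W \<omega> F G e C (\<alpha> e) (A e) \<and> resonant_periodic p q (\<alpha> e) (A e)"
    using solves periodic by (auto simp: abs_less_iff)
  show "\<forall>t. \<alpha> 0 t = of_int p / of_int q * t + \<kappa> \<and> A 0 t = A\<^sub>0"
    using unperturbed by blast
qed (rule an refl)+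

theorem theorem2:
  fixes W :: "real set" and \<omega> :: "real \<Rightarrow> real"
    and F G :: "real \<Rightarrow> real \<Rightarrow> real \<Rightarrow> real \<Rightarrow> real"
    and p q :: int and A\<^sub>0 :: real and C\<^sub>0 :: "real \<Rightarrow> real"
  assumes "open W"
    and "real_analytic_on \<omega> W"
    and "admissible_perturbation W F"
    and "admissible_perturbation W G"
    and "coprime p q" and "p \<noteq> 0" and "q \<ge> 1"
    and "A\<^sub>0 \<in> W" and "\<omega> A\<^sub>0 = of_int p / of_int q"
    and "deriv \<omega> A\<^sub>0 \<noteq> 0"
    and "real_analytic_on C\<^sub>0 UNIV"
    and "\<forall>t. C\<^sub>0 (t + 2 * pi) = C\<^sub>0 t"
    and "\<forall>t\<^sub>0\<in>{0..<2 * pi}.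
           subharmonic_Melnikov \<omega> G A\<^sub>0 q t\<^sub>0 (C\<^sub>0 t\<^sub>0) = 0 \<and>
           deriv (\<lambda>C. subharmonic_Melnikov \<omega> G A\<^sub>0 q t\<^sub>0 C) (C\<^sub>0 t\<^sub>0) \<noteq> 0"
    and "\<forall>t\<^sub>m\<in>{0..<2 * pi}. \<forall>t\<^sub>M\<in>{0..<2 * pi}.
           (\<forall>t\<in>{0..<2 * pi}. C\<^sub>0 t\<^sub>m \<le> C\<^sub>0 t \<and> C\<^sub>0 t \<le> C\<^sub>0 t\<^sub>M) \<longrightarrow>
           deriv (deriv C\<^sub>0) t\<^sub>m * deriv (deriv C\<^sub>0) t\<^sub>M \<noteq> 0"
  shows "\<exists>\<epsilon>\<^sub>0 > 0. \<exists>\<gamma>\<^sub>1 \<gamma>\<^sub>2 :: real \<Rightarrow> real.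
    real_analytic_on \<gamma>\<^sub>1 {-\<epsilon>\<^sub>0<..<\<epsilon>\<^sub>0} \<and>
    real_analytic_on \<gamma>\<^sub>2 {-\<epsilon>\<^sub>0<..<\<epsilon>\<^sub>0} \<and>
    \<gamma>\<^sub>1 0 = \<gamma>\<^sub>2 0 \<and> \<gamma>\<^sub>1 0 = 0 \<and>
    (\<forall>\<epsilon>\<in>{0<..<\<epsilon>\<^sub>0}. \<gamma>\<^sub>1 \<epsilon> > \<gamma>\<^sub>2 \<epsilon>) \<and>
    (\<forall>\<epsilon>\<in>{-\<epsilon>\<^sub>0<..<0}. \<gamma>\<^sub>1 \<epsilon> < \<gamma>\<^sub>2 \<epsilon>) \<and>
    deriv \<gamma>\<^sub>1 0 \<noteq> deriv \<gamma>\<^sub>2 0 \<and>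
    (\<forall>\<epsilon>\<in>{0<..<\<epsilon>\<^sub>0}. \<forall>C. \<gamma>\<^sub>2 \<epsilon> \<le> \<epsilon> * C \<and> \<epsilon> * C \<le> \<gamma>\<^sub>1 \<epsilon> \<longrightarrow>
       (\<exists>\<alpha> A. subharmonic_solution W \<omega> F G A\<^sub>0 p q \<epsilon> C \<alpha> A)) \<and>
    (\<forall>\<epsilon>\<in>{-\<epsilon>\<^sub>0<..<0}. \<forall>C. \<gamma>\<^sub>1 \<epsilon> \<le> \<epsilon> * C \<and> \<epsilon> * C \<le> \<gamma>\<^sub>2 \<epsilon> \<longrightarrow>
       (\<exists>\<alpha> A. subharmonic_solution W \<omega> F G A\<^sub>0 p q \<epsilon> C \<alpha> A))"
proof -
  define \<Omega> :: real where "\<Omega> = of_int p / of_int q"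
  have \<omega>: "\<omega> A\<^sub>0 = \<Omega>" using assms(9) by (simp add: \<Omega>_def)
  have "\<Omega> \<noteq> 0" using assms(6,7) by (simp add: \<Omega>_def)
  obtain t\<^sub>1 where t\<^sub>1: "0 < t\<^sub>1" "t\<^sub>1 < 2 * pi" "deriv C\<^sub>0 t\<^sub>1 \<noteq> 0"
    using nonconstant_periodic_has_nonzero_deriv[OF assms(11,12,14)] by metis
  define C\<^sub>1 where "C\<^sub>1 = C\<^sub>0 t\<^sub>1"
  obtain \<delta>F BF EF where F: "\<delta>F > 0" "complex_extension F A\<^sub>0 C\<^sub>1 \<delta>F BF EF"
    by (rule complex_extension_exists[OF assms(1,3,8)])
  obtain \<delta>G BG EG where G: "\<delta>G > 0" "complex_extension G A\<^sub>0 C\<^sub>1 \<delta>G BG EG"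
    by (rule complex_extension_exists[OF assms(1,4,8)])
  define \<delta> where "\<delta> = min \<delta>F \<delta>G"
  define B where "B = max 0 (max BF BG)"
  have \<delta>: "\<delta> > 0" and B: "B \<ge> 0" using F G by (simp_all add: \<delta>_def B_def)
  have EF: "complex_extension F A\<^sub>0 C\<^sub>1 \<delta> B EF"
    by (rule complex_extension_shrink[OF F(2)]) (simp_all add: \<delta>_def B_def)
  have EG: "complex_extension G A\<^sub>0 C\<^sub>1 \<delta> B EG"
    by (rule complex_extension_shrink[OF G(2)]) (simp_all add: \<delta>_def B_def)
  obtain d r where d: "d > 0" and r: "r holomorphic_on ball 0 d" "r 0 = 0" "deriv r 0 = 0"
    and r_eq: "\<And>y. \<bar>y\<bar> < d \<Longrightarrow> A\<^sub>0 + y \<in> W \<and> r (of_real y) = of_real (\<omega> (A\<^sub>0 + y) - \<omega> A\<^sub>0 - deriv \<omega> A\<^sub>0 * y)"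
    by (rule remainder_exists[OF assms(2,1,8)]) blast
  define m where "m = complex_Melnikov EG \<Omega> A\<^sub>0 (2 * pi * of_int q)"
  define k\<^sub>0 where "k\<^sub>0 = - \<Omega> * t\<^sub>1"
  have zero: "subharmonic_Melnikov \<omega> G A\<^sub>0 q t (C\<^sub>0 t) = 0" if "0 \<le> t" "t < 2 * pi" for t
    using assms(13) that by simp
  have dM: "deriv (\<lambda>C. subharmonic_Melnikov \<omega> G A\<^sub>0 q t\<^sub>1 C) (C\<^sub>0 t\<^sub>1) \<noteq> 0"
    using assms(13) t\<^sub>1 by simp
  obtain \<mu> :: real where "\<mu> \<noteq> 0"
    and D\<mu>: "((\<lambda>s. m (of_real k\<^sub>0 + s) (of_real C\<^sub>1)) has_field_derivative of_real \<mu>) (at 0)"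
    unfolding m_def k\<^sub>0_def C\<^sub>1_def
    by (rule Melnikov_phase_derivative_nonzero[where \<omega> = \<omega>, OF EG[unfolded C\<^sub>1_def] \<delta> \<Omega>_def assms(7) \<open>\<Omega> \<noteq> 0\<close> \<omega>
          assms(11) t\<^sub>1 zero dM])
  have m0: "m (of_real k\<^sub>0) (of_real C\<^sub>1) = 0"
    using complex_Melnikov_eq[where \<omega> = \<omega>, OF EG \<delta> \<Omega>_def assms(7) _ \<omega>, of C\<^sub>1 t\<^sub>1] zero[of t\<^sub>1] t\<^sub>1 \<delta>
    by (simp add: m_def k\<^sub>0_def C\<^sub>1_def)
  obtain \<eta> where \<eta>: "\<eta> > 0"
    and approx: "\<And>s. norm s < \<eta> \<Longrightarrow> norm (m (of_real k\<^sub>0 + s) (of_real C\<^sub>1) - of_real \<mu> * s) \<le> \<bar>\<mu>\<bar> / 8 * norm s"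
  proof -
    have "\<bar>\<mu>\<bar> / 8 > 0" using \<open>\<mu> \<noteq> 0\<close> by simp
    then obtain \<eta> where "\<eta> > 0" "\<forall>s. norm (s - 0) < \<eta> \<longrightarrow>
        norm (m (of_real k\<^sub>0 + s) (of_real C\<^sub>1) - m (of_real k\<^sub>0 + 0) (of_real C\<^sub>1) - of_real \<mu> * (s - 0)) \<le> \<bar>\<mu>\<bar> / 8 * norm (s - 0)"
      using D\<mu> unfolding has_field_derivative_def has_derivative_at_alt by blast
    then show ?thesis by (intro that[of \<eta>]) (simp_all add: m0)
  qed
  define \<sigma> where "\<sigma> = \<delta> / (8 * (\<bar>\<Omega>\<bar> + 1))"
  have \<sigma>: "\<sigma> > 0" "8 * (\<bar>\<Omega>\<bar> + 1) * \<sigma> \<le> \<delta>"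
    using \<delta> by (simp_all add: \<sigma>_def add_nonneg_pos)
  have q: "real_of_int q \<ge> 1" using assms(7) by simp
  have "4 * B / \<delta> \<ge> 0" "4 * (2 * pi * of_int q + \<sigma>) \<ge> 0" using B \<delta> \<sigma> q by simp_all
  from contraction_constants[OF this B assms(10) \<open>\<mu> \<noteq> 0\<close>]
  obtain \<rho> where \<rho>: "\<rho> > 0"
    and const: "\<And>R. R > 0 \<Longrightarrow> \<exists>\<epsilon>\<^sub>0>0. \<exists>c>0. \<exists>a b y x. c \<le> R \<and>
      contraction_bounds (4 * B / \<delta>) (4 * (2 * pi * of_int q + \<sigma>)) B (deriv \<omega> A\<^sub>0) \<mu> \<rho> R \<epsilon>\<^sub>0 c a b y x"
    by blast
  obtain R\<^sub>1 where R\<^sub>1: "R\<^sub>1 > 0"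
    and r_lip: "\<And>y y'. norm y \<le> R\<^sub>1 \<Longrightarrow> norm y' \<le> R\<^sub>1 \<Longrightarrow> norm (r y - r y') \<le> \<rho> * norm (y - y')"
    using lipschitz_of_deriv_0[OF r(1) d r(3) \<rho>] by metis
  \<comment> \<open>the last entry makes the second difference estimate small against \<open>\<mu>\<close>; the divisors of the others leave the room that the locale asks for\<close>
  define R where "R = Min {R\<^sub>1, d / 4, \<delta> / 32, \<eta> / 4, \<bar>\<mu>\<bar> * \<delta>\<^sup>2 / (2048 * (B + 1))}"
  have R: "R > 0"
    using R\<^sub>1 d \<delta> \<eta> \<open>\<mu> \<noteq> 0\<close> B by (simp add: R_def)
  have R_le: "R \<le> R\<^sub>1" "R \<le> d / 4" "R \<le> \<delta> / 32" "R \<le> \<eta> / 4" "R \<le> \<bar>\<mu>\<bar> * \<delta>\<^sup>2 / (2048 * (B + 1))"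
    unfolding R_def by (intro Min_le; simp)+
  have R_small: "64 * B / \<delta>\<^sup>2 * (4 * R) \<le> \<bar>\<mu>\<bar> / 8"
  proof -
    have "2048 * (B + 1) * R \<le> \<bar>\<mu>\<bar> * \<delta>\<^sup>2"
      using R_le(5) B by (simp add: pos_le_divide_eq mult.commute)
    moreover have "2048 * B * R \<le> 2048 * (B + 1) * R" using R by (intro mult_right_mono) auto
    ultimately have "2048 * B * R \<le> \<bar>\<mu>\<bar> * \<delta>\<^sup>2" by linarith
    then show ?thesis using \<delta> by (simp add: field_simps)
  qed
  obtain \<epsilon>\<^sub>0 c a b y x where \<epsilon>\<^sub>0: "\<epsilon>\<^sub>0 > 0" and c: "c > 0" "c \<le> R"
    and bounds: "contraction_bounds (4 * B / \<delta>) (4 * (2 * pi * of_int q + \<sigma>)) B (deriv \<omega> A\<^sub>0) \<mu> \<rho> R \<epsilon>\<^sub>0 c a b y x"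
    using const[OF R] by metis
  have solution: "\<exists>\<alpha> A. subharmonic_solution W \<omega> F G A\<^sub>0 p q e C \<alpha> A"
    if C: "\<bar>C - C\<^sub>1\<bar> \<le> c" and e: "\<bar>e\<bar> < \<epsilon>\<^sub>0" for C e
  proof -
    have bounds_C: "contraction_bounds (4 * B / \<delta>) (4 * (2 * pi * of_int q + \<sigma>)) B (deriv \<omega> A\<^sub>0) \<mu> \<rho> R
        \<epsilon>\<^sub>0 \<bar>C - C\<^sub>1\<bar> a b y x"
      by (rule contraction_bounds_mono[OF bounds C]) (use B \<delta> in simp)
    interpret resonant_torus F G A\<^sub>0 C\<^sub>1 \<delta> B \<Omega> "deriv \<omega> A\<^sub>0" \<sigma> p q EF EG r k\<^sub>0 \<mu> R \<rho> \<epsilon>\<^sub>0 C a b y x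
    proof (unfold_locales; (rule EF EG B \<sigma> \<Omega>_def assms(7,10) \<open>\<mu> \<noteq> 0\<close> R r(2) R_small \<epsilon>\<^sub>0 bounds_C)?)
      show "32 * R \<le> \<delta>" using R_le by simp
      show "r holomorphic_on ball 0 (2 * R)"
        using r(1) R_le(2) R by (auto intro: holomorphic_on_subset)
      show "r (of_real y) \<in> \<real>" if "\<bar>y\<bar> \<le> R" for y
        using r_eq[of y] that R_le(2) d by simp
      show "norm (r y - r y') \<le> \<rho> * norm (y - y')" if "norm y \<le> R" "norm y' \<le> R" for y y'
        using that R_le(1) by (intro r_lip) auto
      show "0 \<le> \<rho>" using \<rho> by simp
      show "mean (2 * pi * of_int q) (\<lambda>t. EG (of_real \<Omega> * t + of_real k\<^sub>0) (of_real A\<^sub>0) (of_real C\<^sub>1) t) = 0"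
        using m0 by (simp add: m_def complex_Melnikov_def)
      show "norm (mean (2 * pi * of_int q) (\<lambda>t. EG (of_real \<Omega> * t + of_real k\<^sub>0 + s) (of_real A\<^sub>0) (of_real C\<^sub>1) t) - of_real \<mu> * s)
          \<le> \<bar>\<mu>\<bar> / 8 * norm s" if "norm s \<le> 2 * R" for s
        using approx[of s] that R_le(4) \<eta> by (simp add: m_def complex_Melnikov_def add.assoc)
      show "\<bar>C - C\<^sub>1\<bar> \<le> R" using C c by simp
    qed
    obtain \<alpha> A \<kappa> where an: "real_analytic_on (\<lambda>(e, t). \<alpha> e t) ({-\<epsilon>\<^sub>0<..<\<epsilon>\<^sub>0} \<times> UNIV)"
        "real_analytic_on (\<lambda>(e, t). A e t) ({-\<epsilon>\<^sub>0<..<\<epsilon>\<^sub>0} \<times> UNIV)"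
      and unperturbed: "\<And>t. \<alpha> 0 t = \<Omega> * t + \<kappa>" "\<And>t. A 0 t = A\<^sub>0"
      and A_R: "\<And>e t. \<bar>e\<bar> < \<epsilon>\<^sub>0 \<Longrightarrow> \<bar>A e t - A\<^sub>0\<bar> \<le> R"
      and D\<alpha>: "\<And>e t. \<bar>e\<bar> < \<epsilon>\<^sub>0 \<Longrightarrow> (\<alpha> e has_real_derivative
        \<Omega> + deriv \<omega> A\<^sub>0 * (A e t - A\<^sub>0) + Re (r (of_real (A e t - A\<^sub>0))) + e * F (\<alpha> e t) (A e t) C t) (at t)"
      and DA: "\<And>e t. \<bar>e\<bar> < \<epsilon>\<^sub>0 \<Longrightarrow> (A e has_real_derivative e * G (\<alpha> e t) (A e t) C t) (at t)"
      and per_\<alpha>: "\<And>e t. \<bar>e\<bar> < \<epsilon>\<^sub>0 \<Longrightarrow> \<alpha> e (t + T) = \<alpha> e t + \<Omega> * T"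
      and per_A: "\<And>e t. \<bar>e\<bar> < \<epsilon>\<^sub>0 \<Longrightarrow> A e (t + T) = A e t"
      by (rule periodic_solutions_exist) blast
    have solves: "solves_system W \<omega> F G e C (\<alpha> e) (A e)" if e: "\<bar>e\<bar> < \<epsilon>\<^sub>0" for e
      unfolding solves_system_def
    proof (intro allI conjI DA[OF e])
      fix t
      have "\<bar>A e t - A\<^sub>0\<bar> < d" using A_R[OF e, of t] R_le(2) d by linarith
      from r_eq[OF this] have W: "A e t \<in> W"
        and "Re (r (of_real (A e t - A\<^sub>0))) = \<omega> (A e t) - \<Omega> - deriv \<omega> A\<^sub>0 * (A e t - A\<^sub>0)"
        by (simp_all add: \<omega>)
      then have "\<Omega> + deriv \<omega> A\<^sub>0 * (A e t - A\<^sub>0) + Re (r (of_real (A e t - A\<^sub>0))) = \<omega> (A e t)" by simp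
      then show "(\<alpha> e has_real_derivative \<omega> (A e t) + e * F (\<alpha> e t) (A e t) C t) (at t)"
        using D\<alpha>[OF e, of t] by simp
      show "A e t \<in> W" by (rule W)
    qed
    have periodic: "resonant_periodic p q (\<alpha> e) (A e)" if e: "\<bar>e\<bar> < \<epsilon>\<^sub>0" for e
      using per_\<alpha>[OF e] per_A[OF e] unfolding resonant_periodic_def Let_def T_def \<Omega>_def
      by (simp only:) (simp add: algebra_simps)
    show ?thesis
      using subharmonic_solution_of_family[OF an unperturbed[unfolded \<Omega>_def] solves periodic e] by blast
  qed
  \<comment> \<open>the two curves are straight lines whose slopes are the endpoints of the interval of admissible \<open>C\<close>\<close>
  have deriv_linear: "deriv (\<lambda>\<epsilon>::real. \<epsilon> * u) 0 = u" for u
    by (rule DERIV_imp_deriv) (auto intro!: derivative_eq_intros)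
  have an_linear: "real_analytic_on (\<lambda>\<epsilon>. \<epsilon> * u) S" for u S
    using real_analytic_on_affine[of 0 u S] by (simp add: mult.commute)
  show ?thesis
  proof (rule exI[of _ \<epsilon>\<^sub>0], rule conjI[OF \<epsilon>\<^sub>0], rule exI[of _ "\<lambda>\<epsilon>. \<epsilon> * (C\<^sub>1 + c)"],
      rule exI[of _ "\<lambda>\<epsilon>. \<epsilon> * (C\<^sub>1 - c)"], intro conjI ballI allI impI an_linear)
    show "deriv (\<lambda>\<epsilon>. \<epsilon> * (C\<^sub>1 + c)) 0 \<noteq> deriv (\<lambda>\<epsilon>. \<epsilon> * (C\<^sub>1 - c)) 0"
      unfolding deriv_linear using c by simp
    show "\<epsilon> * (C\<^sub>1 - c) < \<epsilon> * (C\<^sub>1 + c)" if "\<epsilon> \<in> {0<..<\<epsilon>\<^sub>0}" for \<epsilon>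
      using that c by (intro mult_strict_left_mono) auto
    show "\<epsilon> * (C\<^sub>1 + c) < \<epsilon> * (C\<^sub>1 - c)" if "\<epsilon> \<in> {-\<epsilon>\<^sub>0<..<0}" for \<epsilon>
      using that c by (intro mult_strict_left_mono_neg) auto
    show "\<exists>\<alpha> A. subharmonic_solution W \<omega> F G A\<^sub>0 p q \<epsilon> C \<alpha> A"
      if "\<epsilon> \<in> {0<..<\<epsilon>\<^sub>0}" "\<epsilon> * (C\<^sub>1 - c) \<le> \<epsilon> * C \<and> \<epsilon> * C \<le> \<epsilon> * (C\<^sub>1 + c)" for \<epsilon> C
    proof (rule solution)
      have "C\<^sub>1 - c \<le> C" "C \<le> C\<^sub>1 + c" using that by (simp_all add: mult_le_cancel_left_pos)
      then show "\<bar>C - C\<^sub>1\<bar> \<le> c" by linarith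
    qed (use that in auto)
    show "\<exists>\<alpha> A. subharmonic_solution W \<omega> F G A\<^sub>0 p q \<epsilon> C \<alpha> A"
      if "\<epsilon> \<in> {-\<epsilon>\<^sub>0<..<0}" "\<epsilon> * (C\<^sub>1 + c) \<le> \<epsilon> * C \<and> \<epsilon> * C \<le> \<epsilon> * (C\<^sub>1 - c)" for \<epsilon> C
    proof (rule solution)
      have "C\<^sub>1 - c \<le> C" "C \<le> C\<^sub>1 + c" using that by (simp_all add: mult_le_cancel_left_neg)
      then show "\<bar>C - C\<^sub>1\<bar> \<le> c" by linarith
    qed (use that in auto)
  qed simp_all
qed

end
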